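(* Let $E$ be a metric space and let $\bar C(E)$ be the space of bounded and uniformly continuous functions on $E$. For each index $\alpha$, let $X_\alpha$ be a process with sample paths in $D([0,\infty),E)$, defined on a probability space $(\Omega_\alpha,\mathcal{F}^\alpha,P_\alpha)$ and adapted to a filtration $\{\mathcal{F}^\alpha_t\}$, and let $A_\alpha$ be an increasing process which is adapted to $\{\mathcal{F}^\alpha_t\}$ and satisfies, for every $T>0$, $$\lim_{\delta\to0}\sup_\alpha\mathbf{E}\Big[\sup_{0\le r\le T}|A_\alpha(r+\delta)-A_\alpha(r)|\Big]=0.$$ Suppose that $C_a$ is a subalgebra of $\bar C(E)$. Let $D$ be the collection of $f\in\bar C(E)$ such that for every $\varepsilon>0$ and $T>0$ there exist $(Y_\alpha,Z_\alpha)\in\mathcal{A}_\alpha$ with $$\sup_\alpha\mathbf{E}\Big[\sup_{t\in[0,T]\cap\mathbb{Q}}|Y_\alpha(t)-f(X_\alpha(t))|\Big]<\varepsilon$$ and $$\sup_\alpha\mathbf{E}\big[\|Z_\alpha\|_{p,T}^p\big]<\infty\quad\text{for some }p\in(1,\infty].$$ If $C_a$ is contained in $D$, then $\{f\circ X_\alpha\}$ is tight in $D([0,\infty),\mathbb{R})$ for each $f\in C_a$.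
   Context: $D([0,\infty),E)$ is the Skorokhod space of right-continuous paths with left limits from $[0,\infty)$ to $E$, and $\mathbb{Q}$ is the set of rational numbers. $\mathcal{L}_\alpha$ denotes the Banach space of real-valued $\{\mathcal{F}^\alpha_t\}$-progressively measurable processes $Y$ with norm $\|Y\|=\sup_{t\ge0}\mathbf{E}[|Y(t)|]<\infty$. Given $T\ge0$ and $h_\alpha\in\mathcal{L}_\alpha$, define $\|h_\alpha\|_{p,T}=\big[\int_0^T|h_\alpha(t)|^p\,dA_\alpha(t)\big]^{1/p}$ for $0<p<\infty$, and $\|h_\alpha\|_{\infty,T}=\operatorname{ess\,sup}_{0\le t\le T}|h_\alpha(t)|$. Finally, $$\mathcal{A}_\alpha=\Big\{(Y,Z)\in\mathcal{L}_\alpha\times\mathcal{L}_\alpha:\ Y(t)-\int_0^tZ(s)\,dA_\alpha(s)\text{ is an }\{\mathcal{F}^\alpha_t\}\text{-martingale}\Big\}.$$ *)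

theory Defs
  imports "HOL-Probability.Probability"
begin

text \<open>Time is \<open>[0,\<infinity>)\<close>, represented by the nonnegative reals. A process is a function
  \<open>real \<Rightarrow> 'a \<Rightarrow> 'b\<close> (time, then sample point) whose values at negative times are never used.\<close>

definition cadlag :: "(real \<Rightarrow> 'b::metric_space) \<Rightarrow> bool" where
  "cadlag x \<longleftrightarrow>
     (\<forall>t\<ge>0. (x \<longlongrightarrow> x t) (at_right t)) \<and> (\<forall>t>0. \<exists>l. (x \<longlongrightarrow> l) (at_left t))"

text \<open>Extensionality makes a path determined by its values on \<open>[0,\<infinity>)\<close>.\<close>

definition skorokhod_space :: "(real \<Rightarrow> 'b::metric_space) set" where
  "skorokhod_space = {x \<in> extensional {0..}. cadlag x}"

text \<open>The Skorokhod (J1) topology is given by the Ethier--Kurtz metric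
  \[ d(x,y) = \inf_{\lambda\in\Lambda} \Big[\gamma(\lambda) \vee
       \int_0^\infty e^{-u}\, \sup_{t\ge0} q\big(x(t\wedge u), y(\lambda(t)\wedge u)\big)\, du\Big],
     \qquad q = r \wedge 1, \]
  where $\gamma(\lambda) = \sup_{t>s\ge0} |\log\frac{\lambda(t)-\lambda(s)}{t-s}|$ and
  $\Lambda$ is the set of strictly increasing maps of $[0,\infty)$ onto itself with
  $\gamma(\lambda)<\infty$. The infimum is at most 1 (take the identity time change), so
  converting it to a real number loses nothing.\<close>

definition time_change_gamma :: "(real \<Rightarrow> real) \<Rightarrow> ennreal" where
  "time_change_gamma l =
     (SUP (s, t) \<in> {(s, t). 0 \<le> s \<and> s < t}. ennreal \<bar>ln ((l t - l s) / (t - s))\<bar>)"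

definition time_changes :: "(real \<Rightarrow> real) set" where
  "time_changes =
     {l. strict_mono_on {0..} l \<and> l ` {0..} = {0..} \<and> time_change_gamma l < \<infinity>}"

definition stopped_dist ::
  "(real \<Rightarrow> 'b::metric_space) \<Rightarrow> (real \<Rightarrow> 'b) \<Rightarrow> (real \<Rightarrow> real) \<Rightarrow> real \<Rightarrow> ennreal" where
  "stopped_dist x y l u =
     (SUP t\<in>{0..}. ennreal (min (dist (x (min t u)) (y (min (l t) u))) 1))"

definition skorokhod_dist :: "(real \<Rightarrow> 'b::metric_space) \<Rightarrow> (real \<Rightarrow> 'b) \<Rightarrow> real" where
  "skorokhod_dist x y = enn2real
     (INF l\<in>time_changes. max (time_change_gamma l)
        (\<integral>\<^sup>+u\<in>{0..}. ennreal (exp (- u)) * stopped_dist x y l u \<partial>lborel))"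

definition skorokhod_topology :: "(real \<Rightarrow> 'b::metric_space) topology" where
  "skorokhod_topology = Metric_space.mtopology skorokhod_space skorokhod_dist"

text \<open>If \<open>{\<xi> i \<in> K}\<close> is not an event, \<open>measure\<close> gives it the value 0, so measurability of these
  sets is part of the claim (for \<open>\<epsilon> < 1\<close>).\<close>

definition tight_family ::
  "'b topology \<Rightarrow> ('i \<Rightarrow> 'a measure) \<Rightarrow> ('i \<Rightarrow> 'a \<Rightarrow> 'b) \<Rightarrow> bool" where
  "tight_family T M \<xi> \<longleftrightarrow>
     (\<forall>\<epsilon>>0. \<exists>K. compactin T K \<and>
        (\<forall>i. measure (M i) {\<omega> \<in> space (M i). \<xi> i \<omega> \<in> K} \<ge> 1 - \<epsilon>))"

definition filtered :: "'a measure \<Rightarrow> (real \<Rightarrow> 'a measure) \<Rightarrow> bool" where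
  "filtered M F \<longleftrightarrow>
     (\<forall>t\<ge>0. subalgebra M (F t)) \<and> (\<forall>s t. 0 \<le> s \<longrightarrow> s \<le> t \<longrightarrow> subalgebra (F t) (F s))"

definition adapted ::
  "(real \<Rightarrow> 'a measure) \<Rightarrow> (real \<Rightarrow> 'a \<Rightarrow> 'b::topological_space) \<Rightarrow> bool" where
  "adapted F X \<longleftrightarrow> (\<forall>t\<ge>0. X t \<in> F t \<rightarrow>\<^sub>M borel)"

definition progressive :: "(real \<Rightarrow> 'a measure) \<Rightarrow> (real \<Rightarrow> 'a \<Rightarrow> real) \<Rightarrow> bool" where
  "progressive F Y \<longleftrightarrow>
     (\<forall>t\<ge>0. (\<lambda>(s, \<omega>). Y s \<omega>) \<in> borel_measurable (restrict_space borel {0..t} \<Otimes>\<^sub>M F t))"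

text \<open>As usual, increasing processes are right-continuous. Neither \<open>A 0 = 0\<close> nor integrability
  is required.\<close>

definition increasing_process :: "'a measure \<Rightarrow> (real \<Rightarrow> 'a \<Rightarrow> real) \<Rightarrow> bool" where
  "increasing_process M A \<longleftrightarrow>
     (\<forall>\<omega>\<in>space M. mono_on {0..} (\<lambda>t. A t \<omega>) \<and>
        (\<forall>t\<ge>0. continuous (at_right t) (\<lambda>t. A t \<omega>)))"

text \<open>The pathwise Stieltjes measure \<open>dA(\<omega>)\<close>. The path is extended by the constant \<open>A 0 \<omega>\<close> to
  negative times, so the measure lives on \<open>(0,\<infinity>)\<close>.\<close>

definition stieltjes :: "(real \<Rightarrow> 'a \<Rightarrow> real) \<Rightarrow> 'a \<Rightarrow> real measure" where
  "stieltjes A \<omega> = interval_measure (\<lambda>t. A (max 0 t) \<omega>)"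

definition martingale :: "'a measure \<Rightarrow> (real \<Rightarrow> 'a measure) \<Rightarrow> (real \<Rightarrow> 'a \<Rightarrow> real) \<Rightarrow> bool" where
  "martingale M F N \<longleftrightarrow>
     adapted F N \<and> (\<forall>t\<ge>0. integrable M (N t)) \<and>
     (\<forall>s t. 0 \<le> s \<longrightarrow> s \<le> t \<longrightarrow> (AE \<omega> in M. real_cond_exp M (F s) (N t) \<omega> = N s \<omega>))"

definition process_space :: "'a measure \<Rightarrow> (real \<Rightarrow> 'a measure) \<Rightarrow> (real \<Rightarrow> 'a \<Rightarrow> real) set"
  where
  "process_space M F =
     {Y. progressive F Y \<and> (SUP t\<in>{0..}. \<integral>\<^sup>+\<omega>. ennreal \<bar>Y t \<omega>\<bar> \<partial>M) < \<infinity>}"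

text \<open>The pathwise integrals are required to exist almost surely, since the Bochner integral of a
  non-integrable function is 0 by convention.\<close>

definition semimartingale_pairs ::
  "'a measure \<Rightarrow> (real \<Rightarrow> 'a measure) \<Rightarrow> (real \<Rightarrow> 'a \<Rightarrow> real)
     \<Rightarrow> ((real \<Rightarrow> 'a \<Rightarrow> real) \<times> (real \<Rightarrow> 'a \<Rightarrow> real)) set" where
  "semimartingale_pairs M F A =
     {(Y, Z). Y \<in> process_space M F \<and> Z \<in> process_space M F \<and>
        (AE \<omega> in M. \<forall>t\<ge>0. set_integrable (stieltjes A \<omega>) {0..t} (\<lambda>s. Z s \<omega>)) \<and>
        martingale M F (\<lambda>t \<omega>. Y t \<omega> - (LINT s:{0..t}|stieltjes A \<omega>. Z s \<omega>))}"

text \<open>Only used for \<open>r > 0\<close>.\<close>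

definition ennreal_powr :: "ennreal \<Rightarrow> real \<Rightarrow> ennreal" where
  "ennreal_powr x r = (if x = \<infinity> then \<infinity> else ennreal (enn2real x powr r))"

text \<open>The norm of \<open>h\<close> on \<open>[0,T]\<close> with respect to a measure \<open>\<mu>\<close> on the line, for \<open>0 < p \<le> \<infinity>\<close>.
  The essential supremum is taken with respect to the same measure \<open>\<mu>\<close>.\<close>

definition lp_norm :: "real measure \<Rightarrow> ereal \<Rightarrow> real \<Rightarrow> (real \<Rightarrow> real) \<Rightarrow> ennreal" where
  "lp_norm \<mu> p T h =
     (if p = \<infinity> then esssup (restrict_space \<mu> {0..T}) (\<lambda>t. ennreal \<bar>h t\<bar>)
      else ennreal_powr (\<integral>\<^sup>+t\<in>{0..T}. ennreal (\<bar>h t\<bar> powr real_of_ereal p) \<partial>\<mu>)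
             (1 / real_of_ereal p))"

text \<open>The \<open>p\<close>-th power of the norm; for \<open>p = \<infinity>\<close> it is read as the norm itself.\<close>

definition lp_norm_pow :: "real measure \<Rightarrow> ereal \<Rightarrow> real \<Rightarrow> (real \<Rightarrow> real) \<Rightarrow> ennreal" where
  "lp_norm_pow \<mu> p T h =
     (if p = \<infinity> then lp_norm \<mu> p T h else ennreal_powr (lp_norm \<mu> p T h) (real_of_ereal p))"

definition bdd_unif_cont :: "('e::metric_space \<Rightarrow> real) set" where
  "bdd_unif_cont = {f. bounded (range f) \<and> uniformly_continuous_on UNIV f}"

definition subalgebra_of_bdd_unif_cont :: "('e::metric_space \<Rightarrow> real) set \<Rightarrow> bool" where
  "subalgebra_of_bdd_unif_cont C \<longleftrightarrow>
     C \<subseteq> bdd_unif_cont \<and> (\<lambda>x. 0) \<in> C \<and>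
     (\<forall>f\<in>C. \<forall>g\<in>C. (\<lambda>x. f x + g x) \<in> C \<and> (\<lambda>x. f x * g x) \<in> C) \<and>
     (\<forall>c. \<forall>f\<in>C. (\<lambda>x. c * f x) \<in> C)"

definition approximable_functions ::
  "('i \<Rightarrow> 'a measure) \<Rightarrow> ('i \<Rightarrow> real \<Rightarrow> 'a measure) \<Rightarrow> ('i \<Rightarrow> real \<Rightarrow> 'a \<Rightarrow> 'e::metric_space)
     \<Rightarrow> ('i \<Rightarrow> real \<Rightarrow> 'a \<Rightarrow> real) \<Rightarrow> ('e \<Rightarrow> real) set" where
  "approximable_functions M F X A =
     {f \<in> bdd_unif_cont. \<forall>\<epsilon>>0. \<forall>T>0. \<exists>Y Z.
        (\<forall>i. (Y i, Z i) \<in> semimartingale_pairs (M i) (F i) (A i)) \<and>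
        (SUP i. \<integral>\<^sup>+\<omega>. (SUP t\<in>{0..T} \<inter> \<rat>. ennreal \<bar>Y i t \<omega> - f (X i t \<omega>)\<bar>) \<partial>M i)
          < ennreal \<epsilon> \<and>
        (\<exists>p>1. (SUP i. \<integral>\<^sup>+\<omega>. lp_norm_pow (stieltjes (A i) \<omega>) p T (\<lambda>t. Z i t \<omega>) \<partial>M i) < \<infinity>)}"

end

theory Submission
  imports Defs
begin

text \<open>Let \<open>\<xi> = f \<circ> X\<close>. Both \<open>f\<close> and \<open>f\<^sup>2\<close> are approximable, so \<open>\<xi>\<close> and \<open>\<xi>\<^sup>2\<close> are uniformly close to
  processes \<open>Y\<close>, \<open>Y'\<close> with drifts \<open>V = \<integral>Z dA\<close>, \<open>V' = \<integral>Z' dA\<close>, whose oscillation over short windows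
  is small in probability, uniformly in the index. From
  \<open>(\<xi>\<^sub>\<tau> - \<xi>\<^sub>\<sigma>)\<^sup>2 = (\<xi>\<^sub>\<tau>\<^sup>2 - \<xi>\<^sub>\<sigma>\<^sup>2) - 2 \<xi>\<^sub>\<sigma> (\<xi>\<^sub>\<tau> - \<xi>\<^sub>\<sigma>)\<close> and optional sampling, the mean square of the
  increment of \<open>\<xi>\<close> between nearby stopping times is small, and Aldous's argument keeps the successive
  jump times of \<open>\<xi>\<close> apart.

  Since \<open>Y\<close> need not be right-continuous, stopping times only take dyadic values. That a path is
  close to a step function with well separated break points is a closed condition on its values at
  the dyadic times, because such step functions form a compact set; hence its probability is a limit
  of probabilities on finite grids. Paths satisfying this condition at all scales form a compact set
  of the Skorokhod space.\<close>

subsection \<open>The Ethier--Kurtz metric\<close>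

text \<open>The obstacle is the drift. Optional sampling needs the increment of \<open>V\<close>
  between two stopping times to be small in mean, but \<open>Z\<close> and \<open>A\<close> only
  make it small in probability. Sampling therefore also stops as soon as \<open>V\<close> or
  \<open>V'\<close> has moved by more than \<open>\<theta>\<close>. The increment up to that time is
  at most \<open>\<theta>\<close> plus one grid step, and a single grid step is at most
  \<open>\<theta>\<close> off a set \<open>Q\<close>. The probability of \<open>Q\<close> must be so
  small that the martingale part is negligible on it; how small depends on the index, and it is
  achieved by refining the grid for that index. Stopping early because of the drift is confined to a
  second set \<open>W\<close>, whose probability only has to be below \<open>\<eta> / 2\<close>;
  this is available for a window length common to all indices. So the spacing of the break points is
  uniform although the grids are not, and the dependence of the grid on the index disappears when,
  for a fixed index, the grid is refined indefinitely.\<close>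

lemma right_limit_iff:
  fixes x :: "real \<Rightarrow> 'b::metric_space"
  shows "(x \<longlongrightarrow> x t) (at_right t) \<longleftrightarrow>
    (\<forall>e>0. \<exists>d>0. \<forall>s. t \<le> s \<and> s < t + d \<longrightarrow> dist (x s) (x t) < e)"
proof
  assume "(x \<longlongrightarrow> x t) (at_right t)"
  show "\<forall>e>0. \<exists>d>0. \<forall>s. t \<le> s \<and> s < t + d \<longrightarrow> dist (x s) (x t) < e"
  proof (intro allI impI)
    fix e :: real assume "e > 0"
    with \<open>(x \<longlongrightarrow> x t) (at_right t)\<close> have "\<forall>\<^sub>F s in at_right t. dist (x s) (x t) < e"
      by (auto simp: tendsto_iff)
    then obtain b where b: "b > t" "\<And>s. s > t \<Longrightarrow> s < b \<Longrightarrow> dist (x s) (x t) < e"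
      unfolding eventually_at_right_field by auto
    have "dist (x s) (x t) < e" if "t \<le> s" "s < t + (b - t)" for s
      using b that \<open>e > 0\<close> by (cases "s = t") auto
    then show "\<exists>d>0. \<forall>s. t \<le> s \<and> s < t + d \<longrightarrow> dist (x s) (x t) < e"
      using b(1) by (intro exI[of _ "b - t"]) auto
  qed
next
  assume R: "\<forall>e>0. \<exists>d>0. \<forall>s. t \<le> s \<and> s < t + d \<longrightarrow> dist (x s) (x t) < e"
  show "(x \<longlongrightarrow> x t) (at_right t)"
  proof (rule tendstoI)
    fix e :: real assume "e > 0"
    with R obtain d where "d > 0" "\<forall>s. t \<le> s \<and> s < t + d \<longrightarrow> dist (x s) (x t) < e" by blast
    then show "\<forall>\<^sub>F s in at_right t. dist (x s) (x t) < e"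
      unfolding eventually_at_right_field by (intro exI[of _ "t + d"]) auto
  qed
qed

text \<open>Monotonicity keeps \<open>m s\<close> at or to the right of \<open>m t\<close>. Equality
  must be allowed, since a clock such as \<open>min s u\<close> stands still after \<open>u\<close>;
  hence the criterion with \<open>t \<le> s\<close> instead of a composition of punctured
  limits.\<close>

lemma right_limit_compose:
  fixes x :: "real \<Rightarrow> 'b::metric_space" and t :: real
  assumes x: "(x \<longlongrightarrow> x (m t)) (at_right (m t))"
    and m: "(m \<longlongrightarrow> m t) (at_right t)" and mono: "\<And>s. t \<le> s \<Longrightarrow> m t \<le> m s"
  shows "((\<lambda>s. x (m s)) \<longlongrightarrow> x (m t)) (at_right t)"
proof (rule tendstoI)
  fix e :: real assume "e > 0"
  with x obtain d where d: "d > 0" "\<forall>s. m t \<le> s \<and> s < m t + d \<longrightarrow> dist (x s) (x (m t)) < e"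
    unfolding right_limit_iff by blast
  have "\<forall>\<^sub>F s in at_right t. dist (m s) (m t) < d"
    using m d(1) by (auto simp: tendsto_iff)
  moreover have "\<forall>\<^sub>F s in at_right t. t < s"
    by (simp add: eventually_at_right_less)
  ultimately show "\<forall>\<^sub>F s in at_right t. dist (x (m s)) (x (m t)) < e"
    by eventually_elim (use d(2) mono in \<open>force simp: dist_real_def\<close>)
qed

lemma cadlagD_right: "cadlag x \<Longrightarrow> 0 \<le> t \<Longrightarrow> (x \<longlongrightarrow> x t) (at_right t)"
  by (simp add: cadlag_def)

lemma cadlagD_left: "cadlag x \<Longrightarrow> 0 < t \<Longrightarrow> \<exists>l. (x \<longlongrightarrow> l) (at_left t)"
  by (simp add: cadlag_def)

lemma filterlim_at_right_sandwich:
  fixes r :: "nat \<Rightarrow> real"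
  assumes "\<And>n. u < r n" "\<And>n. r n \<le> u + 1 / real (Suc n)"
  shows "filterlim r (at_right u) sequentially"
proof -
  have "r \<longlonglongrightarrow> u"
  proof (rule tendsto_sandwich[OF _ _ tendsto_const])
    show "(\<lambda>n. u + 1 / real (Suc n)) \<longlonglongrightarrow> u"
      using tendsto_add[OF tendsto_const LIMSEQ_inverse_real_of_nat, of u]
      by (simp add: inverse_eq_divide)
    show "\<forall>\<^sub>F n in sequentially. u \<le> r n" using assms(1) by (simp add: less_imp_le)
    show "\<forall>\<^sub>F n in sequentially. r n \<le> u + 1 / real (Suc n)" using assms(2) by simp
  qed
  moreover have "\<forall>\<^sub>F n in sequentially. r n \<in> {u<..} \<and> r n \<noteq> u"
    using assms(1) by (intro always_eventually allI) (auto simp: less_imp_neq[symmetric] dest: less_imp_neq)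
  ultimately show ?thesis by (simp add: filterlim_at)
qed

text \<open>Replacing \<open>u\<close> by the next point of the grid of mesh
  \<open>1 / (n + 1)\<close> strictly to its right exhibits \<open>f\<close> as a pointwise limit of
  functions of an integer part.\<close>

lemma borel_measurable_right_continuous:
  fixes f :: "real \<Rightarrow> real"
  assumes "\<And>u. (f \<longlongrightarrow> f u) (at_right u)"
  shows "f \<in> borel_measurable borel"
proof (rule borel_measurable_LIMSEQ_real)
  define r where "r n u = (real_of_int \<lfloor>real (Suc n) * u\<rfloor> + 1) / real (Suc n)" for n and u :: real
  have r: "u < r n u \<and> r n u \<le> u + 1 / real (Suc n)" for n u
  proof -
    have "real_of_int \<lfloor>real (Suc n) * u\<rfloor> \<le> real (Suc n) * u"
      "real (Suc n) * u < real_of_int \<lfloor>real (Suc n) * u\<rfloor> + 1" by linarith+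
    then show ?thesis unfolding r_def by (simp add: field_simps del: of_nat_Suc)
  qed
  show "(\<lambda>n. f (r n u)) \<longlonglongrightarrow> f u" for u
  proof -
    have "filterlim (\<lambda>n. r n u) (at_right u) sequentially"
      by (rule filterlim_at_right_sandwich) (use r in auto)
    with assms[of u] show ?thesis by (rule filterlim_compose)
  qed
  show "(\<lambda>u. f (r n u)) \<in> borel_measurable borel" for n
  proof -
    have "(\<lambda>k::int. f ((real_of_int k + 1) / real (Suc n))) \<circ> (\<lambda>u. \<lfloor>real (Suc n) * u\<rfloor>)
      \<in> borel_measurable borel"
      by (rule measurable_comp[where N="count_space UNIV"]) measurable
    then show ?thesis by (simp add: r_def comp_def)
  qed
qed

section \<open>Time changes and the logarithms of their chord slopes\<close>

lemma time_change_gamma_le_iff: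
  "time_change_gamma l \<le> c \<longleftrightarrow>
    (\<forall>s t. 0 \<le> s \<longrightarrow> s < t \<longrightarrow> ennreal \<bar>ln ((l t - l s) / (t - s))\<bar> \<le> c)"
  unfolding time_change_gamma_def by (auto simp: SUP_le_iff)

lemma time_change_gamma_upper:
  "0 \<le> s \<Longrightarrow> s < t \<Longrightarrow> ennreal \<bar>ln ((l t - l s) / (t - s))\<bar> \<le> time_change_gamma l"
  using time_change_gamma_le_iff by blast

lemma time_changeD:
  assumes "l \<in> time_changes"
  shows "strict_mono_on {0..} l" "l ` {0..} = {0..}" "time_change_gamma l < \<infinity>"
  using assms by (auto simp: time_changes_def)

lemma time_change_less:
  assumes "l \<in> time_changes" "0 \<le> s" "s < t" shows "l s < l t"
  using time_changeD(1)[OF assms(1)] assms(2,3) by (auto simp: strict_mono_on_def)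

lemma time_change_mono:
  assumes "l \<in> time_changes" "0 \<le> s" "s \<le> t" shows "l s \<le> l t"
  using time_change_less[OF assms(1,2)] assms(3) by (cases "s = t") (auto simp: less_imp_le)

lemma time_change_nonneg: "l \<in> time_changes \<Longrightarrow> 0 \<le> t \<Longrightarrow> 0 \<le> l t"
  using time_changeD(2) by fastforce

lemma time_change_zero: 
  assumes "l \<in> time_changes" shows "l 0 = 0"
proof -
  obtain s where "0 \<le> s" "l s = 0"
    using time_changeD(2)[OF assms] by (metis atLeast_iff imageE order_refl)
  then show ?thesis using time_change_mono[OF assms, of 0 s] time_change_nonneg[OF assms, of 0] by auto
qed

lemma time_change_ratio:
  assumes l: "l \<in> time_changes" and g: "time_change_gamma l \<le> ennreal c" "0 \<le> c" and st: "0 \<le> s" "s \<le> t"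
  shows "exp (- c) * (t - s) \<le> l t - l s \<and> l t - l s \<le> exp c * (t - s)"
proof (cases "s = t")
  case False
  then have "s < t" using st by auto
  have pos: "(l t - l s) / (t - s) > 0" using time_change_less[OF l st(1) \<open>s < t\<close>] \<open>s < t\<close> by simp
  have "ennreal \<bar>ln ((l t - l s) / (t - s))\<bar> \<le> ennreal c"
    using time_change_gamma_upper[OF st(1) \<open>s < t\<close>, of l] g(1) by (rule order_trans)
  then have "\<bar>ln ((l t - l s) / (t - s))\<bar> \<le> c" using g(2) by (simp add: ennreal_le_iff)
  then have "- c \<le> ln ((l t - l s) / (t - s))" "ln ((l t - l s) / (t - s)) \<le> c" by auto
  then have "exp (- c) \<le> exp (ln ((l t - l s) / (t - s)))" "exp (ln ((l t - l s) / (t - s))) \<le> exp c"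
    by simp_all
  then have "exp (- c) \<le> (l t - l s) / (t - s)" "(l t - l s) / (t - s) \<le> exp c"
    unfolding exp_ln[OF pos] by simp_all
  then show ?thesis using \<open>s < t\<close> by (simp add: field_simps)
qed simp

lemma time_change_gamma_finite:
  assumes l: "l \<in> time_changes"
  obtains c where "0 \<le> c" "time_change_gamma l = ennreal c"
  using time_changeD(3)[OF l] by (cases "time_change_gamma l") auto

lemma time_change_right_limit:
  assumes l: "l \<in> time_changes" and t: "0 \<le> t"
  shows "(l \<longlongrightarrow> l t) (at_right t)"
proof -
  obtain c where c: "0 \<le> c" "time_change_gamma l = ennreal c" using time_change_gamma_finite[OF l] .
  have u: "((\<lambda>s. l t + exp c * (s - t)) \<longlongrightarrow> l t + exp c * (t - t)) (at_right t)"
    by (intro tendsto_intros)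
  have gt: "\<forall>\<^sub>F s in at_right t. t < s" by (simp add: eventually_at_right_less)
  show ?thesis
  proof (rule tendsto_sandwich[OF _ _ tendsto_const])
    show "((\<lambda>s. l t + exp c * (s - t)) \<longlongrightarrow> l t) (at_right t)" using u by simp
    show "\<forall>\<^sub>F s in at_right t. l t \<le> l s"
      using gt by eventually_elim (use time_change_mono[OF l t] in auto)
    show "\<forall>\<^sub>F s in at_right t. l s \<le> l t + exp c * (s - t)"
      using gt
    proof eventually_elim
      case (elim s)
      then have "t \<le> s" by simp
      then show ?case using time_change_ratio[OF l eq_refl[OF c(2)] c(1) t \<open>t \<le> s\<close>] by simp
    qed
  qed
qed

lemma time_change_id: "(\<lambda>t. t) \<in> time_changes" and time_change_gamma_id: "time_change_gamma (\<lambda>t. t) = 0"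
proof -
  have "time_change_gamma (\<lambda>t. t) \<le> 0" unfolding time_change_gamma_le_iff by auto
  then show g: "time_change_gamma (\<lambda>t. t) = 0" by simp
  show "(\<lambda>t. t) \<in> time_changes" unfolding time_changes_def by (auto simp: g strict_mono_on_def)
qed

text \<open>Chord slopes multiply under composition, so their logarithms add. This is the time part
  of the triangle inequality.\<close>

lemma time_change_compose:
  assumes l: "l \<in> time_changes" and m: "m \<in> time_changes"
  shows "m \<circ> l \<in> time_changes"
    and "time_change_gamma (m \<circ> l) \<le> time_change_gamma l + time_change_gamma m"
proof -
  show g: "time_change_gamma (m \<circ> l) \<le> time_change_gamma l + time_change_gamma m"
    unfolding time_change_gamma_le_iff
  proof (intro allI impI)
    fix s t :: real assume st: "0 \<le> s" "s < t"
    have 1: "0 \<le> l s" "l s < l t" using time_change_nonneg[OF l] time_change_less[OF l] st by auto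
    then have 2: "m (l s) < m (l t)" using time_change_less[OF m] by auto
    have "((m \<circ> l) t - (m \<circ> l) s) / (t - s) = (l t - l s) / (t - s) * ((m (l t) - m (l s)) / (l t - l s))"
      using 1 by simp
    also have "ln \<dots> = ln ((l t - l s) / (t - s)) + ln ((m (l t) - m (l s)) / (l t - l s))"
      using 1 2 st by (intro ln_mult_pos) auto
    finally have "ennreal \<bar>ln (((m \<circ> l) t - (m \<circ> l) s) / (t - s))\<bar>
      \<le> ennreal (\<bar>ln ((l t - l s) / (t - s))\<bar> + \<bar>ln ((m (l t) - m (l s)) / (l t - l s))\<bar>)"
      by (intro ennreal_leI) linarith
    also have "\<dots> \<le> time_change_gamma l + time_change_gamma m"
      using time_change_gamma_upper[OF st, of l] time_change_gamma_upper[OF 1, of m]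
      by (simp add: ennreal_plus add_mono)
    finally show "ennreal \<bar>ln (((m \<circ> l) t - (m \<circ> l) s) / (t - s))\<bar> \<le> time_change_gamma l + time_change_gamma m" .
  qed
  have "time_change_gamma (m \<circ> l) < \<infinity>"
    using g time_changeD(3)[OF l] time_changeD(3)[OF m]
    by (auto intro: order_le_less_trans)
  moreover have "strict_mono_on {0..} (m \<circ> l)"
    using time_change_less[OF m] time_change_less[OF l] time_change_nonneg[OF l]
    by (auto simp: strict_mono_on_def)
  moreover have "(m \<circ> l) ` {0..} = {0..}"
    using time_changeD(2)[OF l] time_changeD(2)[OF m] by (metis image_comp)
  ultimately show "m \<circ> l \<in> time_changes" by (simp add: time_changes_def)
qed

text \<open>The chords of the inverse have reciprocal slopes, and \<open>ln\<close> of a reciprocal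
  only changes sign. This is the time part of the symmetry of the metric.\<close>

lemma time_change_inverse:
  assumes l: "l \<in> time_changes"
  obtains k where "k \<in> time_changes" "time_change_gamma k \<le> time_change_gamma l"
    "\<And>t. 0 \<le> t \<Longrightarrow> k (l t) = t" "\<And>t. 0 \<le> t \<Longrightarrow> l (k t) = t"
proof -
  define k where "k = inv_into {0..} l"
  have inj: "inj_on l {0..}" using time_changeD(1)[OF l] by (rule strict_mono_on_imp_inj_on)
  have kl: "k (l t) = t" if "0 \<le> t" for t using that inj by (simp add: k_def inv_into_f_f)
  have lk: "l (k t) = t" and k0: "0 \<le> k t" if "0 \<le> t" for t
    using f_inv_into_f[of t l "{0..}"] inv_into_into[of t l "{0..}"] time_changeD(2)[OF l] that
    by (auto simp: k_def)
  have kless: "k s < k t" if "0 \<le> s" "s < t" for s t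
  proof (rule ccontr)
    assume "\<not> k s < k t"
    then have "l (k t) \<le> l (k s)" using time_change_mono[OF l, of "k t" "k s"] k0[of t] that by auto
    then show False using lk[of s] lk[of t] that by auto
  qed
  have g: "time_change_gamma k \<le> time_change_gamma l"
    unfolding time_change_gamma_le_iff[of k]
  proof (intro allI impI)
    fix s t :: real assume st: "0 \<le> s" "s < t"
    have "ln ((k t - k s) / (t - s)) = - ln ((l (k t) - l (k s)) / (k t - k s))"
      using st kless[OF st] lk[of s] lk[of t] by (simp add: ln_div)
    then show "ennreal \<bar>ln ((k t - k s) / (t - s))\<bar> \<le> time_change_gamma l"
      using time_change_gamma_upper[OF k0[OF st(1)] kless[OF st], of l] by simp
  qed
  have "k ` {0..} = {0..}"
  proof
    show "k ` {0..} \<subseteq> {0..}" using k0 by auto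
    show "{0..} \<subseteq> k ` {0..}"
    proof
      fix t :: real assume "t \<in> {0..}"
      then show "t \<in> k ` {0..}" using kl[of t] time_change_nonneg[OF l, of t] by (intro image_eqI[of _ _ "l t"]) auto
    qed
  qed
  then have "k \<in> time_changes"
    using order_le_less_trans[OF g time_changeD(3)[OF l]] kless
    by (simp add: time_changes_def strict_mono_on_def)
  then show thesis using that[of k] g kl lk by blast
qed

section \<open>The distance of two paths stopped at a common level\<close>

lemma stopped_dist_le_iff:
  "stopped_dist x y l u \<le> c \<longleftrightarrow> (\<forall>t\<ge>0. ennreal (min (dist (x (min t u)) (y (min (l t) u))) 1) \<le> c)"
  unfolding stopped_dist_def by (auto simp: SUP_le_iff)

lemma stopped_dist_upper:
  "0 \<le> t \<Longrightarrow> ennreal (min (dist (x (min t u)) (y (min (l t) u))) 1) \<le> stopped_dist x y l u"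
  using stopped_dist_le_iff by blast

lemma stopped_dist_le_1: "stopped_dist x y l u \<le> 1"
  unfolding stopped_dist_le_iff by (auto simp: ennreal_1[symmetric] simp del: ennreal_1 intro!: ennreal_leI)

lemma stopped_dist_refl: "stopped_dist x x (\<lambda>t. t) u = 0"
proof -
  have "stopped_dist x x (\<lambda>t. t) u \<le> 0" by (rule stopped_dist_le_iff[THEN iffD2]) simp
  then show ?thesis by simp
qed

text \<open>The term at time \<open>t\<close> on the left is the term at time \<open>l t\<close> on
  the right, because \<open>k\<close> leads back from \<open>l t\<close> to
  \<open>t\<close>.\<close>

lemma stopped_dist_inverse:
  assumes l: "l \<in> time_changes" and k: "\<And>t. 0 \<le> t \<Longrightarrow> k (l t) = t" 
  shows "stopped_dist x y l u \<le> stopped_dist y x k u"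
  unfolding stopped_dist_le_iff[of x]
proof (intro allI impI)
  fix t :: real assume "0 \<le> t"
  then show "ennreal (min (dist (x (min t u)) (y (min (l t) u))) 1) \<le> stopped_dist y x k u"
    using stopped_dist_upper[OF time_change_nonneg[OF l \<open>0 \<le> t\<close>], of y u x k] k[of t]
    by (simp add: dist_commute)
qed

text \<open>The intermediate path is read at \<open>min (l t) u\<close>. This is its second slot in
  the comparison by \<open>l\<close> at time \<open>t\<close> and its first slot in the comparison
  by \<open>m\<close> at time \<open>l t\<close>; both stop at the same level
  \<open>u\<close>.\<close>

lemma stopped_dist_triangle:
  assumes l: "l \<in> time_changes"
  shows "stopped_dist x z (m \<circ> l) u \<le> stopped_dist x y l u + stopped_dist y z m u"
  unfolding stopped_dist_le_iff[of x z]
proof (intro allI impI)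
  fix t :: real assume t: "0 \<le> t"
  have min_add: "min a 1 \<le> min b 1 + min c 1" if "a \<le> b + c" "0 \<le> b" "0 \<le> c" for a b c :: real
    using that by linarith
  have "min (dist (x (min t u)) (z (min (m (l t)) u))) 1
    \<le> min (dist (x (min t u)) (y (min (l t) u))) 1 + min (dist (y (min (l t) u)) (z (min (m (l t)) u))) 1"
    by (rule min_add[OF dist_triangle zero_le_dist zero_le_dist])
  then have "ennreal (min (dist (x (min t u)) (z (min ((m \<circ> l) t) u))) 1)
    \<le> ennreal (min (dist (x (min t u)) (y (min (l t) u))) 1) + ennreal (min (dist (y (min (l t) u)) (z (min (m (l t)) u))) 1)"
    by (simp add: ennreal_plus[symmetric] ennreal_leI del: ennreal_plus)
  also have "\<dots> \<le> stopped_dist x y l u + stopped_dist y z m u"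
    by (intro add_mono stopped_dist_upper t time_change_nonneg[OF l t])
  finally show "ennreal (min (dist (x (min t u)) (z (min ((m \<circ> l) t) u))) 1) \<le> \<dots>" .
qed

lemma min_right_limit: "((\<lambda>s. min s u) \<longlongrightarrow> min t u) (at_right (t::real))"
  by (intro tendsto_intros)

text \<open>Right continuity is used twice: in \<open>t\<close>, to restrict the supremum to
  rational times, and in \<open>u\<close>, to make each of the countably many terms measurable. The
  indicator removes negative levels, where the paths are arbitrary.\<close>

lemma stopped_dist_measurable:
  assumes x: "cadlag x" and y: "cadlag y" and l: "l \<in> time_changes"
  shows "(\<lambda>u. stopped_dist x y l u * indicator {0..} u) \<in> borel_measurable borel"
proof -
  define g where "g t u = min (dist (x (min t u)) (y (min (l t) u))) 1" for t u
  have gt: "((\<lambda>s. g s u) \<longlongrightarrow> g t u) (at_right t)" if "0 \<le> t" "0 \<le> u" for t u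
    unfolding g_def
  proof (rule tendsto_min[OF tendsto_dist tendsto_const])
    show "((\<lambda>s. x (min s u)) \<longlongrightarrow> x (min t u)) (at_right t)"
      by (rule right_limit_compose[where m="\<lambda>s. min s u"])
         (use that in \<open>auto intro!: cadlagD_right[OF x] min_right_limit\<close>)
    have "((\<lambda>s. min (l s) u) \<longlongrightarrow> min (l t) u) (at_right t)"
      by (rule tendsto_min[OF time_change_right_limit[OF l that(1)] tendsto_const])
    moreover have "min (l t) u \<le> min (l s) u" if "t \<le> s" for s
      using time_change_mono[OF l \<open>0 \<le> t\<close> that] by linarith
    moreover have "0 \<le> min (l t) u" using that time_change_nonneg[OF l that(1)] by simp
    ultimately show "((\<lambda>s. y (min (l s) u)) \<longlongrightarrow> y (min (l t) u)) (at_right t)"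
      by (rule right_limit_compose[where m="\<lambda>s. min (l s) u", OF cadlagD_right[OF y], rotated 1])
  qed
  have gu: "(g t \<longlongrightarrow> g t u) (at_right u)" if "0 \<le> t" "0 \<le> u" for t u
    unfolding g_def[abs_def]
  proof (rule tendsto_min[OF tendsto_dist tendsto_const])
    have "((\<lambda>s. z (min c s)) \<longlongrightarrow> z (min c u)) (at_right u)" if "cadlag z" "0 \<le> c" for c and z :: "real \<Rightarrow> 'a"
      by (rule right_limit_compose[where m="min c"])
         (use that \<open>0 \<le> u\<close> in \<open>auto intro!: cadlagD_right tendsto_min[OF tendsto_const tendsto_ident_at]\<close>)
    then show "((\<lambda>s. x (min t s)) \<longlongrightarrow> x (min t u)) (at_right u)"
      "((\<lambda>s. y (min (l t) s)) \<longlongrightarrow> y (min (l t) u)) (at_right u)"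
      using x y that time_change_nonneg[OF l that(1)] by blast+
  qed
  have meas: "(\<lambda>u. g t u * indicator {0..} u) \<in> borel_measurable borel" if t: "0 \<le> t" for t
  proof (rule borel_measurable_right_continuous)
    fix u :: real
    show "((\<lambda>u. g t u * indicator {0..} u) \<longlongrightarrow> g t u * indicator {0..} u) (at_right u)"
    proof (cases "0 \<le> u")
      case True
      have "\<forall>\<^sub>F s in at_right u. g t s = g t s * indicator {0..} s"
        using eventually_at_right_less[of u] by eventually_elim (use True in auto)
      from tendsto_cong[THEN iffD1, OF this gu[OF t True]] show ?thesis using True by simp
    next
      case False
      then have "\<forall>\<^sub>F s in at_right u. 0 = g t s * indicator {0..} s"
        unfolding eventually_at_right_field by (intro exI[of _ 0]) auto
      from tendsto_cong[THEN iffD1, OF this tendsto_const] show ?thesis using False by simp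
    qed
  qed
  have eq: "stopped_dist x y l u * indicator {0..} u
      = (SUP t\<in>{0..} \<inter> \<rat>. ennreal (g t u * indicator {0..} u))" for u
  proof (cases "0 \<le> u")
    case True
    have "stopped_dist x y l u \<le> (SUP t\<in>{0..} \<inter> \<rat>. ennreal (g t u))"
      unfolding stopped_dist_le_iff
    proof (intro allI impI)
      fix t :: real assume t: "0 \<le> t"
      have "\<exists>q. q \<in> \<rat> \<and> t < q \<and> q < t + 1 / real (Suc n)" for n
        using Rats_dense_in_real[of t "t + 1 / real (Suc n)"] by auto
      then obtain q where q: "\<And>n. q n \<in> \<rat>" "\<And>n. t < q n" "\<And>n. q n < t + 1 / real (Suc n)" by metis
      have "filterlim q (at_right t) sequentially"
        by (rule filterlim_at_right_sandwich) (use q in \<open>auto simp: less_imp_le\<close>)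
      from filterlim_compose[OF gt[OF t True] this]
      have "(\<lambda>n. ennreal (g (q n) u)) \<longlonglongrightarrow> ennreal (g t u)" by (rule tendsto_ennrealI)
      moreover have "ennreal (g (q n) u) \<le> (SUP t\<in>{0..} \<inter> \<rat>. ennreal (g t u))" for n
        by (rule SUP_upper) (use q(1,2)[of n] t in auto)
      ultimately have "ennreal (g t u) \<le> (SUP t\<in>{0..} \<inter> \<rat>. ennreal (g t u))"
        by (intro LIMSEQ_le_const2) auto
      then show "ennreal (min (dist (x (min t u)) (y (min (l t) u))) 1) \<le> (SUP t\<in>{0..} \<inter> \<rat>. ennreal (g t u))"
        by (simp add: g_def)
    qed
    moreover have "(SUP t\<in>{0..} \<inter> \<rat>. ennreal (g t u)) \<le> stopped_dist x y l u"
      by (rule SUP_least) (auto simp: g_def intro: stopped_dist_upper)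
    ultimately show ?thesis using True by simp
  next
    case False
    have "{0..} \<inter> \<rat> \<noteq> ({}::real set)" by (auto intro!: exI[of _ 0])
    then show ?thesis using False by simp
  qed
  show ?thesis unfolding eq
    by (intro borel_measurable_SUP) (use meas in \<open>auto intro: countable_rat\<close>)
qed

section \<open>The Skorokhod distance as an infimum of costs, and its metric axioms\<close>

definition change_cost :: "(real \<Rightarrow> 'b::metric_space) \<Rightarrow> (real \<Rightarrow> 'b) \<Rightarrow> (real \<Rightarrow> real) \<Rightarrow> ennreal" where
  "change_cost x y l = max (time_change_gamma l)
        (\<integral>\<^sup>+u\<in>{0..}. ennreal (exp (- u)) * stopped_dist x y l u \<partial>lborel)"

lemma skorokhod_dist_eq: "skorokhod_dist x y = enn2real (INF l\<in>time_changes. change_cost x y l)"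
  by (simp add: skorokhod_dist_def change_cost_def)

text \<open>With \<open>a = 0\<close> this is the total weight 1 of the levels; with
  \<open>a = N\<close> it is the weight of the levels beyond the horizon, where nothing is known
  about the paths.\<close>

lemma exp_integral_atLeast: "(\<integral>\<^sup>+u\<in>{a..}. ennreal (exp (- u)) \<partial>lborel) = ennreal (exp (- a))"
proof -
  have "(\<integral>\<^sup>+u. ennreal (exp (- u)) * indicator {a..} u \<partial>lborel) = ennreal (0 - (- exp (- a)))"
  proof (rule nn_integral_FTC_atLeast[where f="\<lambda>u. exp (- u)" and F="\<lambda>u. - exp (- u)" and T=0])
    show "((\<lambda>u::real. - exp (- u)) \<longlongrightarrow> 0) at_top"
      by (rule tendsto_eq_intros filterlim_compose[OF exp_at_bot filterlim_uminus_at_bot_at_top] | simp)+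
  qed (auto intro!: derivative_eq_intros)
  then show ?thesis by simp
qed

lemma change_cost_refl: "change_cost x x (\<lambda>t. t) = 0"
  by (simp add: change_cost_def time_change_gamma_id stopped_dist_refl)

lemma INF_change_cost_le_1: "(INF l\<in>time_changes. change_cost x y l) \<le> 1"
proof -
  have "(\<integral>\<^sup>+u\<in>{0..}. ennreal (exp (- u)) * stopped_dist x y (\<lambda>t. t) u \<partial>lborel)
    \<le> (\<integral>\<^sup>+u\<in>{0..}. ennreal (exp (- u)) \<partial>lborel)"
    by (intro nn_integral_mono mult_right_mono) (use mult_left_mono[OF stopped_dist_le_1] in fastforce)+
  then have "change_cost x y (\<lambda>t. t) \<le> 1"
    by (simp add: change_cost_def time_change_gamma_id exp_integral_atLeast)
  then show ?thesis by (rule INF_lower2[OF time_change_id])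
qed

text \<open>The infimum is at most 1, hence finite, so \<open>enn2real\<close> preserves strict
  comparisons; a strict bound on an infimum then yields a witness.\<close>

lemma skorokhod_dist_less_iff:
  assumes "0 < e" shows "skorokhod_dist x y < e \<longleftrightarrow> (\<exists>l\<in>time_changes. change_cost x y l < ennreal e)"
proof -
  have fin: "(INF l\<in>time_changes. change_cost x y l) < \<infinity>"
    using order_le_less_trans[OF INF_change_cost_le_1[of x y] ennreal_one_less_top] by simp
  have "skorokhod_dist x y < e \<longleftrightarrow> (INF l\<in>time_changes. change_cost x y l) < ennreal e"
    unfolding skorokhod_dist_eq using fin assms
    by (cases "INF l\<in>time_changes. change_cost x y l") (auto simp: ennreal_less_iff)
  then show ?thesis by (simp add: INF_less_iff)
qed

lemma skorokhod_dist_nonneg: "0 \<le> skorokhod_dist x y"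
  by (simp add: skorokhod_dist_def)

lemma change_cost_inverse:
  assumes l: "l \<in> time_changes"
  obtains k where "k \<in> time_changes" "change_cost y x k \<le> change_cost x y l"
proof -
  obtain k where k: "k \<in> time_changes" "time_change_gamma k \<le> time_change_gamma l"
    "\<And>t. 0 \<le> t \<Longrightarrow> k (l t) = t" "\<And>t. 0 \<le> t \<Longrightarrow> l (k t) = t"
    using time_change_inverse[OF l] by blast
  have "(\<integral>\<^sup>+u\<in>{0..}. ennreal (exp (- u)) * stopped_dist y x k u \<partial>lborel)
    \<le> (\<integral>\<^sup>+u\<in>{0..}. ennreal (exp (- u)) * stopped_dist x y l u \<partial>lborel)"
    by (intro nn_integral_mono mult_right_mono mult_left_mono stopped_dist_inverse k) auto
  then have "change_cost y x k \<le> change_cost x y l"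
    unfolding change_cost_def using k(2) by (intro max.mono) auto
  then show thesis using that k(1) by blast
qed

lemma skorokhod_dist_le_commute: "skorokhod_dist x y \<le> skorokhod_dist y x"
proof (rule field_le_epsilon)
  fix e :: real assume "0 < e"
  then have "skorokhod_dist y x < skorokhod_dist y x + e" "0 < skorokhod_dist y x + e"
    using skorokhod_dist_nonneg[of y x] by auto
  then obtain l where "l \<in> time_changes" "change_cost y x l < ennreal (skorokhod_dist y x + e)"
    by (subst (asm) skorokhod_dist_less_iff) auto
  moreover obtain k where "k \<in> time_changes" "change_cost x y k \<le> change_cost y x l"
    using change_cost_inverse[OF \<open>l \<in> time_changes\<close>] .
  ultimately have "k \<in> time_changes" "change_cost x y k < ennreal (skorokhod_dist y x + e)"
    by auto
  then have "skorokhod_dist x y < skorokhod_dist y x + e"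
    using \<open>0 < skorokhod_dist y x + e\<close> by (subst skorokhod_dist_less_iff) auto
  then show "skorokhod_dist x y \<le> skorokhod_dist y x + e" by simp
qed

lemma change_cost_compose:
  assumes x: "cadlag x" and y: "cadlag y" and z: "cadlag z"
    and l: "l \<in> time_changes" and m: "m \<in> time_changes"
  shows "change_cost x z (m \<circ> l) \<le> change_cost x y l + change_cost y z m"
proof -
  let ?I = "\<lambda>x y l. \<integral>\<^sup>+u\<in>{0..}. ennreal (exp (- u)) * stopped_dist x y l u \<partial>lborel"
  have meas: "(\<lambda>u. ennreal (exp (- u)) * stopped_dist x y l u * indicator {0..} u) \<in> borel_measurable lborel"
    if "cadlag x" "cadlag y" "l \<in> time_changes" for x y :: "real \<Rightarrow> 'a" and l
    using borel_measurable_times_ennreal[OF _ stopped_dist_measurable[OF that], of "\<lambda>u. ennreal (exp (- u))"]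
    by (simp add: mult.assoc)
  have "?I x z (m \<circ> l) \<le> (\<integral>\<^sup>+u. ennreal (exp (- u)) * stopped_dist x y l u * indicator {0..} u
      + ennreal (exp (- u)) * stopped_dist y z m u * indicator {0..} u \<partial>lborel)"
  proof (rule nn_integral_mono)
    fix u :: real
    show "ennreal (exp (- u)) * stopped_dist x z (m \<circ> l) u * indicator {0..} u
      \<le> ennreal (exp (- u)) * stopped_dist x y l u * indicator {0..} u
      + ennreal (exp (- u)) * stopped_dist y z m u * indicator {0..} u"
      using mult_left_mono[OF stopped_dist_triangle[OF l, of x z m u y], of "ennreal (exp (- u))"]
      by (auto simp: indicator_def distrib_left)
  qed
  also have "\<dots> = ?I x y l + ?I y z m"
    by (intro nn_integral_add meas x y z l m)
  finally have "?I x z (m \<circ> l) \<le> ?I x y l + ?I y z m" .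
  then show ?thesis unfolding change_cost_def
    by (intro max.boundedI order_trans[OF time_change_compose(2)[OF l m]]
        order_trans[OF \<open>?I x z (m \<circ> l) \<le> ?I x y l + ?I y z m\<close>] add_mono max.cobounded1 max.cobounded2)
qed

lemma skorokhod_dist_triangle:
  assumes "cadlag x" "cadlag y" "cadlag z"
  shows "skorokhod_dist x z \<le> skorokhod_dist x y + skorokhod_dist y z"
proof (rule field_le_epsilon)
  fix e :: real assume "0 < e"
  define a b where "a = skorokhod_dist x y + e / 2" and "b = skorokhod_dist y z + e / 2"
  have ab: "0 < a" "0 < b" "skorokhod_dist x y < a" "skorokhod_dist y z < b"
    using \<open>0 < e\<close> skorokhod_dist_nonneg[of x y] skorokhod_dist_nonneg[of y z] by (auto simp: a_def b_def)
  obtain l m where l: "l \<in> time_changes" "change_cost x y l < ennreal a"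
    and m: "m \<in> time_changes" "change_cost y z m < ennreal b"
    using ab skorokhod_dist_less_iff by blast
  have "change_cost x z (m \<circ> l) \<le> change_cost x y l + change_cost y z m"
    using change_cost_compose[OF assms l(1) m(1)] .
  also have "\<dots> < ennreal a + ennreal b" using l(2) m(2) by (rule add_strict_mono)
  also have "\<dots> = ennreal (a + b)" using ab by simp
  finally have "skorokhod_dist x z < a + b"
    using ab time_change_compose(1)[OF l(1) m(1)] by (subst skorokhod_dist_less_iff) auto
  then show "skorokhod_dist x z \<le> skorokhod_dist x y + skorokhod_dist y z + e"
    by (simp add: a_def b_def)
qed

lemma skorokhod_dist_refl: "skorokhod_dist x x = 0"
proof -
  have "(INF l\<in>time_changes. change_cost x x l) \<le> 0"
    by (rule INF_lower2[OF time_change_id]) (simp add: change_cost_refl)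
  then show ?thesis by (simp add: skorokhod_dist_eq)
qed

text \<open>If the paths differ at \<open>t\<close>, right continuity keeps them apart throughout
  \<open>[t, t + d)\<close>. A time change with small \<open>gamma\<close> cannot carry the midpoint
  \<open>t1\<close> out of this interval, so the stopped distance is bounded below at every level
  beyond \<open>t + d\<close>, and so is the integral.\<close>

lemma skorokhod_dist_eq_0D:
  fixes x y :: "real \<Rightarrow> 'b::metric_space"
  assumes x: "cadlag x" and y: "cadlag y" and 0: "skorokhod_dist x y = 0" and t: "0 \<le> t"
  shows "x t = y t"
proof (rule ccontr)
  assume "x t \<noteq> y t"
  define e where "e = dist (x t) (y t)"
  have "e > 0" using \<open>x t \<noteq> y t\<close> by (simp add: e_def)
  then have "e / 4 > 0" by simp
  obtain d1 where d1: "d1 > 0" "\<And>s. t \<le> s \<Longrightarrow> s < t + d1 \<Longrightarrow> dist (x s) (x t) < e / 4"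
    using cadlagD_right[OF x t] \<open>e / 4 > 0\<close> unfolding right_limit_iff by meson
  obtain d2 where d2: "d2 > 0" "\<And>s. t \<le> s \<Longrightarrow> s < t + d2 \<Longrightarrow> dist (y s) (y t) < e / 4"
    using cadlagD_right[OF y t] \<open>e / 4 > 0\<close> unfolding right_limit_iff by meson
  define d where "d = min d1 d2"
  have "d > 0" using d1 d2 by (simp add: d_def)
  define t1 where "t1 = t + d / 2"
  have t1: "t < t1" "t1 < t + d" "0 < t1" using \<open>d > 0\<close> t by (auto simp: t1_def)
  \<comment> \<open>Chosen so that slopes up to \<open>exp c\<close> move \<open>t1\<close> to the
    right by at most \<open>d / 4\<close>.\<close>
  define c where "c = ln (1 + d / (4 * t1))"
  have c: "c > 0" "exp c = 1 + d / (4 * t1)" using \<open>d > 0\<close> t1 by (auto simp: c_def intro!: ln_gt_zero add_pos_pos)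
  define b where "b = min (e / 2) 1"
  have "b > 0" using \<open>e > 0\<close> by (simp add: b_def)
  define \<kappa> where "\<kappa> = min c (exp (- (t + d + 1)) * b)"
  have "\<kappa> > 0" using c \<open>b > 0\<close> by (simp add: \<kappa>_def)
  then have "\<exists>l\<in>time_changes. change_cost x y l < ennreal \<kappa>"
    using 0 skorokhod_dist_less_iff[of \<kappa> x y] by simp
  then obtain l where l: "l \<in> time_changes" and cost: "change_cost x y l < ennreal \<kappa>" by blast
  then have "time_change_gamma l \<le> ennreal \<kappa>" unfolding change_cost_def by (simp add: less_imp_le)
  also have "\<dots> \<le> ennreal c" by (intro ennreal_leI) (simp add: \<kappa>_def)
  finally have gam: "time_change_gamma l \<le> ennreal c" .
  have lt: "exp (- c) * t1 \<le> l t1" "l t1 \<le> exp c * t1"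
    using time_change_ratio[OF l gam _ order_refl, of t1] c t1 time_change_zero[OF l] by auto
  have "exp c * t1 = t1 + d / 4" using c(2) t1 by (simp add: field_simps)
  then have "l t1 \<le> t1 + d / 4" using lt(2) by simp
  moreover have "t1 - d / 4 \<le> l t1"
  proof -
    \<comment> \<open>This turns the value of \<open>exp c\<close> into the lower bound
      \<open>1 - d / (4 * t1)\<close> for \<open>exp (- c)\<close>, so \<open>t1\<close> moves to
      the left by at most \<open>d / 4\<close> as well.\<close>
    have "exp c + exp (- c) \<ge> 2"
    proof -
      have "(exp (c/2) - exp (- c/2))\<^sup>2 \<ge> 0" by simp
      moreover have "exp (c/2) * exp (- c/2) = 1" by (simp add: exp_add[symmetric])
      moreover have "(exp (c/2))\<^sup>2 = exp c" "(exp (- c/2))\<^sup>2 = exp (- c)" by (simp_all add: exp_double[symmetric])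
      ultimately show ?thesis by (simp add: power2_diff mult.assoc)
    qed
    then have "1 - d / (4 * t1) \<le> exp (- c)" using c by simp
    then have "(1 - d / (4 * t1)) * t1 \<le> l t1" using lt(1) t1 by (meson mult_right_mono order_trans less_imp_le)
    moreover have "(1 - d / (4 * t1)) * t1 = t1 - d / 4" using t1 by (simp add: field_simps)
    ultimately show ?thesis by simp
  qed
  ultimately have l1: "t \<le> l t1" "l t1 < t + d" using \<open>d > 0\<close> by (auto simp: t1_def)
  have far: "ennreal b \<le> stopped_dist x y l u" if "t + d \<le> u" for u
  proof -
    have "e \<le> dist (x t) (x t1) + dist (x t1) (y (l t1)) + dist (y (l t1)) (y t)"
      unfolding e_def using dist_triangle[of "x t" "y t" "x t1"] dist_triangle[of "x t1" "y t" "y (l t1)"] by linarith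
    moreover have "dist (x t1) (x t) < e / 4" "dist (y (l t1)) (y t) < e / 4"
      using d1(2)[of t1] d2(2)[of "l t1"] t1 l1 by (auto simp: d_def)
    ultimately have "e / 2 \<le> dist (x t1) (y (l t1))" by (simp add: dist_commute)
    then have "ennreal b \<le> ennreal (min (dist (x (min t1 u)) (y (min (l t1) u))) 1)"
      using t1 l1 that by (intro ennreal_leI) (simp add: b_def)
    also have "\<dots> \<le> stopped_dist x y l u" using t1 by (intro stopped_dist_upper) auto
    finally show ?thesis .
  qed
  \<comment> \<open>One unit of levels suffices: on \<open>[t + d, t + d + 1]\<close> the weight
    \<open>exp (- u)\<close> is at least \<open>exp (- (t + d + 1))\<close> and the stopped distance
    at least \<open>b\<close>.\<close>
  have "ennreal (exp (- (t + d + 1)) * b) = (\<integral>\<^sup>+u\<in>{t + d..t + d + 1}. ennreal (exp (- (t + d + 1)) * b) \<partial>lborel)"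
    using \<open>b > 0\<close> by (simp add: nn_integral_cmult_indicator)
  also have "\<dots> \<le> (\<integral>\<^sup>+u\<in>{0..}. ennreal (exp (- u)) * stopped_dist x y l u \<partial>lborel)"
  proof (rule nn_integral_mono)
    fix u :: real
    show "ennreal (exp (- (t + d + 1)) * b) * indicator {t + d..t + d + 1} u
      \<le> ennreal (exp (- u)) * stopped_dist x y l u * indicator {0..} u"
      using t \<open>d > 0\<close> \<open>b > 0\<close> far[of u]
      by (auto simp: indicator_def ennreal_mult intro!: mult_mono ennreal_leI)
  qed
  also have "\<dots> \<le> change_cost x y l" by (simp add: change_cost_def)
  also have "\<dots> < ennreal \<kappa>" by (rule cost)
  also have "\<dots> \<le> ennreal (exp (- (t + d + 1)) * b)" by (intro ennreal_leI) (simp add: \<kappa>_def)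
  finally show False by simp
qed

lemma skorokhod_space_ext:
  "x \<in> skorokhod_space \<Longrightarrow> y \<in> skorokhod_space \<Longrightarrow> (\<And>t. 0 \<le> t \<Longrightarrow> x t = y t) \<Longrightarrow> x = y"
  by (rule extensionalityI[of _ "{0..}"]) (auto simp: skorokhod_space_def)

text \<open>The triangle inequality needs measurable integrands, hence cadlag paths; off the space
  the axioms only ask for symmetry and nonnegativity.\<close>

lemma Metric_space_skorokhod:
  "Metric_space skorokhod_space (skorokhod_dist :: (real \<Rightarrow> 'b::metric_space) \<Rightarrow> _)"
proof
  fix x y z :: "real \<Rightarrow> 'b"
  show "0 \<le> skorokhod_dist x y" by (rule skorokhod_dist_nonneg)
  show "skorokhod_dist x y = skorokhod_dist y x" by (intro antisym skorokhod_dist_le_commute)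
  assume x: "x \<in> skorokhod_space" and y: "y \<in> skorokhod_space"
  then show "(skorokhod_dist x y = 0) = (x = y)"
    using skorokhod_dist_eq_0D[of x y] skorokhod_dist_refl[of x] skorokhod_space_ext[OF x y]
    by (auto simp: skorokhod_space_def)
  assume z: "z \<in> skorokhod_space"
  show "skorokhod_dist x z \<le> skorokhod_dist x y + skorokhod_dist y z"
    using x y z by (intro skorokhod_dist_triangle) (auto simp: skorokhod_space_def)
qed

subsection \<open>Step functions\<close>

text \<open>Tychonoff's theorem; a product over a countable index type is first countable, so
  compactness gives convergent subsequences.\<close>

lemma coordinatewise_subsequence:
  fixes f :: "nat \<Rightarrow> 'a::countable \<Rightarrow> 'b::metric_space"
  assumes "\<And>a. compact (B a)" and "\<And>k a. f k a \<in> B a"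
  obtains r l where "strict_mono r" "\<And>a. (\<lambda>k. f (r k) a) \<longlonglongrightarrow> l a" 
proof -
  have "compactin (product_topology (\<lambda>_. euclidean) UNIV) (Pi\<^sub>E UNIV B)"
    by (subst compactin_PiE) (use assms(1) in auto)
  then have "compact (Pi\<^sub>E UNIV B)" by (simp add: euclidean_product_topology)
  then have "seq_compact (Pi\<^sub>E UNIV B)" by (rule compact_imp_seq_compact)
  moreover have "\<forall>k. f k \<in> Pi\<^sub>E UNIV B" using assms(2) by auto
  ultimately obtain l r where lr: "strict_mono r" "(f \<circ> r) \<longlonglongrightarrow> l" by (rule seq_compactE)
  have "(\<lambda>k. f (r k) a) \<longlonglongrightarrow> l a" for a
    using continuous_on_tendsto_compose[OF continuous_on_product_coordinates lr(2), of a] by (simp add: comp_def)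
  then show thesis using that lr(1) by blast
qed

text \<open>Break points and values of a step function. The upper bound on the spacing only serves to
  make these sequences range over a compact set.\<close>

definition step_data :: "real \<Rightarrow> real \<Rightarrow> real \<Rightarrow> (nat \<Rightarrow> real \<times> real) set" where
  "step_data \<delta> H C = {p. fst (p 0) = 0 \<and>
     (\<forall>i. fst (p i) + \<delta> \<le> fst (p (Suc i)) \<and> fst (p (Suc i)) \<le> fst (p i) + H + 1 \<and> \<bar>snd (p i)\<bar> \<le> C)}"

text \<open>A path enters only through its values at the dyadic times \<open>j / 2 ^ n\<close>.\<close>

definition fits_at :: "(nat \<Rightarrow> real \<times> real) \<Rightarrow> real \<Rightarrow> real \<Rightarrow> (nat \<times> nat \<Rightarrow> real) \<Rightarrow> nat \<Rightarrow> nat \<Rightarrow> bool" where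
  "fits_at p r H v n j \<longleftrightarrow>
     (\<forall>i. fst (p i) < j / 2 ^ n \<longrightarrow> j / 2 ^ n < fst (p (Suc i)) \<longrightarrow> j / 2 ^ n < H \<longrightarrow> \<bar>v (n, j) - snd (p i)\<bar> \<le> r)"

definition fits :: "(nat \<Rightarrow> real \<times> real) \<Rightarrow> real \<Rightarrow> real \<Rightarrow> (nat \<times> nat \<Rightarrow> real) \<Rightarrow> bool" where
  "fits p r H v \<longleftrightarrow> (\<forall>n j. fits_at p r H v n j)"

lemma step_dataD:
  assumes "p \<in> step_data \<delta> H C"
  shows "fst (p 0) = 0" "fst (p i) + \<delta> \<le> fst (p (Suc i))" "fst (p (Suc i)) \<le> fst (p i) + H + 1" "\<bar>snd (p i)\<bar> \<le> C"
  using assms by (auto simp: step_data_def)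

lemma step_data_lower:
  assumes "p \<in> step_data \<delta> H C" shows "real i * \<delta> \<le> fst (p i)"
proof (induction i)
  case 0 then show ?case using step_dataD(1)[OF assms] by simp
next
  case (Suc i) then show ?case using step_dataD(2)[OF assms, of i] by (simp add: algebra_simps)
qed

lemma step_data_upper:
  assumes "p \<in> step_data \<delta> H C" shows "fst (p i) \<le> real i * (H + 1)"
proof (induction i)
  case 0 then show ?case using step_dataD(1)[OF assms] by simp
next
  case (Suc i) then show ?case using step_dataD(3)[OF assms, of i] by (simp add: algebra_simps)
qed

lemma step_data_mono:
  assumes "p \<in> step_data \<delta> H C" "0 < \<delta>" "i \<le> j" shows "fst (p i) \<le> fst (p j)"
  by (rule lift_Suc_mono_le[of "\<lambda>i. fst (p i)"]) (use step_dataD(2)[OF assms(1)] assms in \<open>smt (verit)\<close>)+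

lemma step_data_gap:
  assumes "p \<in> step_data \<delta> H C" "0 < \<delta>" "i < j" shows "fst (p i) + \<delta> \<le> fst (p j)"
  using step_dataD(2)[OF assms(1), of i] step_data_mono[OF assms(1,2), of "Suc i" j] assms(3) by simp

lemma step_data_box:
  assumes "p \<in> step_data \<delta> H C" "0 < \<delta>"
  shows "p i \<in> {0..real i * (H + 1)} \<times> {- C..C}"
  using step_data_lower[OF assms(1), of i] step_data_upper[OF assms(1), of i] step_dataD(4)[OF assms(1), of i] assms(2)
  by (auto simp: mem_Times_iff intro: order_trans[of 0 "real i * \<delta>"])

text \<open>The index \<open>a\<close> lets one subsequence serve countably many levels at once,
  each with its own \<open>\<delta>\<close>, \<open>H\<close> and \<open>C\<close>. For a single
  sequence of step data the index type is \<open>unit\<close>.\<close>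

lemma step_data_subsequence:
  fixes p :: "nat \<Rightarrow> 'a::countable \<Rightarrow> nat \<Rightarrow> real \<times> real"
  assumes "\<And>k a. p k a \<in> step_data (\<delta> a) (H a) (C a)" "\<And>a. 0 < \<delta> a"
  obtains r q where "strict_mono r" "\<And>a i. (\<lambda>k. p (r k) a i) \<longlonglongrightarrow> q a i" 
proof -
  define f where "f k = (\<lambda>(a, i). p k a i)" for k
  define B where "B = (\<lambda>(a, i::nat). {0..real i * (H a + 1)} \<times> {- C a..C a})"
  have "compact (B a)" for a by (auto simp: B_def intro: compact_Times split: prod.split)
  moreover have "f k a \<in> B a" for k a
    using step_data_box[OF assms(1) assms(2)] by (auto simp: B_def f_def split: prod.split)
  ultimately obtain r l where "strict_mono r" and l: "\<And>a. (\<lambda>k. f (r k) a) \<longlonglongrightarrow> l a"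
    using coordinatewise_subsequence[of B f] by blast
  then show thesis using that[of r "\<lambda>a i. l (a, i)"] l[of "(_, _)"] by (auto simp: f_def)
qed

lemma step_data_limit:
  assumes p: "\<And>k. p k \<in> step_data \<delta> H C" and lim: "\<And>i. (\<lambda>k. p k i) \<longlonglongrightarrow> q i"
  shows "q \<in> step_data \<delta> H C"
proof -
  have f: "(\<lambda>k. fst (p k i)) \<longlonglongrightarrow> fst (q i)" and s: "(\<lambda>k. snd (p k i)) \<longlonglongrightarrow> snd (q i)" for i
    using lim tendsto_fst tendsto_snd by blast+
  have "fst (q 0) = 0"
    using LIMSEQ_unique[OF f[of 0]] step_dataD(1)[OF p] by simp
  moreover have "fst (q i) + \<delta> \<le> fst (q (Suc i))" for i
    by (rule LIMSEQ_le[OF tendsto_add[OF f tendsto_const] f]) (use step_dataD(2)[OF p] in auto)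
  moreover have "fst (q (Suc i)) \<le> fst (q i) + H + 1" for i
    by (rule LIMSEQ_le[OF f tendsto_add[OF tendsto_add[OF f tendsto_const] tendsto_const]])
       (use step_dataD(3)[OF p] in auto)
  moreover have "\<bar>snd (q i)\<bar> \<le> C" for i
    by (rule LIMSEQ_le_const2[OF tendsto_rabs[OF s]]) (use step_dataD(4)[OF p] in auto)
  ultimately show ?thesis by (simp add: step_data_def)
qed

text \<open>The time constraints in \<open>fits_at\<close> are strict, so if they hold for the
  limiting break points they hold eventually along the sequence. The bound on the values is not
  strict and survives the limit.\<close>

lemma fits_at_limit:
  assumes p: "\<And>i. (\<lambda>k. p k i) \<longlonglongrightarrow> q i" and v: "(\<lambda>k. v k (n, j)) \<longlonglongrightarrow> w (n, j)"
    and fit: "\<forall>\<^sub>F k in sequentially. fits_at (p k) r H (v k) n j"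
  shows "fits_at q r H w n j"
  unfolding fits_at_def
proof (intro allI impI)
  fix i assume i: "fst (q i) < j / 2 ^ n" "j / 2 ^ n < fst (q (Suc i))" "j / 2 ^ n < H"
  have f: "(\<lambda>k. fst (p k i)) \<longlonglongrightarrow> fst (q i)" and s: "(\<lambda>k. snd (p k i)) \<longlonglongrightarrow> snd (q i)" for i
    using p tendsto_fst tendsto_snd by blast+
  have "\<forall>\<^sub>F k in sequentially. fst (p k i) < j / 2 ^ n" "\<forall>\<^sub>F k in sequentially. j / 2 ^ n < fst (p k (Suc i))"
    using order_tendstoD(2)[OF f i(1)] order_tendstoD(1)[OF f i(2)] by auto
  then have "\<forall>\<^sub>F k in sequentially. \<bar>v k (n, j) - snd (p k i)\<bar> \<le> r"
    using fit by eventually_elim (use i(3) in \<open>auto simp: fits_at_def\<close>)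
  then show "\<bar>w (n, j) - snd (q i)\<bar> \<le> r"
    using tendsto_rabs[OF tendsto_diff[OF v s]] by (intro tendsto_upperbound) auto
qed

text \<open>Compactness of the step data keeps the condition closed under the existential quantifier
  over \<open>p\<close>. \<open>I\<close> is a single level for the events on one grid and
  \<open>UNIV\<close> for the event on all dyadic times.\<close>

lemma closed_step_data_fits:
  assumes "0 < \<delta>"
  shows "closed {v. \<exists>p\<in>step_data \<delta> H C. \<forall>n\<in>I. \<forall>j. fits_at p r H v n j}"
  unfolding closed_sequential_limits
proof (intro allI impI, elim conjE)
  fix v w assume "\<forall>k. v k \<in> {v. \<exists>p\<in>step_data \<delta> H C. \<forall>n\<in>I. \<forall>j. fits_at p r H v n j}" and lim: "v \<longlonglongrightarrow> w"
  then obtain p where p: "\<And>k. p k \<in> step_data \<delta> H C" "\<And>k n j. n \<in> I \<Longrightarrow> fits_at (p k) r H (v k) n j"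
    by (auto simp: Bex_def choice_iff)
  obtain s q where s: "strict_mono s" and q: "\<And>a i. (\<lambda>k. p (s k) i) \<longlonglongrightarrow> q (a::unit) i"
    using step_data_subsequence[of "\<lambda>k a::unit. p k" "\<lambda>_. \<delta>" "\<lambda>_. H" "\<lambda>_. C"] p(1) assms by blast
  have v: "(\<lambda>k. v (s k) a) \<longlonglongrightarrow> w a" for a
    using continuous_on_tendsto_compose[OF continuous_on_product_coordinates LIMSEQ_subseq_LIMSEQ[OF lim s], of a]
    by (simp add: comp_def)
  have "fits_at (q ()) r H w n j" if "n \<in> I" for n j
    by (rule fits_at_limit[OF q v]) (use p(2) that in auto)
  moreover have "q () \<in> step_data \<delta> H C" by (rule step_data_limit[OF _ q]) (rule p)
  ultimately show "w \<in> {v. \<exists>p\<in>step_data \<delta> H C. \<forall>n\<in>I. \<forall>j. fits_at p r H v n j}" by blast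
qed

text \<open>The step function fitting at level \<open>n\<close> depends on \<open>n\<close>. It also
  fits at every coarser level, so a cluster point of these step functions fits at all
  levels.\<close>

lemma fits_iff_all_levels:
  assumes "0 < \<delta>" and coarser: "\<And>p n k. k \<le> n \<Longrightarrow> \<forall>j. fits_at p r H v n j \<Longrightarrow> \<forall>j. fits_at p r H v k j"
    and ex: "\<And>n. \<exists>p\<in>step_data \<delta> H C. \<forall>j. fits_at p r H v n j"
  shows "\<exists>p\<in>step_data \<delta> H C. fits p r H v"
proof -
  obtain p where p: "\<And>k. p k \<in> step_data \<delta> H C" "\<And>k j. fits_at (p k) r H v k j" using ex by metis
  obtain s q where s: "strict_mono s" and q: "\<And>a i. (\<lambda>k. p (s k) i) \<longlonglongrightarrow> q (a::unit) i"
    using step_data_subsequence[of "\<lambda>k a::unit. p k" "\<lambda>_. \<delta>" "\<lambda>_. H" "\<lambda>_. C"] p(1) assms(1) by blast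
  have "fits_at (q ()) r H v n j" for n j
  proof (rule fits_at_limit[OF q])
    have "fits_at (p (s k)) r H v n j" if "n \<le> k" for k
      using coarser[of n "s k" "p (s k)"] p(2) seq_suble[OF s, of k] that by auto
    then show "\<forall>\<^sub>F k in sequentially. fits_at (p (s k)) r H v n j"
      unfolding eventually_sequentially by blast
  qed simp
  moreover have "q () \<in> step_data \<delta> H C" by (rule step_data_limit[OF _ q]) (rule p)
  ultimately show ?thesis by (auto simp: fits_def)
qed

lemma fits_at_coarser:
  fixes x :: "real \<Rightarrow> real"
  assumes "k \<le> n" "\<forall>j. fits_at p r H (\<lambda>(n, j::nat). x (j / 2 ^ n)) n j"
  shows "\<forall>j. fits_at p r H (\<lambda>(n, j::nat). x (j / 2 ^ n)) k j"
proof
  fix j :: nat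
  have "real j / 2 ^ k = real (j * 2 ^ (n - k)) / 2 ^ n"
    using assms(1) by (simp add: field_simps power_add[symmetric])
  moreover have "fits_at p r H (\<lambda>(n, j::nat). x (j / 2 ^ n)) n (j * 2 ^ (n - k))" using assms(2) by blast
  ultimately show "fits_at p r H (\<lambda>(n, j::nat). x (j / 2 ^ n)) k j"
    unfolding fits_at_def by simp
qed

section \<open>Time changes that move prescribed points\<close>

lemma lipschitz_time_change:
  assumes g0: "g 0 = 0" and lip: "\<And>s t. 0 \<le> s \<Longrightarrow> 0 \<le> t \<Longrightarrow> \<bar>g t - g s\<bar> \<le> a * \<bar>t - s\<bar>" and a: "0 \<le> a" "a < 1"
  shows "(\<lambda>t. t + g t) \<in> time_changes" "time_change_gamma (\<lambda>t. t + g t) \<le> ennreal (- ln (1 - a))"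
proof -
  define l where "l t = t + g t" for t
  have bounds: "(1 - a) * (t - s) \<le> l t - l s" "l t - l s \<le> (1 + a) * (t - s)" if "0 \<le> s" "s \<le> t" for s t
    using lip[of s t] that by (auto simp: l_def algebra_simps abs_le_iff)
  show gam: "time_change_gamma (\<lambda>t. t + g t) \<le> ennreal (- ln (1 - a))"
    unfolding time_change_gamma_le_iff l_def[symmetric]
  proof (intro allI impI ennreal_leI)
    fix s t :: real assume st: "0 \<le> s" "s < t"
    define R where "R = (l t - l s) / (t - s)"
    have R: "1 - a \<le> R" "R \<le> 1 + a" using bounds[of s t] st by (auto simp: R_def field_simps)
    then have "0 < R" using a by linarith
    have "ln R \<le> ln (1 / (1 - a))"
    proof -
      \<comment> \<open>Chord slopes lie between \<open>1 - a\<close> and \<open>1 + a\<close>;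
        since \<open>1 + a\<close> is at most \<open>1 / (1 - a)\<close>, a single logarithm bounds
        both sides.\<close>
      have "(1 + a) * (1 - a) \<le> 1" by (simp add: algebra_simps)
      then have "1 + a \<le> 1 / (1 - a)" using a by (simp add: field_simps)
      then show ?thesis using R \<open>0 < R\<close> a by simp
    qed
    moreover have "ln (1 - a) \<le> ln R" using R a \<open>0 < R\<close> by simp
    ultimately show "\<bar>ln ((l t - l s) / (t - s))\<bar> \<le> - ln (1 - a)"
      using a unfolding R_def[symmetric] by (simp add: ln_div abs_le_iff)
  qed
  have less: "l s < l t" if "0 \<le> s" "s < t" for s t
  proof -
    have "0 < (1 - a) * (t - s)" using that a by simp
    then show ?thesis using bounds(1)[of s t] that by linarith
  qed
  have l0: "l 0 = 0" by (simp add: l_def g0)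
  have cont: "continuous_on {0..} l"
  proof (rule continuous_on_iff[THEN iffD2], intro ballI allI impI)
    fix s e :: real assume "s \<in> {0..}" "0 < e"
    have "\<bar>l t - l s\<bar> \<le> 2 * \<bar>t - s\<bar>" if "0 \<le> t" for t
    proof -
      have "\<bar>g t - g s\<bar> \<le> a * \<bar>t - s\<bar>" using lip \<open>s \<in> {0..}\<close> that by auto
      also have "\<dots> \<le> 1 * \<bar>t - s\<bar>" using a by (intro mult_right_mono) auto
      finally have "\<bar>g t - g s\<bar> \<le> \<bar>t - s\<bar>" by simp
      moreover have "\<bar>l t - l s\<bar> \<le> \<bar>t - s\<bar> + \<bar>g t - g s\<bar>"
        using abs_triangle_ineq[of "t - s" "g t - g s"] by (simp add: l_def algebra_simps)
      ultimately show ?thesis by simp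
    qed
    then show "\<exists>d>0. \<forall>t\<in>{0..}. dist t s < d \<longrightarrow> dist (l t) (l s) < e"
      using \<open>0 < e\<close> by (intro exI[of _ "e / 2"]) (fastforce simp: dist_real_def)
  qed
  have "l ` {0..} = {0..}"
  proof
    show "l ` {0..} \<subseteq> {0..}" using less[of 0] l0 by (auto simp: le_less)
    show "{0..} \<subseteq> l ` {0..}"
    proof
      fix y :: real assume y: "y \<in> {0..}"
      \<comment> \<open>Slopes are at least \<open>1 - a\<close>, so \<open>l\<close> has reached
        \<open>y\<close> by time \<open>m\<close>, and the intermediate value theorem applies on
        \<open>[0, m]\<close>.\<close>
      define m where "m = y / (1 - a)"
      have m: "0 \<le> m" "y \<le> l m" using bounds(1)[of 0 m] y a l0 by (auto simp: m_def)
      have "\<exists>s. 0 \<le> s \<and> s \<le> m \<and> l s = y"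
        by (rule IVT') (use m y l0 in \<open>auto intro: continuous_on_subset[OF cont]\<close>)
      then show "y \<in> l ` {0..}" by auto
    qed
  qed
  then show "(\<lambda>t. t + g t) \<in> time_changes"
    using order_le_less_trans[OF gam] less unfolding time_changes_def l_def[symmetric]
    by (simp add: strict_mono_on_def)
qed

text \<open>McShane's extension of the displacements \<open>b i\<close> of the break points \<open>T i\<close>.\<close>

lemma time_change_moving_points:
  fixes T b :: "nat \<Rightarrow> real"
  assumes gap: "\<And>i j. i < j \<Longrightarrow> j \<le> I \<Longrightarrow> T i + \<delta> \<le> T j" and "0 < \<delta>" and T0: "T 0 = 0" and b0: "b 0 = 0"
    and a: "a = (\<Sum>i\<le>I. 2 * \<bar>b i\<bar> / \<delta>)" "a < 1"
  obtains l where "l \<in> time_changes" "time_change_gamma l \<le> ennreal (- ln (1 - a))"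
    "\<And>i. i \<le> I \<Longrightarrow> l (T i) = T i + b i"
proof -
  define F where "F t i = b i + a * \<bar>t - T i\<bar>" for t i
  define g where "g t = Min (F t ` {..I})" for t
  have a0: "0 \<le> a" unfolding a(1) using \<open>0 < \<delta>\<close> by (intro sum_nonneg) auto
  have gle: "g t \<le> F t i" if "i \<le> I" for t i
    unfolding g_def using that by (intro Min_le) auto
  have gex: "\<exists>i\<le>I. g t = F t i" for t
  proof -
    have "g t \<in> F t ` {..I}" unfolding g_def by (rule Min_in) auto
    then show ?thesis by auto
  qed
  \<comment> \<open>Two displacements thus differ by at most \<open>a * \<delta>\<close>, hence by
    at most \<open>a\<close> times the distance of their break points. So \<open>b\<close> is
    Lipschitz on the break points with constant \<open>a\<close>, and its extension takes the value
    \<open>b j\<close> at \<open>T j\<close>.\<close>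
  have half: "\<bar>b i\<bar> \<le> a * \<delta> / 2" if "i \<le> I" for i
  proof -
    have "2 * \<bar>b i\<bar> / \<delta> \<le> a" unfolding a(1) using that \<open>0 < \<delta>\<close> by (intro member_le_sum) auto
    then show ?thesis using \<open>0 < \<delta>\<close> by (simp add: field_simps)
  qed
  have one: "g t \<le> g s + a * \<bar>t - s\<bar>" for s t
  proof -
    obtain i where i: "i \<le> I" "g s = F s i" using gex by blast
    have "F t i \<le> F s i + a * \<bar>t - s\<bar>"
    proof -
      have "a * \<bar>t - T i\<bar> \<le> a * (\<bar>s - T i\<bar> + \<bar>t - s\<bar>)" using a0 by (intro mult_left_mono) auto
      then show ?thesis by (simp add: F_def algebra_simps)
    qed
    then show ?thesis using gle[OF i(1), of t] i(2) by linarith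
  qed
  have lip: "\<bar>g t - g s\<bar> \<le> a * \<bar>t - s\<bar>" for s t
    using one[of t s] one[of s t] by (simp add: abs_minus_commute)
  have gT: "g (T j) = b j" if "j \<le> I" for j
  proof (rule antisym)
    show "g (T j) \<le> b j" using gle[OF that, of "T j"] by (simp add: F_def)
    obtain i where i: "i \<le> I" "g (T j) = F (T j) i" using gex by blast
    show "b j \<le> g (T j)"
    proof (cases "i = j")
      case True then show ?thesis using i by (simp add: F_def)
    next
      case False
      then have "\<delta> \<le> \<bar>T j - T i\<bar>" using gap[of i j] gap[of j i] that i by (cases "i < j") auto
      then have "a * \<delta> \<le> a * \<bar>T j - T i\<bar>" using a0 by (rule mult_left_mono)
      then show ?thesis using half[OF that] half[OF i(1)] i(2) by (simp add: F_def)
    qed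
  qed
  have "g 0 = 0" using gT[of 0] T0 b0 by simp
  note lipschitz_time_change[OF this lip a0 a(2)]
  then show thesis using that gT by simp
qed

subsection \<open>A family of compact sets\<close>

text \<open>The classical compactness criterion by the modulus \<open>w'\<close>, which allows jumps
  at well separated times, stated through dyadic values. Level \<open>N\<close> uses horizon
  \<open>N\<close> and tolerance \<open>1 / (N + 1)\<close>, so that all levels together determine
  the path.\<close>

definition skorokhod_compact :: "(nat \<Rightarrow> real) \<Rightarrow> real \<Rightarrow> (real \<Rightarrow> real) set" where
  "skorokhod_compact \<delta> C = {x \<in> skorokhod_space.
     \<forall>N. \<exists>p\<in>step_data (\<delta> N) (real N) C. fits p (1 / (real N + 1)) (real N) (\<lambda>(n, j::nat). x (j / 2 ^ n))}"

definition step_index :: "(nat \<Rightarrow> real \<times> real) \<Rightarrow> real \<Rightarrow> nat" where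
  "step_index p s = (LEAST i. s < fst (p (Suc i)))"

lemma step_index:
  assumes p: "p \<in> step_data \<delta> H C" and "0 < \<delta>" "0 \<le> s"
  shows "fst (p (step_index p s)) \<le> s" "s < fst (p (Suc (step_index p s)))"
proof -
  obtain i :: nat where "s < real i * \<delta>" using reals_Archimedean3[OF \<open>0 < \<delta>\<close>] by blast
  then have "s < fst (p i)" using step_data_lower[OF p, of i] by linarith
  moreover have "fst (p i) \<le> fst (p (Suc i))" using step_data_mono[OF p \<open>0 < \<delta>\<close>] by simp
  ultimately have "s < fst (p (Suc i))" by linarith
  then show "s < fst (p (Suc (step_index p s)))" unfolding step_index_def by (rule LeastI)
  show "fst (p (step_index p s)) \<le> s"
  proof (cases "step_index p s")
    case 0 then show ?thesis using step_dataD(1)[OF p] \<open>0 \<le> s\<close> by simp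
  next
    case (Suc k)
    then have "k < (LEAST i. s < fst (p (Suc i)))" by (simp add: step_index_def)
    from not_less_Least[OF this] show ?thesis by (simp add: Suc)
  qed
qed

lemma step_index_unique:
  assumes p: "p \<in> step_data \<delta> H C" and "0 < \<delta>" "fst (p i) \<le> s" "s < fst (p (Suc i))"
  shows "step_index p s = i"
proof -
  have "0 \<le> s" using step_data_mono[OF p \<open>0 < \<delta>\<close>, of 0 i] step_dataD(1)[OF p] assms(3) by simp
  note I = step_index[OF p \<open>0 < \<delta>\<close> this]
  show ?thesis
  proof (rule linorder_cases)
    assume "step_index p s < i"
    then show ?thesis using step_data_mono[OF p \<open>0 < \<delta>\<close>, of "Suc (step_index p s)" i] I assms(3) by simp
  next
    assume "i < step_index p s"
    then show ?thesis using step_data_mono[OF p \<open>0 < \<delta>\<close>, of "Suc i" "step_index p s"] I assms(4) by simp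
  qed simp
qed

text \<open>The dyadic times used lie strictly to the right of \<open>s\<close>, as the
  \<open>+ 1\<close> in \<open>j\<close> ensures. They satisfy the strict lower constraint of
  \<open>fits_at\<close> even if \<open>s\<close> is itself a break point; this is how the step
  becomes closed at its left end.\<close>

lemma fits_right_continuous:
  fixes x :: "real \<Rightarrow> real"
  assumes x: "cadlag x" and fit: "fits p r H (\<lambda>(n, j::nat). x (j / 2 ^ n))"
    and s: "0 \<le> s" "fst (p i) \<le> s" "s < fst (p (Suc i))" "s < H"
  shows "\<bar>x s - snd (p i)\<bar> \<le> r"
proof -
  define j where "j n = nat \<lfloor>2 ^ n * s\<rfloor> + 1" for n
  define q where "q n = real (j n) / 2 ^ n" for n
  have q: "s < q n" "q n \<le> s + 1 / 2 ^ n" for n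
  proof -
    have "real (j n) = of_int \<lfloor>2 ^ n * s\<rfloor> + 1" using s(1) by (simp add: j_def)
    then have "2 ^ n * s < real (j n)" "real (j n) \<le> 2 ^ n * s + 1" by linarith+
    then show "s < q n" "q n \<le> s + 1 / 2 ^ n" by (auto simp: q_def field_simps)
  qed
  have "filterlim q (at_right s) sequentially"
  proof (rule filterlim_at_right_sandwich)
    fix n
    have "real (Suc n) \<le> 2 ^ n" using of_nat_mono[OF Suc_leI[OF less_exp[of n]]] by simp
    then have "1 / 2 ^ n \<le> 1 / real (Suc n)" by (intro divide_left_mono) auto
    then show "q n \<le> s + 1 / real (Suc n)" using q(2)[of n] by linarith
  qed (rule q)
  then have lim: "(\<lambda>n. x (q n)) \<longlonglongrightarrow> x s" and "q \<longlonglongrightarrow> s"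
    using filterlim_compose[OF cadlagD_right[OF x s(1)]] by (auto simp: filterlim_at)
  then have "\<forall>\<^sub>F n in sequentially. q n < fst (p (Suc i))" "\<forall>\<^sub>F n in sequentially. q n < H"
    using s(3,4) order_tendstoD(2) by blast+
  then have "\<forall>\<^sub>F n in sequentially. \<bar>x (q n) - snd (p i)\<bar> \<le> r"
  proof eventually_elim
    case (elim n)
    then show ?case
      using fit[unfolded fits_def, rule_format, of n "j n"] q(1)[of n] s(2) unfolding fits_at_def
      by (auto simp: q_def)
  qed
  then show ?thesis
    using tendsto_rabs[OF tendsto_diff[OF lim tendsto_const]] by (intro tendsto_upperbound) auto
qed

text \<open>A Cauchy criterion: step approximations bound the oscillation to the left of
  \<open>s\<close> without naming the limit.\<close>

lemma left_limit_real:
  fixes x :: "real \<Rightarrow> real"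
  assumes "\<And>e. 0 < e \<Longrightarrow> \<exists>d>0. \<forall>a b. s - d < a \<longrightarrow> a < s \<longrightarrow> s - d < b \<longrightarrow> b < s \<longrightarrow> \<bar>x a - x b\<bar> \<le> e"
  shows "\<exists>l. (x \<longlongrightarrow> l) (at_left s)"
proof -
  define q where "q n = s - 1 / real (Suc n)" for n
  have q: "\<forall>\<^sub>F n in sequentially. s - d < q n" if "0 < d" for d
  proof -
    have "(\<lambda>n. s - inverse (real (Suc n))) \<longlonglongrightarrow> s - 0"
      by (intro tendsto_diff tendsto_const LIMSEQ_inverse_real_of_nat)
    then have "q \<longlonglongrightarrow> s" by (simp add: q_def[abs_def] inverse_eq_divide)
    then show ?thesis using that by (intro order_tendstoD(1)) auto
  qed
  have qs: "q n < s" for n by (simp add: q_def)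
  have "Cauchy (\<lambda>n. x (q n))"
  proof (rule metric_CauchyI)
    fix e :: real assume "0 < e"
    then obtain d where d: "0 < d" "\<And>a b. s - d < a \<Longrightarrow> a < s \<Longrightarrow> s - d < b \<Longrightarrow> b < s \<Longrightarrow> \<bar>x a - x b\<bar> \<le> e / 2"
      using assms[of "e / 2"] by auto
    obtain M where "\<And>n. M \<le> n \<Longrightarrow> s - d < q n" using q[OF d(1)] unfolding eventually_sequentially by blast
    then have "dist (x (q m)) (x (q n)) < e" if "M \<le> m" "M \<le> n" for m n
      using d(2)[of "q m" "q n"] qs[of m] qs[of n] that \<open>0 < e\<close> by (simp add: dist_real_def)
    then show "\<exists>M. \<forall>m\<ge>M. \<forall>n\<ge>M. dist (x (q m)) (x (q n)) < e" by blast
  qed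
  then obtain l where l: "(\<lambda>n. x (q n)) \<longlonglongrightarrow> l" using Cauchy_convergent_iff convergent_def by blast
  have "(x \<longlongrightarrow> l) (at_left s)"
  proof (rule tendstoI)
    fix e :: real assume "0 < e"
    then obtain d where d: "0 < d" "\<And>a b. s - d < a \<Longrightarrow> a < s \<Longrightarrow> s - d < b \<Longrightarrow> b < s \<Longrightarrow> \<bar>x a - x b\<bar> \<le> e / 2"
      using assms[of "e / 2"] by auto
    have "\<bar>x a - l\<bar> \<le> e / 2" if "s - d < a" "a < s" for a
    proof (rule tendsto_upperbound[OF tendsto_rabs[OF tendsto_diff[OF tendsto_const l]]])
      show "\<forall>\<^sub>F n in sequentially. \<bar>x a - x (q n)\<bar> \<le> e / 2"
        using q[OF d(1)] by eventually_elim (use d(2) that qs in auto)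
    qed simp
    then have "dist (x a) l < e" if "s - d < a" "a < s" for a
      using that \<open>0 < e\<close> by (fastforce simp: dist_real_def)
    then show "\<forall>\<^sub>F a in at_left s. dist (x a) l < e"
      unfolding eventually_at_left_field using d(1) by (intro exI[of _ "s - d"]) auto
  qed
  then show ?thesis by blast
qed

text \<open>The situation after a subsequence has been extracted: at each level the step data of the
  paths converge. The paths themselves need not converge pointwise, so the limit path
  \<open>x\<close> is built from the limiting step data alone.\<close>

locale step_approximations =
  fixes \<delta> :: "nat \<Rightarrow> real" and C :: real and X :: "nat \<Rightarrow> real \<Rightarrow> real"
    and P :: "nat \<Rightarrow> nat \<Rightarrow> nat \<Rightarrow> real \<times> real" and p :: "nat \<Rightarrow> nat \<Rightarrow> real \<times> real"
  assumes \<delta>: "\<And>N. 0 < \<delta> N" and X: "\<And>k. X k \<in> skorokhod_space"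
    and P: "\<And>k N. P k N \<in> step_data (\<delta> N) (real N) C"
    and fit: "\<And>k N. fits (P k N) (1 / (real N + 1)) (real N) (\<lambda>(n, j::nat). X k (j / 2 ^ n))"
    and lim: "\<And>N i. (\<lambda>k. P k N i) \<longlonglongrightarrow> p N i"
begin

lemma X_cadlag: "cadlag (X k)" using X by (auto simp: skorokhod_space_def)

lemma p: "p N \<in> step_data (\<delta> N) (real N) C"
  by (rule step_data_limit[OF P lim])

lemma break_point_limit: "(\<lambda>k. fst (P k N i)) \<longlonglongrightarrow> fst (p N i)" and value_limit: "(\<lambda>k. snd (P k N i)) \<longlonglongrightarrow> snd (p N i)"
  using lim tendsto_fst tendsto_snd by blast+

lemma X_near: "0 \<le> s \<Longrightarrow> fst (P k N i) \<le> s \<Longrightarrow> s < fst (P k N (Suc i)) \<Longrightarrow> s < real N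
    \<Longrightarrow> \<bar>X k s - snd (P k N i)\<bar> \<le> 1 / (real N + 1)"
  by (rule fits_right_continuous[OF X_cadlag fit])

definition step_value :: "nat \<Rightarrow> real \<Rightarrow> real" where
  "step_value N s = snd (p N (step_index (p N) s))"

lemma step_value_eq: "fst (p N i) \<le> s \<Longrightarrow> s < fst (p N (Suc i)) \<Longrightarrow> step_value N s = snd (p N i)"
  by (simp add: step_value_def step_index_unique[OF p \<delta>])

text \<open>Both levels approximate the same \<open>X k\<close>. At \<open>s\<close> a break point
  of \<open>P k\<close> may still lie on the wrong side, so the comparison is made at some
  \<open>s' > s\<close> inside both limiting steps, where all inequalities are strict and hold for
  large \<open>k\<close>.\<close>

lemma step_value_close:
  assumes s: "0 \<le> s" "s < real N" "s < real M"
  shows "\<bar>step_value N s - step_value M s\<bar> \<le> 1 / (real N + 1) + 1 / (real M + 1)"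
proof -
  define i j where "i = step_index (p N) s" and "j = step_index (p M) s"
  note I = step_index[OF p \<delta> s(1), of N, folded i_def] and J = step_index[OF p \<delta> s(1), of M, folded j_def]
  obtain s' where s': "s < s'" "s' < Min {fst (p N (Suc i)), fst (p M (Suc j)), real N, real M}"
    using dense[of s "Min {fst (p N (Suc i)), fst (p M (Suc j)), real N, real M}"] I J s by auto
  have "\<forall>\<^sub>F k in sequentially. fst (P k N i) < s'" "\<forall>\<^sub>F k in sequentially. fst (P k M j) < s'"
    using I J s' order_tendstoD(2)[OF break_point_limit] by (auto intro: order_le_less_trans)
  moreover have "\<forall>\<^sub>F k in sequentially. s' < fst (P k N (Suc i))" "\<forall>\<^sub>F k in sequentially. s' < fst (P k M (Suc j))"
    using s' order_tendstoD(1)[OF break_point_limit] by auto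
  ultimately have "\<forall>\<^sub>F k in sequentially. \<bar>snd (P k N i) - snd (P k M j)\<bar> \<le> 1 / (real N + 1) + 1 / (real M + 1)"
  proof eventually_elim
    case (elim k)
    then have "\<bar>X k s' - snd (P k N i)\<bar> \<le> 1 / (real N + 1)" "\<bar>X k s' - snd (P k M j)\<bar> \<le> 1 / (real M + 1)"
      using s(1) s' by (auto intro!: X_near)
    then show ?case by linarith
  qed
  then show ?thesis unfolding step_value_def i_def[symmetric] j_def[symmetric]
    by (intro tendsto_upperbound[OF tendsto_rabs[OF tendsto_diff[OF value_limit value_limit]]]) auto
qed

lemma inverse_tendsto_0: "(\<lambda>N. 1 / (real N + 1)) \<longlonglongrightarrow> 0"
  using LIMSEQ_inverse_real_of_nat by (simp add: inverse_eq_divide add.commute)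

lemma eventually_level:
  assumes "0 < e" shows "\<forall>\<^sub>F N in sequentially. 1 / (real N + 1) < e / 2 \<and> s < real N"
proof (rule eventually_conj)
  show "\<forall>\<^sub>F N in sequentially. 1 / (real N + 1) < e / 2"
    by (rule order_tendstoD(2)[OF inverse_tendsto_0]) (use assms in simp)
  show "\<forall>\<^sub>F N in sequentially. s < real N"
    using reals_Archimedean2[of s] unfolding eventually_sequentially
    by (meson less_le_trans of_nat_mono)
qed

definition x :: "real \<Rightarrow> real" where
  "x = (\<lambda>s\<in>{0..}. lim (\<lambda>N. step_value N s))"

lemma x_close:
  assumes s: "0 \<le> s" "s < real N" shows "\<bar>x s - step_value N s\<bar> \<le> 1 / (real N + 1)"
proof -
  have "Cauchy (\<lambda>N. step_value N s)"
  proof (rule metric_CauchyI)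
    fix e :: real assume "0 < e"
    then obtain K where K: "\<And>N. K \<le> N \<Longrightarrow> 1 / (real N + 1) < e / 2 \<and> s < real N"
      using eventually_level[of e s] unfolding eventually_sequentially by blast
    have "dist (step_value m s) (step_value n s) < e" if "K \<le> m" "K \<le> n" for m n
      using step_value_close[OF s(1), of m n] K[OF that(1)] K[OF that(2)] by (simp add: dist_real_def)
    then show "\<exists>K. \<forall>m\<ge>K. \<forall>n\<ge>K. dist (step_value m s) (step_value n s) < e" by blast
  qed
  then have "(\<lambda>N. step_value N s) \<longlonglongrightarrow> x s"
    using s by (simp add: x_def Cauchy_convergent_iff convergent_LIMSEQ_iff)
  then have "(\<lambda>M. \<bar>step_value M s - step_value N s\<bar>) \<longlonglongrightarrow> \<bar>x s - step_value N s\<bar>" by (intro tendsto_intros)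
  moreover have "(\<lambda>M. 1 / (real M + 1) + 1 / (real N + 1)) \<longlonglongrightarrow> 0 + 1 / (real N + 1)"
    by (intro tendsto_add inverse_tendsto_0 tendsto_const)
  moreover have "\<exists>K. \<forall>M\<ge>K. \<bar>step_value M s - step_value N s\<bar> \<le> 1 / (real M + 1) + 1 / (real N + 1)"
    using step_value_close[OF s(1) _ s(2)] s(2) by (meson less_le_trans of_nat_mono)
  ultimately show ?thesis using LIMSEQ_le by fastforce
qed

lemma x_near:
  assumes "0 \<le> s" "fst (p N i) \<le> s" "s < fst (p N (Suc i))" "s < real N"
  shows "\<bar>x s - snd (p N i)\<bar> \<le> 1 / (real N + 1)"
  using x_close[OF assms(1,4)] step_value_eq[OF assms(2,3)] by simp

lemma x_right:
  assumes "0 \<le> s" shows "(x \<longlongrightarrow> x s) (at_right s)"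
  unfolding right_limit_iff
proof (intro allI impI)
  fix e :: real assume "0 < e"
  then obtain N where N: "1 / (real N + 1) < e / 2" "s < real N"
    using eventually_happens[OF eventually_level] by (metis sequentially_bot)
  define i where "i = step_index (p N) s"
  note I = step_index[OF p \<delta> assms(1), of N, folded i_def]
  define d where "d = min (fst (p N (Suc i))) (real N) - s"
  have "dist (x t) (x s) < e" if "s \<le> t" "t < s + d" for t
    using x_near[of t N i] x_near[of s N i] that assms I N by (simp add: d_def dist_real_def)
  then show "\<exists>d>0. \<forall>t. s \<le> t \<and> t < s + d \<longrightarrow> dist (x t) (x s) < e"
    using I N by (intro exI[of _ d]) (auto simp: d_def)
qed

lemma x_left:
  assumes "0 < s" shows "\<exists>l. (x \<longlongrightarrow> l) (at_left s)"
proof (rule left_limit_real)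
  fix e :: real assume "0 < e"
  then obtain N where N: "1 / (real N + 1) < e / 2" "s < real N"
    using eventually_happens[OF eventually_level] by (metis sequentially_bot)
  \<comment> \<open>A left limit needs the step that ends at or after \<open>s\<close>. If
    \<open>s\<close> is a break point this is the step before it, which exists because the first
    break point is 0 and \<open>s > 0\<close>.\<close>
  have "\<exists>i. fst (p N i) < s \<and> s \<le> fst (p N (Suc i))"
  proof (cases "fst (p N (step_index (p N) s)) < s")
    case True
    then show ?thesis using step_index[OF p \<delta>, of s N] assms less_imp_le by blast
  next
    case False
    then have eq: "fst (p N (step_index (p N) s)) = s" using step_index[OF p \<delta>, of s N] assms by auto
    then obtain k where k: "step_index (p N) s = Suc k"
      using assms step_dataD(1)[OF p[of N]] by (cases "step_index (p N) s") auto
    then show ?thesis using eq step_data_gap[OF p \<delta>, of k "Suc k" N] \<delta>[of N] by (intro exI[of _ k]) auto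
  qed
  then obtain i where i: "fst (p N i) < s" "s \<le> fst (p N (Suc i))" by blast
  have p0: "0 \<le> fst (p N i)" using step_data_mono[OF p \<delta>, of 0 i N] step_dataD(1)[OF p[of N]] by simp
  have "\<bar>x a - x b\<bar> \<le> e" if "fst (p N i) < a" "a < s" "fst (p N i) < b" "b < s" for a b
    using x_near[of a N i] x_near[of b N i] that i p0 N by (simp add: abs_le_iff)
  then show "\<exists>d>0. \<forall>a b. s - d < a \<longrightarrow> a < s \<longrightarrow> s - d < b \<longrightarrow> b < s \<longrightarrow> \<bar>x a - x b\<bar> \<le> e"
    using i by (intro exI[of _ "s - fst (p N i)"]) auto
qed

lemma x_space: "x \<in> skorokhod_space"
  using x_left x_right by (auto simp: skorokhod_space_def cadlag_def x_def)

lemma x_compact: "x \<in> skorokhod_compact \<delta> C"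
proof -
  have "fits (p N) (1 / (real N + 1)) (real N) (\<lambda>(n, j::nat). x (j / 2 ^ n))" for N
    unfolding fits_def fits_at_def by (auto intro!: x_near)
  then show ?thesis using x_space p by (auto simp: skorokhod_compact_def)
qed

text \<open>Spacing at least \<open>\<delta> N\<close> leaves finitely many break points up to the
  horizon. Their displacements from \<open>p N\<close> to \<open>P k N\<close> tend to 0, so they
  can be matched by time changes whose \<open>gamma\<close> tends to 0.\<close>

lemma time_changes_to_X:
  obtains l where "\<And>k. l k \<in> time_changes" "(\<lambda>k. time_change_gamma (l k)) \<longlonglongrightarrow> 0"
    "\<And>i. fst (p N i) \<le> real N \<Longrightarrow> \<forall>\<^sub>F k in sequentially. l k (fst (p N i)) = fst (P k N i) \<and> l k (fst (p N (Suc i))) = fst (P k N (Suc i))"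
proof -
  \<comment> \<open>A break point at or before \<open>N\<close> has index below \<open>I\<close>, so
    its successor has index at most \<open>I\<close> and is matched too.\<close>
  obtain I :: nat where I: "real N < real I * \<delta> N" using reals_Archimedean3[OF \<delta>] by blast
  define b where "b k i = fst (P k N i) - fst (p N i)" for k i
  define a where "a k = (\<Sum>i\<le>I. 2 * \<bar>b k i\<bar> / \<delta> N)" for k
  have "(\<lambda>k. b k i) \<longlonglongrightarrow> 0" for i
    unfolding b_def using tendsto_diff[OF break_point_limit[of N i] tendsto_const[of "fst (p N i)"]] by simp
  then have "a \<longlonglongrightarrow> (\<Sum>i\<le>I. 2 * \<bar>0\<bar> / \<delta> N)"
    unfolding a_def[abs_def] using \<delta>[of N] by (intro tendsto_intros) auto
  then have a: "a \<longlonglongrightarrow> 0" by simp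
  have ex: "\<exists>l. l \<in> time_changes \<and> (a k < 1 \<longrightarrow> time_change_gamma l \<le> ennreal (- ln (1 - a k)) \<and>
      (\<forall>i\<le>I. l (fst (p N i)) = fst (P k N i)))" for k
  proof (cases "a k < 1")
    case True
    have "b k 0 = 0" using step_dataD(1)[OF p[of N]] step_dataD(1)[OF P[of k N]] by (simp add: b_def)
    then obtain l where "l \<in> time_changes" "time_change_gamma l \<le> ennreal (- ln (1 - a k))"
      "\<And>i. i \<le> I \<Longrightarrow> l (fst (p N i)) = fst (p N i) + b k i"
      using time_change_moving_points[of I "\<lambda>i. fst (p N i)" "\<delta> N" "b k" "a k"]
        step_data_gap[OF p \<delta>] \<delta>[of N] step_dataD(1)[OF p[of N]] True a_def by blast
    then show ?thesis by (auto simp: b_def)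
  \<comment> \<open>The identity is a placeholder for the indices \<open>k\<close> at which the
    displacements are still too large.\<close>
  qed (use time_change_id in blast)
  then obtain l where l: "\<And>k. l k \<in> time_changes" "\<And>k. a k < 1 \<Longrightarrow> time_change_gamma (l k) \<le> ennreal (- ln (1 - a k))"
      "\<And>k i. a k < 1 \<Longrightarrow> i \<le> I \<Longrightarrow> l k (fst (p N i)) = fst (P k N i)"
    by metis
  have a1: "\<forall>\<^sub>F k in sequentially. a k < 1" using order_tendstoD(2)[OF a] by simp
  have "(\<lambda>k. - ln (1 - a k)) \<longlonglongrightarrow> - ln (1 - 0)" by (intro tendsto_intros a) auto
  then have "(\<lambda>k. ennreal (- ln (1 - a k))) \<longlonglongrightarrow> 0" using tendsto_ennrealI by fastforce
  then have "(\<lambda>k. time_change_gamma (l k)) \<longlonglongrightarrow> 0"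
    by (rule tendsto_sandwich[OF _ _ tendsto_const, rotated 2]) (use l(2) in \<open>auto intro: eventually_mono[OF a1]\<close>)
  moreover have "\<forall>\<^sub>F k in sequentially. l k (fst (p N i)) = fst (P k N i) \<and> l k (fst (p N (Suc i))) = fst (P k N (Suc i))"
    if "fst (p N i) \<le> real N" for i
  proof -
    have "real i * \<delta> N < real I * \<delta> N" using step_data_lower[OF p[of N], of i] that I by linarith
    then have "i < I" using \<delta>[of N] by simp
    from a1 show ?thesis by eventually_elim (use l(3) \<open>i < I\<close> in auto)
  qed
  ultimately show thesis using that l(1) by blast
qed

text \<open>Once \<open>l k\<close> matches the break points, \<open>t\<close> and
  \<open>l k t\<close> lie in corresponding steps of \<open>x\<close> and \<open>X k\<close>, so the
  values differ by two tolerances plus the error of the step value. The sum in \<open>r\<close>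
  covers all steps before \<open>u\<close> at once. As \<open>u\<close> is no break point, it
  eventually lies in the same step of both.\<close>

lemma limsup_stopped_dist:
  assumes l: "\<And>k. l k \<in> time_changes"
    and lT: "\<And>i. fst (p N i) \<le> real N \<Longrightarrow> \<forall>\<^sub>F k in sequentially. l k (fst (p N i)) = fst (P k N i) \<and> l k (fst (p N (Suc i))) = fst (P k N (Suc i))"
    and u: "0 \<le> u" "u < real N" "u \<notin> range (\<lambda>i. fst (p N i))" and "0 \<le> c"
  shows "limsup (\<lambda>k. ennreal c * stopped_dist x (X k) (l k) u) \<le> ennreal c * ennreal (2 / (real N + 1))"
proof -
  define I where "I = step_index (p N) u"
  have I: "fst (p N I) < u" "u < fst (p N (Suc I))"
  proof -
    have "fst (p N I) \<noteq> u" using u(3) by blast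
    then show "fst (p N I) < u" "u < fst (p N (Suc I))"
      using step_index[OF p \<delta> u(1), of N] by (auto simp: I_def)
  qed
  have TN: "fst (p N i) \<le> real N" if "i \<le> I" for i
    using step_data_mono[OF p \<delta> that, of N] I(1) u(2) by linarith
  define r where "r k = 2 / (real N + 1) + (\<Sum>j\<le>I. \<bar>snd (P k N j) - snd (p N j)\<bar>)" for k
  have "r \<longlonglongrightarrow> 2 / (real N + 1) + (\<Sum>j\<le>I. \<bar>snd (p N j) - snd (p N j)\<bar>)"
    unfolding r_def[abs_def] by (intro tendsto_intros value_limit)
  then have rlim: "r \<longlonglongrightarrow> 2 / (real N + 1)" by simp
  have "\<forall>\<^sub>F k in sequentially. \<forall>i\<in>{..I}. l k (fst (p N i)) = fst (P k N i) \<and> l k (fst (p N (Suc i))) = fst (P k N (Suc i))"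
    using lT TN by (intro eventually_ball_finite) auto
  moreover have "\<forall>\<^sub>F k in sequentially. fst (P k N I) < u" "\<forall>\<^sub>F k in sequentially. u < fst (P k N (Suc I))"
    using order_tendstoD(2)[OF break_point_limit I(1)] order_tendstoD(1)[OF break_point_limit I(2)] by auto
  ultimately have "\<forall>\<^sub>F k in sequentially. stopped_dist x (X k) (l k) u \<le> ennreal (r k)"
  proof eventually_elim
    case (elim k)
    have close: "\<bar>x a - X k b\<bar> \<le> r k"
      if "j \<le> I" "0 \<le> a" "fst (p N j) \<le> a" "a < fst (p N (Suc j))" "a < real N"
        "0 \<le> b" "fst (P k N j) \<le> b" "b < fst (P k N (Suc j))" "b < real N" for a b j
    proof -
      have "\<bar>snd (P k N j) - snd (p N j)\<bar> \<le> (\<Sum>j\<le>I. \<bar>snd (P k N j) - snd (p N j)\<bar>)"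
        using that(1) by (intro member_le_sum) auto
      then show ?thesis
        using x_near[OF that(2-5)] X_near[OF that(6-9)] unfolding r_def by (simp add: abs_le_iff)
    qed
    show ?case unfolding stopped_dist_le_iff
    proof (intro allI impI ennreal_leI)
      fix t :: real assume t: "0 \<le> t"
      have l0: "0 \<le> l k t" by (rule time_change_nonneg[OF l t])
      have "\<bar>x (min t u) - X k (min (l k t) u)\<bar> \<le> r k"
      proof (cases "t \<le> u \<and> l k t \<le> u")
        case True
        define j where "j = step_index (p N) t"
        have J: "fst (p N j) \<le> t" "t < fst (p N (Suc j))" using step_index[OF p \<delta> t, of N] by (auto simp: j_def)
        have "j \<le> I"
        proof (rule ccontr)
          assume "\<not> j \<le> I"
          then have "fst (p N (Suc I)) \<le> fst (p N j)" by (intro step_data_mono[OF p \<delta>]) auto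
          then show False using J I True by simp
        qed
        have p0: "0 \<le> fst (p N j)" using step_data_mono[OF p \<delta>, of 0 j N] step_dataD(1)[OF p[of N]] by simp
        have "fst (P k N j) \<le> l k t" "l k t < fst (P k N (Suc j))"
          using time_change_mono[OF l p0 J(1), of k] time_change_less[OF l t J(2), of k] elim(1) \<open>j \<le> I\<close> by auto
        then show ?thesis using close[OF \<open>j \<le> I\<close>, of t "l k t"] True t l0 J u by simp
      next
        \<comment> \<open>At least one clock has stopped at \<open>u\<close>. Then both stopped
          times lie in step \<open>I\<close>, the one containing \<open>u\<close>, because
          \<open>l k\<close> matches its left end.\<close>
        case False
        have p0: "0 \<le> fst (p N I)" using step_data_mono[OF p \<delta>, of 0 I N] step_dataD(1)[OF p[of N]] by simp
        have lI: "l k (fst (p N I)) = fst (P k N I)" using elim(1) by auto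
        have "fst (p N I) \<le> min t u"
        proof (cases "t \<le> u")
          case True
          then have "u < l k t" using False by simp
          then have "\<not> t < fst (p N I)" using time_change_less[OF l t, of "fst (p N I)" k] lI elim(2) by auto
          then show ?thesis using True by simp
        qed (use I in simp)
        moreover have "fst (P k N I) \<le> min (l k t) u"
        proof (cases "l k t \<le> u")
          case True
          then have "fst (p N I) \<le> t" using False I by simp
          then show ?thesis using time_change_mono[OF l p0, of t k] lI elim(2) by simp
        qed (use elim in simp)
        ultimately show ?thesis using I u elim t l0 by (intro close[OF order_refl]) auto
      qed
      then show "min (dist (x (min t u)) (X k (min (l k t) u))) 1 \<le> r k"
        by (simp add: dist_real_def min.coboundedI1)
    qed
  qed
  then have "\<forall>\<^sub>F k in sequentially. ennreal c * stopped_dist x (X k) (l k) u \<le> ennreal (c * r k)"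
    by eventually_elim (simp add: ennreal_mult' \<open>0 \<le> c\<close> mult_left_mono)
  then have "limsup (\<lambda>k. ennreal c * stopped_dist x (X k) (l k) u) \<le> limsup (\<lambda>k. ennreal (c * r k))"
    by (rule Limsup_mono)
  also have "\<dots> = ennreal (c * (2 / (real N + 1)))"
    by (intro lim_imp_Limsup tendsto_ennrealI tendsto_mult tendsto_const rlim) simp
  also have "\<dots> = ennreal c * ennreal (2 / (real N + 1))" by (rule ennreal_mult) (use \<open>0 \<le> c\<close> in auto)
  finally show ?thesis .
qed

text \<open>Reverse Fatou with the integrable weight \<open>w\<close>. Levels below \<open>N\<close>
  contribute at most \<open>2 / (N + 1)\<close> in the limit, levels beyond \<open>N\<close> at most
  \<open>exp (- N)\<close>, and the exceptional levels are the countably many break points, a null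
  set.\<close>

lemma eventually_dist_less:
  assumes "0 < e"
  shows "\<forall>\<^sub>F k in sequentially. skorokhod_dist x (X k) < e"
proof -
  have "(\<lambda>N. 2 * (1 / (real N + 1)) + exp (- real N)) \<longlonglongrightarrow> 2 * 0 + 0"
    by (intro tendsto_add tendsto_mult tendsto_const inverse_tendsto_0
        filterlim_compose[OF exp_at_bot] filterlim_compose[OF filterlim_uminus_at_bot_at_top filterlim_real_sequentially])
  then have "\<forall>\<^sub>F N in sequentially. 2 * (1 / (real N + 1)) + exp (- real N) < e"
    using assms by (intro order_tendstoD(2)) auto
  then obtain N where N: "2 / (real N + 1) + exp (- real N) < e"
    using eventually_happens[of _ sequentially] by fastforce
  obtain l where l: "\<And>k. l k \<in> time_changes" "(\<lambda>k. time_change_gamma (l k)) \<longlonglongrightarrow> 0"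
    "\<And>i. fst (p N i) \<le> real N \<Longrightarrow> \<forall>\<^sub>F k in sequentially. l k (fst (p N i)) = fst (P k N i) \<and> l k (fst (p N (Suc i))) = fst (P k N (Suc i))"
    using time_changes_to_X[of N] by blast
  define h where "h k u = ennreal (exp (- u)) * (stopped_dist x (X k) (l k) u * indicator {0..} u)" for k u
  define w where "w u = ennreal (exp (- u)) * indicator {0..} u" for u :: real
  have xc: "cadlag x" using x_space by (simp add: skorokhod_space_def)
  have hm[measurable]: "h k \<in> borel_measurable lborel" for k
    unfolding h_def[abs_def] using borel_measurable_times_ennreal[OF _ stopped_dist_measurable[OF xc X_cadlag l(1)], of "\<lambda>u. ennreal (exp (- u))"] by simp
  have wm[measurable]: "w \<in> borel_measurable lborel" unfolding w_def[abs_def] by measurable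
  have hw: "h k u \<le> w u" for k u
    unfolding h_def w_def using stopped_dist_le_1[of x "X k" "l k" u]
    using mult_left_mono[of "stopped_dist x (X k) (l k) u" 1 "ennreal (exp (- u))"]
    by (auto simp: indicator_def)
  have wint: "(\<integral>\<^sup>+u. w u \<partial>lborel) = 1"
    unfolding w_def using exp_integral_atLeast[of 0] by simp
  have "limsup (\<lambda>k. \<integral>\<^sup>+u. h k u \<partial>lborel) \<le> (\<integral>\<^sup>+u. limsup (\<lambda>k. h k u) \<partial>lborel)"
    by (rule nn_integral_limsup[where w=w]) (auto simp: hw wint)
  also have "\<dots> \<le> (\<integral>\<^sup>+u. ennreal (2 / (real N + 1)) * w u + ennreal (exp (- u)) * indicator {real N..} u \<partial>lborel)"
  proof (rule nn_integral_mono_AE)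
    have "range (\<lambda>i. fst (p N i)) \<in> null_sets lborel" by (intro countable_imp_null_set_lborel) auto
    then show "AE u in lborel. limsup (\<lambda>k. h k u) \<le> ennreal (2 / (real N + 1)) * w u + ennreal (exp (- u)) * indicator {real N..} u"
    proof (rule AE_I')
      show "{u \<in> space lborel. \<not> limsup (\<lambda>k. h k u) \<le> ennreal (2 / (real N + 1)) * w u + ennreal (exp (- u)) * indicator {real N..} u}
        \<subseteq> range (\<lambda>i. fst (p N i))"
      proof (safe, rule ccontr)
        fix u assume bad: "\<not> limsup (\<lambda>k. h k u) \<le> ennreal (2 / (real N + 1)) * w u + ennreal (exp (- u)) * indicator {real N..} u"
          and u: "u \<notin> range (\<lambda>i. fst (p N i))"
        consider "u < 0" | "0 \<le> u" "u < real N" | "real N \<le> u" by linarith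
        then show False
        proof cases
          case 1
          then have "limsup (\<lambda>k. h k u) = 0" by (simp add: h_def Limsup_const)
          then show False using bad by simp
        next
          case 2
          have "limsup (\<lambda>k. h k u) = limsup (\<lambda>k. ennreal (exp (- u)) * stopped_dist x (X k) (l k) u)"
            using 2 by (simp add: h_def)
          also have "\<dots> \<le> ennreal (exp (- u)) * ennreal (2 / (real N + 1))"
            by (rule limsup_stopped_dist[OF l(1,3) 2 u]) auto
          finally show False using bad 2 by (simp add: w_def mult.commute)
        next
          case 3
          have "limsup (\<lambda>k. h k u) \<le> limsup (\<lambda>k. w u)" by (intro Limsup_mono) (simp add: hw)
          also have "\<dots> = ennreal (exp (- u)) * indicator {real N..} u" using 3 by (simp add: w_def Limsup_const)
          also have "\<dots> \<le> ennreal (2 / (real N + 1)) * w u + ennreal (exp (- u)) * indicator {real N..} u" by simp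
          finally show False using bad by simp
        qed
      qed
    qed
  qed
  also have "\<dots> = ennreal (2 / (real N + 1)) + ennreal (exp (- real N))"
    by (subst nn_integral_add) (auto simp: nn_integral_cmult wint exp_integral_atLeast)
  also have "\<dots> = ennreal (2 / (real N + 1) + exp (- real N))" by simp
  also have "\<dots> < ennreal e" using N assms by (intro ennreal_lessI) auto
  finally have "\<forall>\<^sub>F k in sequentially. (\<integral>\<^sup>+u. h k u \<partial>lborel) < ennreal e" by (rule Limsup_lessD)
  moreover have "\<forall>\<^sub>F k in sequentially. time_change_gamma (l k) < ennreal e"
    using order_tendstoD(2)[OF l(2)] assms by simp
  ultimately show ?thesis
  proof eventually_elim
    case (elim k)
    then have "change_cost x (X k) (l k) < ennreal e"
      by (simp add: change_cost_def h_def mult.assoc)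
    then show ?case using skorokhod_dist_less_iff[OF assms] l(1) by blast
  qed
qed

end

theorem compactin_skorokhod_compact:
  assumes \<delta>: "\<And>N. 0 < \<delta> N"
  shows "compactin skorokhod_topology (skorokhod_compact \<delta> C)"
proof -
  interpret M: Metric_space skorokhod_space "skorokhod_dist :: (real \<Rightarrow> real) \<Rightarrow> _" by (rule Metric_space_skorokhod)
  show ?thesis unfolding skorokhod_topology_def M.compactin_sequentially
  proof (intro conjI allI impI)
    show "skorokhod_compact \<delta> C \<subseteq> skorokhod_space" by (auto simp: skorokhod_compact_def)
    fix X :: "nat \<Rightarrow> real \<Rightarrow> real" assume "range X \<subseteq> skorokhod_compact \<delta> C"
    then have X: "X k \<in> skorokhod_compact \<delta> C" for k by auto
    then have "\<forall>k N. \<exists>p. p \<in> step_data (\<delta> N) (real N) C \<and>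
        fits p (1 / (real N + 1)) (real N) (\<lambda>(n, j::nat). X k (j / 2 ^ n))"
      by (auto simp: skorokhod_compact_def)
    then obtain P where P: "\<And>k N. P k N \<in> step_data (\<delta> N) (real N) C"
        "\<And>k N. fits (P k N) (1 / (real N + 1)) (real N) (\<lambda>(n, j::nat). X k (j / 2 ^ n))"
      by metis
    obtain r p where r: "strict_mono r" and p: "\<And>N i. (\<lambda>k. P (r k) N i) \<longlonglongrightarrow> p N i"
      by (rule step_data_subsequence[of P \<delta> real "\<lambda>_. C"]) (use P(1) \<delta> in auto)
    interpret step_approximations \<delta> C "\<lambda>k. X (r k)" "\<lambda>k. P (r k)" p
      by unfold_locales (use \<delta> P p X in \<open>auto simp: skorokhod_compact_def\<close>)
    have "limitin M.mtopology (X \<circ> r) x sequentially"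
      unfolding M.limitin_metric
      using x_space X eventually_dist_less by (auto simp: M.commute skorokhod_compact_def)
    then show "\<exists>l r. l \<in> skorokhod_compact \<delta> C \<and> strict_mono r \<and> limitin M.mtopology (X \<circ> r) l sequentially"
      using x_compact r by blast
  qed
qed

text \<open>The dyadic values form a measurable map into a countable product, and \<open>G N\<close>
  is the preimage of a closed set. Right continuity has already reduced membership in the compact
  set to these values.\<close>

lemma skorokhod_compact_measurable:
  fixes X :: "real \<Rightarrow> 'a \<Rightarrow> real"
  assumes X: "\<And>t. 0 \<le> t \<Longrightarrow> X t \<in> borel_measurable M"
    and cad: "\<And>\<omega>. \<omega> \<in> space M \<Longrightarrow> cadlag (\<lambda>t. X t \<omega>)" and \<delta>: "\<And>N. 0 < \<delta> N"
    and G_def: "\<And>N. G N = {\<omega> \<in> space M. \<exists>p\<in>step_data (\<delta> N) (real N) C.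
      fits p (1 / (real N + 1)) (real N) (\<lambda>(n, j::nat). X (j / 2 ^ n) \<omega>)}"
  shows "{\<omega> \<in> space M. (\<lambda>t\<in>{0..}. X t \<omega>) \<in> skorokhod_compact \<delta> C} = (\<Inter>N. G N)" "G N \<in> sets M"
proof -
  have "(\<lambda>t\<in>{0..}. X t \<omega>) \<in> skorokhod_space" if "\<omega> \<in> space M" for \<omega>
  proof -
    have "cadlag (\<lambda>t\<in>{0..}. X t \<omega>)"
      unfolding cadlag_def
    proof (intro conjI allI impI)
      fix t :: real assume t: "0 \<le> t"
      have "\<forall>\<^sub>F s in at_right t. X s \<omega> = (\<lambda>t\<in>{0..}. X t \<omega>) s"
        using eventually_at_right_less[of t] by eventually_elim (use t in auto)
      from tendsto_cong[THEN iffD1, OF this cadlagD_right[OF cad[OF that] t]]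
      show "((\<lambda>t\<in>{0..}. X t \<omega>) \<longlongrightarrow> (\<lambda>t\<in>{0..}. X t \<omega>) t) (at_right t)"
        using t unfolding restrict_def by simp
    next
      fix t :: real assume t: "0 < t"
      from cadlagD_left[OF cad[OF \<open>\<omega> \<in> space M\<close>] t]
      obtain l where l: "((\<lambda>t. X t \<omega>) \<longlongrightarrow> l) (at_left t)" by blast
      have "\<forall>\<^sub>F s in at_left t. X s \<omega> = (\<lambda>t\<in>{0..}. X t \<omega>) s"
        unfolding eventually_at_left_field by (intro exI[of _ 0]) (use t in auto)
      from tendsto_cong[THEN iffD1, OF this l] show "\<exists>l. ((\<lambda>t\<in>{0..}. X t \<omega>) \<longlongrightarrow> l) (at_left t)" by blast
    qed
    then show ?thesis by (simp add: skorokhod_space_def)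
  qed
  then show "{\<omega> \<in> space M. (\<lambda>t\<in>{0..}. X t \<omega>) \<in> skorokhod_compact \<delta> C} = (\<Inter>N. G N)"
    by (auto simp: skorokhod_compact_def G_def case_prod_beta)
  define v where "v \<omega> = (\<lambda>(n, j::nat). X (j / 2 ^ n) \<omega>)" for \<omega>
  have "v \<in> borel_measurable M"
    by (rule measurable_coordinatewise_then_product) (auto simp: v_def split: prod.split intro!: X)
  moreover have "closed {v. \<exists>p\<in>step_data (\<delta> N) (real N) C. \<forall>n\<in>UNIV. \<forall>j. fits_at p (1 / (real N + 1)) (real N) v n j}"
    by (rule closed_step_data_fits) (rule \<delta>)
  ultimately have "v -` {v. \<exists>p\<in>step_data (\<delta> N) (real N) C. \<forall>n\<in>UNIV. \<forall>j. fits_at p (1 / (real N + 1)) (real N) v n j} \<inter> space M \<in> sets M"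
    by (intro measurable_sets[of _ _ borel]) auto
  also have "v -` {v. \<exists>p\<in>step_data (\<delta> N) (real N) C. \<forall>n\<in>UNIV. \<forall>j. fits_at p (1 / (real N + 1)) (real N) v n j} \<inter> space M = G N"
    by (auto simp: G_def v_def fits_def)
  finally show "G N \<in> sets M" .
qed

subsection \<open>Oscillation of the Stieltjes integrals\<close>

lemma stieltjes_distribution:
  assumes A: "increasing_process M A" and \<omega>: "\<omega> \<in> space M"
  shows "x \<le> y \<Longrightarrow> A (max 0 x) \<omega> \<le> A (max 0 y) \<omega>"
    and "continuous (at_right a) (\<lambda>t. A (max 0 t) \<omega>)"
proof -
  have mono: "mono_on {0..} (\<lambda>t. A t \<omega>)" and rc: "\<And>t. 0 \<le> t \<Longrightarrow> continuous (at_right t) (\<lambda>t. A t \<omega>)"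
    using A \<omega> by (auto simp: increasing_process_def)
  show "x \<le> y \<Longrightarrow> A (max 0 x) \<omega> \<le> A (max 0 y) \<omega>"
    by (rule mono_onD[OF mono]) auto
  show "continuous (at_right a) (\<lambda>t. A (max 0 t) \<omega>)"
  proof (cases "0 \<le> a")
    case True
    have "\<forall>\<^sub>F s in at_right a. A s \<omega> = A (max 0 s) \<omega>"
      using eventually_at_right_less[of a] by eventually_elim (use True in \<open>simp add: max_def\<close>)
    from tendsto_cong[THEN iffD1, OF this] rc[OF True] True show ?thesis
      by (simp add: continuous_within max_def)
  next
    case False
    then have "\<forall>\<^sub>F s in at_right a. A 0 \<omega> = A (max 0 s) \<omega>"
      unfolding eventually_at_right_field by (intro exI[of _ 0]) auto
    from tendsto_cong[THEN iffD1, OF this tendsto_const] False show ?thesis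
      by (simp add: continuous_within max_def)
  qed
qed

lemma sets_stieltjes [simp, measurable_cong]: "sets (stieltjes A \<omega>) = sets borel"
  and space_stieltjes [simp]: "space (stieltjes A \<omega>) = UNIV"
  by (simp_all add: stieltjes_def)

lemma emeasure_stieltjes_Ioc:
  assumes "increasing_process M A" and "\<omega> \<in> space M" and "a \<le> b"
  shows "emeasure (stieltjes A \<omega>) {a<..b} = ennreal (A (max 0 b) \<omega> - A (max 0 a) \<omega>)"
  unfolding stieltjes_def
  using emeasure_interval_measure_Ioc[OF assms(3) stieltjes_distribution[OF assms(1,2)]] by blast

lemma increasing_processD:
  assumes "increasing_process M A" "\<omega> \<in> space M" "0 \<le> s" "s \<le> t" shows "A s \<omega> \<le> A t \<omega>"
  using stieltjes_distribution(1)[OF assms(1,2,4)] assms(3,4) by (simp add: max_def)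

text \<open>The integrating measure depends on \<open>\<omega>\<close>. Restricted to bounded times
  and divided by \<open>c\<close> it is a subprobability kernel, for which integrals of jointly
  measurable functions are measurable; multiplying by \<open>c\<close> recovers the
  integral.\<close>

lemma stieltjes_integral_measurable:
  fixes g :: "real \<Rightarrow> 'a \<Rightarrow> ennreal"
  assumes A: "increasing_process M A" and Am: "\<And>t. 0 \<le> t \<Longrightarrow> A t \<in> borel_measurable M" and T: "0 \<le> T"
    and g: "(\<lambda>(s, \<omega>). g s \<omega>) \<in> borel_measurable (restrict_space borel {0..T} \<Otimes>\<^sub>M M)"
  shows "(\<lambda>\<omega>. \<integral>\<^sup>+s\<in>{0..T}. g s \<omega> \<partial>stieltjes A \<omega>) \<in> borel_measurable M"
proof -
  define c where "c \<omega> = 1 + (A T \<omega> - A 0 \<omega>)" for \<omega>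
  have c: "1 \<le> c \<omega>" if "\<omega> \<in> space M" for \<omega>
    using increasing_processD[OF A that, of 0 T] T by (simp add: c_def)
  have cm[measurable]: "c \<in> borel_measurable M" unfolding c_def[abs_def] using Am T by measurable
  \<comment> \<open>Starting the half-open interval at \<open>-1\<close> includes the point 0 while
    matching the formula for \<open>{a<..b}\<close>; the Stieltjes measure has no mass on
    \<open>{- 1<..0}\<close>.\<close>
  define L where "L \<omega> = density (stieltjes A \<omega>) (\<lambda>s. ennreal (1 / c \<omega>) * indicator {- 1<..T} s)" for \<omega>
  have eL: "emeasure (L \<omega>) S = ennreal (1 / c \<omega>) * emeasure (stieltjes A \<omega>) ({- 1<..T} \<inter> S)"
    if "S \<in> sets borel" for S \<omega>
    using that by (simp add: L_def emeasure_density mult.assoc indicator_inter_arith[symmetric] nn_integral_cmult)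
  have "L \<in> measurable M (subprob_algebra borel)"
  proof (rule measurable_subprob_algebra_generated[where \<Omega>=UNIV and G="range atMost"])
    show "sets borel = sigma_sets UNIV (range (atMost :: real \<Rightarrow> _))"
      by (simp add: borel_eq_atMost)
    show "Int_stable (range (atMost :: real \<Rightarrow> _))"
      by (auto simp: Int_stable_def)
    show "subprob_space (L \<omega>)" if "\<omega> \<in> space M" for \<omega>
    proof
      have "emeasure (L \<omega>) UNIV = ennreal (1 / c \<omega>) * ennreal (A T \<omega> - A 0 \<omega>)"
        using emeasure_stieltjes_Ioc[OF A that, of "-1" T] T by (simp add: eL)
      also have "\<dots> = ennreal ((A T \<omega> - A 0 \<omega>) / c \<omega>)"
        using c[OF that] by (simp add: ennreal_mult'[symmetric])
      also have "\<dots> \<le> 1" using c[OF that] by (auto simp: c_def)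
      finally show "emeasure (L \<omega>) (space (L \<omega>)) \<le> 1" by (simp add: L_def)
      show "space (L \<omega>) \<noteq> {}" by (simp add: L_def)
    qed
    show "(\<lambda>\<omega>. emeasure (L \<omega>) S) \<in> borel_measurable M" if "S \<in> range atMost" for S
    proof -
      obtain x where S: "S = {..x}" using \<open>S \<in> range atMost\<close> by blast
      define y where "y = max (- 1) (min x T)"
      have y: "- 1 \<le> y" "{- 1<..T} \<inter> S = {- 1<..y}" using T by (auto simp: S y_def)
      have "emeasure (L \<omega>) S = ennreal (1 / c \<omega>) * ennreal (A (max 0 y) \<omega> - A 0 \<omega>)" if "\<omega> \<in> space M" for \<omega>
        using emeasure_stieltjes_Ioc[OF A that y(1)] S by (simp add: eL y(2)[unfolded S])
      moreover have "(\<lambda>\<omega>. ennreal (1 / c \<omega>) * ennreal (A (max 0 y) \<omega> - A 0 \<omega>)) \<in> borel_measurable M"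
        using Am[of "max 0 y"] Am[of 0] by measurable
      ultimately show ?thesis by (subst measurable_cong) auto
    qed
    show "(\<lambda>\<omega>. emeasure (L \<omega>) UNIV) \<in> borel_measurable M"
    proof -
      have "emeasure (L \<omega>) UNIV = ennreal (1 / c \<omega>) * ennreal (A T \<omega> - A 0 \<omega>)" if "\<omega> \<in> space M" for \<omega>
        using emeasure_stieltjes_Ioc[OF A that, of "-1" T] T by (simp add: eL)
      moreover have "(\<lambda>\<omega>. ennreal (1 / c \<omega>) * ennreal (A T \<omega> - A 0 \<omega>)) \<in> borel_measurable M"
        using Am[of T] Am[of 0] T by measurable
      ultimately show ?thesis by (subst measurable_cong) auto
    qed
  qed (auto simp: L_def)
  \<comment> \<open>\<open>g\<close> is only known to be measurable for times in
    \<open>[0, T]\<close>. Clamping the time extends it to the whole line without changing the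
    integral.\<close>
  moreover have gm: "(\<lambda>(\<omega>, s). g (max 0 (min T s)) \<omega> * indicator {0..T} s) \<in> borel_measurable (M \<Otimes>\<^sub>M borel)"
  proof -
    have "(\<lambda>z. (max 0 (min T (snd z)), fst z)) \<in> M \<Otimes>\<^sub>M borel \<rightarrow>\<^sub>M restrict_space borel {0..T} \<Otimes>\<^sub>M M"
      by (rule measurable_Pair[OF measurable_restrict_space2 measurable_fst]) (use T in auto)
    from measurable_compose[OF this g]
    show ?thesis by (simp add: case_prod_beta)
  qed
  ultimately have "(\<lambda>\<omega>. \<integral>\<^sup>+s. g (max 0 (min T s)) \<omega> * indicator {0..T} s \<partial>L \<omega>) \<in> borel_measurable M"
    by (intro nn_integral_measurable_subprob_algebra2) auto
  then have "(\<lambda>\<omega>. ennreal (c \<omega>) * (\<integral>\<^sup>+s. g (max 0 (min T s)) \<omega> * indicator {0..T} s \<partial>L \<omega>)) \<in> borel_measurable M"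
    by measurable
  moreover have "ennreal (c \<omega>) * (\<integral>\<^sup>+s. g (max 0 (min T s)) \<omega> * indicator {0..T} s \<partial>L \<omega>)
      = (\<integral>\<^sup>+s\<in>{0..T}. g s \<omega> \<partial>stieltjes A \<omega>)" if "\<omega> \<in> space M" for \<omega>
  proof -
    have [measurable]: "(\<lambda>s. g (max 0 (min T s)) \<omega> * indicator {0..T} s) \<in> borel_measurable borel"
      using measurable_compose[OF measurable_Pair1'[OF that, of borel] gm] by simp
    have "(\<integral>\<^sup>+s. g (max 0 (min T s)) \<omega> * indicator {0..T} s \<partial>L \<omega>)
      = (\<integral>\<^sup>+s. ennreal (1 / c \<omega>) * (g (max 0 (min T s)) \<omega> * indicator {0..T} s) \<partial>stieltjes A \<omega>)"
    proof -
      have "(\<integral>\<^sup>+s. g (max 0 (min T s)) \<omega> * indicator {0..T} s \<partial>L \<omega>)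
        = (\<integral>\<^sup>+s. ennreal (1 / c \<omega>) * indicator {- 1<..T} s * (g (max 0 (min T s)) \<omega> * indicator {0..T} s) \<partial>stieltjes A \<omega>)"
        unfolding L_def by (rule nn_integral_density) measurable
      then show ?thesis by (auto intro!: nn_integral_cong simp: indicator_def)
    qed
    also have "\<dots> = ennreal (1 / c \<omega>) * (\<integral>\<^sup>+s. g (max 0 (min T s)) \<omega> * indicator {0..T} s \<partial>stieltjes A \<omega>)"
      by (rule nn_integral_cmult) auto
    also have "(\<integral>\<^sup>+s. g (max 0 (min T s)) \<omega> * indicator {0..T} s \<partial>stieltjes A \<omega>)
      = (\<integral>\<^sup>+s\<in>{0..T}. g s \<omega> \<partial>stieltjes A \<omega>)"
      by (intro nn_integral_cong) (auto simp: indicator_def max_def min_def)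
    finally show ?thesis
      using c[OF that] by (simp add: mult.assoc[symmetric] ennreal_mult'[symmetric])
  qed
  ultimately show ?thesis by (subst (asm) measurable_cong) auto
qed

lemma progressive_compose_measurable:
  fixes Y :: "real \<Rightarrow> 'a \<Rightarrow> real" and \<phi> :: "real \<Rightarrow> ennreal"
  assumes "progressive F Y" "subalgebra M (F T)" "0 \<le> T" and [measurable]: "\<phi> \<in> borel_measurable borel"
  shows "(\<lambda>(s, \<omega>). \<phi> (Y s \<omega>)) \<in> borel_measurable (restrict_space borel {0..T} \<Otimes>\<^sub>M M)"
proof -
  have id: "(\<lambda>\<omega>. \<omega>) \<in> M \<rightarrow>\<^sub>M F T" using assms(2) by (auto simp: measurable_def subalgebra_def)
  have "(\<lambda>z. (fst z, snd z)) \<in> restrict_space borel {0..T} \<Otimes>\<^sub>M M \<rightarrow>\<^sub>M restrict_space borel {0..T} \<Otimes>\<^sub>M F T"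
    by (rule measurable_Pair[OF measurable_fst measurable_compose[OF measurable_snd id]])
  moreover have "(\<lambda>(s, \<omega>). Y s \<omega>) \<in> borel_measurable (restrict_space borel {0..T} \<Otimes>\<^sub>M F T)"
    using assms(1,3) unfolding progressive_def by blast
  ultimately have "(\<lambda>z. (\<lambda>(s, \<omega>). Y s \<omega>) (fst z, snd z)) \<in> borel_measurable (restrict_space borel {0..T} \<Otimes>\<^sub>M M)"
    by (rule measurable_compose)
  then have "(\<lambda>z. Y (fst z) (snd z)) \<in> borel_measurable (restrict_space borel {0..T} \<Otimes>\<^sub>M M)"
    by simp
  from measurable_compose[OF this assms(4)] show ?thesis by (simp add: case_prod_beta)
qed

lemma lp_norm_pow_finite:
  assumes "1 < r"
  shows "lp_norm_pow \<mu> (ereal r) T h = (\<integral>\<^sup>+t\<in>{0..T}. ennreal (\<bar>h t\<bar> powr r) \<partial>\<mu>)"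
proof -
  have "ennreal_powr (ennreal_powr I (1 / r)) r = I" for I
    using assms by (cases I) (auto simp: ennreal_powr_def powr_powr)
  then show ?thesis by (simp add: lp_norm_pow_def lp_norm_def)
qed

text \<open>If \<open>z > L\<close> then \<open>(z / L) powr (r - 1)\<close> is at least 1.
  Integrated against \<open>dA\<close>, the first term is paid by the increment of \<open>A\<close>,
  the second by the \<open>r\<close>-th moment of \<open>Z\<close> with a factor that vanishes as
  \<open>L\<close> grows, because \<open>r > 1\<close>.\<close>

lemma powr_split_bound:
  fixes r L z :: real
  assumes "1 < r" "0 < L" "0 \<le> z" shows "z \<le> L + L powr (1 - r) * z powr r"
proof (cases "z \<le> L")
  case True
  moreover have "0 \<le> L powr (1 - r) * z powr r" by simp
  ultimately show ?thesis by linarith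
next
  case False
  then have z: "0 < z" using assms by simp
  have "z = z powr (1 - r) * z powr r" using z by (simp add: powr_add[symmetric])
  also have "\<dots> \<le> L powr (1 - r) * z powr r"
    using False assms z by (intro mult_right_mono powr_mono2') auto
  finally show ?thesis using assms by linarith
qed

text \<open>Only a measurable set below \<open>f\<close> enters, so the bound applies to uncountable
  and essential suprema whose measurability in \<open>\<omega>\<close> is not known.\<close>

lemma markov_exceptional_set:
  fixes f :: "'a \<Rightarrow> ennreal"
  assumes "(\<integral>\<^sup>+\<omega>. f \<omega> \<partial>M) \<le> ennreal S" "B \<in> sets M" "\<And>\<omega>. \<omega> \<in> B \<Longrightarrow> ennreal R \<le> f \<omega>" "0 < R" "S \<le> \<eta> * R" "0 \<le> S"
  shows "emeasure M B \<le> ennreal \<eta>"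
proof -
  have "ennreal R * emeasure M B = (\<integral>\<^sup>+\<omega>. ennreal R * indicator B \<omega> \<partial>M)"
    using assms(2) by (simp add: nn_integral_cmult_indicator)
  also have "\<dots> \<le> (\<integral>\<^sup>+\<omega>. f \<omega> \<partial>M)"
    by (intro nn_integral_mono) (use assms(3) in \<open>auto simp: indicator_def\<close>)
  also have "\<dots> \<le> ennreal S" by (rule assms)
  also have "\<dots> \<le> ennreal (\<eta> * R)" using assms by (intro ennreal_leI) auto
  finally have "ennreal R * emeasure M B \<le> ennreal R * ennreal \<eta>"
    using assms(4,5,6) by (simp add: ennreal_mult' mult.commute[of \<eta>])
  then show ?thesis using assms(4) by (subst (asm) ennreal_mult_le_mult_iff) auto
qed

text \<open>A bound on the outer measure of the failure of \<open>P\<close>, since the windows below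
  involve uncountably many times and need not define events.\<close>

definition holds_outside :: "'a measure \<Rightarrow> real \<Rightarrow> ('a \<Rightarrow> bool) \<Rightarrow> bool" where
  "holds_outside M \<eta> P \<longleftrightarrow> (\<exists>B\<in>sets M. emeasure M B \<le> ennreal \<eta> \<and> (\<forall>\<omega>\<in>space M - B. P \<omega>))"

lemma holds_outsideI:
  "B \<in> sets M \<Longrightarrow> emeasure M B \<le> ennreal \<eta> \<Longrightarrow> (\<And>\<omega>. \<omega> \<in> space M - B \<Longrightarrow> P \<omega>) \<Longrightarrow> holds_outside M \<eta> P"
  by (auto simp: holds_outside_def)

lemma (in finite_measure) holds_outside_measureE:
  assumes "holds_outside M \<eta> P" "0 \<le> \<eta>"
  obtains B where "B \<in> sets M" "measure M B \<le> \<eta>" "\<And>\<omega>. \<omega> \<in> space M - B \<Longrightarrow> P \<omega>"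
  using assms by (auto simp: holds_outside_def emeasure_eq_measure)

lemma (in finite_measure) holds_outside_measureI:
  "B \<in> sets M \<Longrightarrow> measure M B \<le> \<eta> \<Longrightarrow> (\<And>\<omega>. \<omega> \<in> space M - B \<Longrightarrow> P \<omega>) \<Longrightarrow> holds_outside M \<eta> P"
  by (auto simp: holds_outside_def emeasure_eq_measure intro!: ennreal_leI)

lemma holds_outside_conj:
  assumes P: "holds_outside M a P" and Q: "holds_outside M b Q" and "0 \<le> a" "0 \<le> b"
    and R: "\<And>\<omega>. \<omega> \<in> space M \<Longrightarrow> P \<omega> \<Longrightarrow> Q \<omega> \<Longrightarrow> R \<omega>"
  shows "holds_outside M (a + b) R"
proof -
  obtain B where B: "B \<in> sets M" "emeasure M B \<le> ennreal a" "\<And>\<omega>. \<omega> \<in> space M - B \<Longrightarrow> P \<omega>"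
    using P unfolding holds_outside_def by blast
  obtain B' where B': "B' \<in> sets M" "emeasure M B' \<le> ennreal b" "\<And>\<omega>. \<omega> \<in> space M - B' \<Longrightarrow> Q \<omega>"
    using Q unfolding holds_outside_def by blast
  have "emeasure M (B \<union> B') \<le> emeasure M B + emeasure M B'" by (rule emeasure_subadditive[OF B(1) B'(1)])
  also have "\<dots> \<le> ennreal (a + b)" using B(2) B'(2) assms(3,4) by (simp add: ennreal_plus add_mono)
  finally show ?thesis using B(1,3) B'(1,3) R by (intro holds_outsideI[of "B \<union> B'"]) auto
qed

lemma AE_holds_outside: "AE \<omega> in M. P \<omega> \<Longrightarrow> holds_outside M 0 P"
  by (elim AE_E) (auto simp: holds_outside_def)

definition windows_le :: "real \<Rightarrow> real \<Rightarrow> real \<Rightarrow> (real \<Rightarrow> real) \<Rightarrow> bool" where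
  "windows_le T d c v \<longleftrightarrow> (\<forall>s t. 0 \<le> s \<longrightarrow> s \<le> t \<longrightarrow> t \<le> s + d \<longrightarrow> t \<le> T \<longrightarrow> \<bar>v t - v s\<bar> \<le> c)"

lemma windows_leD: "windows_le T d c v \<Longrightarrow> 0 \<le> s \<Longrightarrow> s \<le> t \<Longrightarrow> t \<le> s + d \<Longrightarrow> t \<le> T \<Longrightarrow> \<bar>v t - v s\<bar> \<le> c"
  by (simp add: windows_le_def)

lemma windows_le_antimono: "windows_le T d c v \<Longrightarrow> d' \<le> d \<Longrightarrow> windows_le T d' c v"
  by (auto simp: windows_le_def)

text \<open>The \<open>p\<close>-norms are bounded in probability, which is all that is needed for \<open>p = \<infinity>\<close> too:
  in that case the mean of \<open>\<integral>\<bar>Z\<bar> dA\<close> over a short window need not be small.\<close>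

lemma stieltjes_integral_split:
  fixes M :: "'i \<Rightarrow> 'a measure"
  assumes sub: "\<And>i. subalgebra (M i) (F i T)" and A: "\<And>i. increasing_process (M i) (A i)"
    and Am: "\<And>i t. 0 \<le> t \<Longrightarrow> A i t \<in> borel_measurable (M i)"
    and Z: "\<And>i. progressive (F i) (Z i)" and T: "0 < T" and p: "1 < p"
    and bound: "(SUP i. \<integral>\<^sup>+\<omega>. lp_norm_pow (stieltjes (A i) \<omega>) p T (\<lambda>t. Z i t \<omega>) \<partial>M i) < \<infinity>"
    and \<theta>: "0 < \<theta>" and \<eta>: "0 < \<eta>"
  obtains L where "0 < L" "\<And>i. holds_outside (M i) \<eta> (\<lambda>\<omega>. \<forall>s t. 0 \<le> s \<longrightarrow> s \<le> t \<longrightarrow> t \<le> T \<longrightarrow>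
        (\<integral>\<^sup>+u\<in>{s<..t}. ennreal \<bar>Z i u \<omega>\<bar> \<partial>stieltjes (A i) \<omega>) \<le> ennreal (L * (A i t \<omega> - A i s \<omega>) + \<theta>))"
proof -
  obtain S where S: "0 \<le> S" "(SUP i. \<integral>\<^sup>+\<omega>. lp_norm_pow (stieltjes (A i) \<omega>) p T (\<lambda>t. Z i t \<omega>) \<partial>M i) = ennreal S"
    using bound by (cases "SUP i. \<integral>\<^sup>+\<omega>. lp_norm_pow (stieltjes (A i) \<omega>) p T (\<lambda>t. Z i t \<omega>) \<partial>M i") auto
  have Si: "(\<integral>\<^sup>+\<omega>. lp_norm_pow (stieltjes (A i) \<omega>) p T (\<lambda>t. Z i t \<omega>) \<partial>M i) \<le> ennreal S" for i
    unfolding S(2)[symmetric] by (rule SUP_upper) auto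
  \<comment> \<open>The Markov threshold; the \<open>+ 1\<close> keeps it positive when
    \<open>S = 0\<close>.\<close>
  define R where "R = (S + 1) / \<eta>"
  have R: "0 < R" "S \<le> \<eta> * R" using S \<eta> by (auto simp: R_def)
  have meas: "(\<lambda>\<omega>. \<integral>\<^sup>+t\<in>{0..T}. \<phi> (Z i t \<omega>) \<partial>stieltjes (A i) \<omega>) \<in> borel_measurable (M i)"
    if "\<phi> \<in> borel_measurable borel" for i and \<phi> :: "real \<Rightarrow> ennreal"
    by (rule stieltjes_integral_measurable[OF A Am]) (use T progressive_compose_measurable[OF Z sub _ that] in auto)
  \<comment> \<open>Progressive measurability only speaks of times up to \<open>T\<close>; the
    indicator extends the path of \<open>Z\<close> measurably to the line.\<close>
  have Zm: "(\<lambda>u. ennreal \<bar>Z i u \<omega>\<bar> * indicator S u) \<in> borel_measurable (stieltjes (A i) \<omega>)"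
    if "S \<subseteq> {0..T}" "S \<in> sets borel" "\<omega> \<in> space (M i)" for i \<omega> S
  proof -
    have g: "(\<lambda>(s, \<omega>). ennreal \<bar>Z i s \<omega>\<bar>) \<in> borel_measurable (restrict_space borel {0..T} \<Otimes>\<^sub>M M i)"
      by (rule progressive_compose_measurable[OF Z sub, where \<phi>="\<lambda>z. ennreal \<bar>z\<bar>"]) (use T in auto)
    have "(\<lambda>u. ennreal \<bar>Z i u \<omega>\<bar>) \<in> borel_measurable (restrict_space borel {0..T})"
      using measurable_compose[OF measurable_Pair2'[OF that(3), of "restrict_space borel {0..T}"] g] by simp
    then have m: "(\<lambda>u. ennreal \<bar>Z i u \<omega>\<bar> * indicator {0..T} u) \<in> borel_measurable borel"
      by (subst (asm) borel_measurable_restrict_space_iff_ennreal) auto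
    have "(\<lambda>u. ennreal \<bar>Z i u \<omega>\<bar> * indicator {0..T} u * indicator S u) \<in> borel_measurable borel"
      using that(2) by (intro borel_measurable_times_ennreal m) auto
    also have "(\<lambda>u. ennreal \<bar>Z i u \<omega>\<bar> * indicator {0..T} u * indicator S u) = (\<lambda>u. ennreal \<bar>Z i u \<omega>\<bar> * indicator S u)"
      using that(1) by (auto simp: indicator_def fun_eq_iff)
    finally show ?thesis by simp
  qed
  have Aint: "(\<integral>\<^sup>+u\<in>{s<..t}. ennreal L \<partial>stieltjes (A i) \<omega>) = ennreal (L * (A i t \<omega> - A i s \<omega>))"
    if "0 \<le> s" "s \<le> t" "\<omega> \<in> space (M i)" "0 \<le> L" for i s t \<omega> L
    using emeasure_stieltjes_Ioc[OF A that(3,2)] that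
    by (simp add: nn_integral_cmult_indicator ennreal_mult' max_def)
  show thesis
  proof (cases p)
    case PInf
    \<comment> \<open>The event that \<open>\<bar>Z\<bar> > R\<close> on a set of positive
      \<open>dA\<close> measure, written as an integral because that is known to be measurable in
      \<open>\<omega>\<close>.\<close>
    define B where "B i = {\<omega> \<in> space (M i). (\<integral>\<^sup>+t\<in>{0..T}. indicator {z. R < \<bar>z\<bar>} (Z i t \<omega>) \<partial>stieltjes (A i) \<omega>) \<noteq> 0}" for i
    have Bm: "B i \<in> sets (M i)" for i
    proof -
      have "(\<lambda>\<omega>. \<integral>\<^sup>+t\<in>{0..T}. indicator {z. R < \<bar>z\<bar>} (Z i t \<omega>) \<partial>stieltjes (A i) \<omega>) \<in> borel_measurable (M i)"
        by (rule meas) measurable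
      then show ?thesis unfolding B_def by measurable
    qed
    have "emeasure (M i) (B i) \<le> ennreal \<eta>" for i
    proof (rule markov_exceptional_set[OF Si[of i] Bm _ R S(1)], rule ccontr)
      fix \<omega> assume "\<omega> \<in> B i" and small: "\<not> ennreal R \<le> lp_norm_pow (stieltjes (A i) \<omega>) p T (\<lambda>t. Z i t \<omega>)"
      have "AE t in restrict_space (stieltjes (A i) \<omega>) {0..T}. ennreal \<bar>Z i t \<omega>\<bar> \<le> lp_norm_pow (stieltjes (A i) \<omega>) p T (\<lambda>t. Z i t \<omega>)"
        using esssup_AE[of "\<lambda>t. ennreal \<bar>Z i t \<omega>\<bar>"] PInf by (simp add: lp_norm_pow_def lp_norm_def)
      then have "AE t in restrict_space (stieltjes (A i) \<omega>) {0..T}. \<bar>Z i t \<omega>\<bar> \<le> R"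
      proof eventually_elim
        case (elim t)
        then have "ennreal \<bar>Z i t \<omega>\<bar> \<le> ennreal R" using small by simp
        then show ?case using R(1) by (simp add: ennreal_le_iff)
      qed
      then have "AE t in stieltjes (A i) \<omega>. t \<in> {0..T} \<longrightarrow> \<bar>Z i t \<omega>\<bar> \<le> R"
        by (subst (asm) AE_restrict_space_iff) auto
      then have "(\<integral>\<^sup>+t\<in>{0..T}. indicator {z. R < \<bar>z\<bar>} (Z i t \<omega>) \<partial>stieltjes (A i) \<omega>) = (\<integral>\<^sup>+t. 0 \<partial>stieltjes (A i) \<omega>)"
        by (intro nn_integral_cong_AE) (auto simp: indicator_def elim!: eventually_mono)
      then show False using \<open>\<omega> \<in> B i\<close> by (simp add: B_def)
    qed
    moreover have "(\<integral>\<^sup>+u\<in>{s<..t}. ennreal \<bar>Z i u \<omega>\<bar> \<partial>stieltjes (A i) \<omega>) \<le> ennreal (R * (A i t \<omega> - A i s \<omega>) + \<theta>)"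
      if "\<omega> \<in> space (M i) - B i" "0 \<le> s" "s \<le> t" "t \<le> T" for i \<omega> s t
    proof -
      have w: "\<omega> \<in> space (M i)" using that by simp
      have "(\<lambda>t. indicator {z. R < \<bar>z\<bar>} (Z i t \<omega>) * indicator {0..T} t :: ennreal) =
          (\<lambda>t. indicator {z. ennreal R < z} (ennreal \<bar>Z i t \<omega>\<bar> * indicator {0..T} t))"
        using R by (auto simp: fun_eq_iff indicator_def ennreal_less_iff)
      moreover have "(\<lambda>t. indicator {z. ennreal R < z} (ennreal \<bar>Z i t \<omega>\<bar> * indicator {0..T} t) :: ennreal) \<in> borel_measurable (stieltjes (A i) \<omega>)"
        by (rule measurable_compose[OF Zm[OF order_refl _ w]]) auto
      ultimately have "AE u in stieltjes (A i) \<omega>. indicator {z. R < \<bar>z\<bar>} (Z i u \<omega>) * indicator {0..T} u = (0::ennreal)"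
        using that(1) by (subst nn_integral_0_iff_AE[symmetric]) (auto simp: B_def)
      then have "(\<integral>\<^sup>+u\<in>{s<..t}. ennreal \<bar>Z i u \<omega>\<bar> \<partial>stieltjes (A i) \<omega>) \<le> (\<integral>\<^sup>+u\<in>{s<..t}. ennreal R \<partial>stieltjes (A i) \<omega>)"
      proof (intro nn_integral_mono_AE, eventually_elim)
        case (elim u)
        show ?case
        proof (cases "u \<in> {s<..t}")
          case True
          then have "\<not> R < \<bar>Z i u \<omega>\<bar>" using elim that by (auto simp: indicator_def)
          then show ?thesis using True by (simp add: ennreal_leI)
        qed simp
      qed
      also have "\<dots> = ennreal (R * (A i t \<omega> - A i s \<omega>))" using that R by (intro Aint) auto
      also have "\<dots> \<le> ennreal (R * (A i t \<omega> - A i s \<omega>) + \<theta>)" using \<theta> by (intro ennreal_leI) auto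
      finally show ?thesis .
    qed
    ultimately show thesis
      by - (rule that[OF R(1)], rule holds_outsideI[OF Bm], blast+)
  next
    case (real r)
    then have r: "1 < r" using p by (simp add: one_ereal_def)
    \<comment> \<open>Solves \<open>L powr (1 - r) * R = \<theta>\<close>, so the second term of
      \<open>powr_split_bound\<close> integrates to at most \<open>\<theta>\<close> whenever the
      \<open>r\<close>-th moment stays below \<open>R\<close>.\<close>
    define L where "L = (\<theta> / R) powr (1 / (1 - r))"
    have L: "0 < L" using \<theta> R by (simp add: L_def)
    have LR: "L powr (1 - r) * R = \<theta>" using r R \<theta> by (simp add: L_def powr_powr)
    define B where "B i = {\<omega> \<in> space (M i). ennreal R \<le> (\<integral>\<^sup>+t\<in>{0..T}. ennreal (\<bar>Z i t \<omega>\<bar> powr r) \<partial>stieltjes (A i) \<omega>)}" for i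
    have Bm: "B i \<in> sets (M i)" for i
    proof -
      have "(\<lambda>\<omega>. \<integral>\<^sup>+t\<in>{0..T}. ennreal (\<bar>Z i t \<omega>\<bar> powr r) \<partial>stieltjes (A i) \<omega>) \<in> borel_measurable (M i)"
        by (rule meas) measurable
      then show ?thesis unfolding B_def by measurable
    qed
    have "emeasure (M i) (B i) \<le> ennreal \<eta>" for i
      by (rule markov_exceptional_set[OF Si[of i] Bm _ R S(1)]) (simp add: real lp_norm_pow_finite[OF r] B_def)
    moreover have "(\<integral>\<^sup>+u\<in>{s<..t}. ennreal \<bar>Z i u \<omega>\<bar> \<partial>stieltjes (A i) \<omega>) \<le> ennreal (L * (A i t \<omega> - A i s \<omega>) + \<theta>)"
      if "\<omega> \<in> space (M i) - B i" "0 \<le> s" "s \<le> t" "t \<le> T" for i \<omega> s t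
    proof -
      have w: "\<omega> \<in> space (M i)" using that by simp
      define h where "h u = ennreal (\<bar>Z i u \<omega>\<bar> powr r) * indicator {0..T} u" for u
      have "(\<lambda>u. ennreal (enn2real (ennreal \<bar>Z i u \<omega>\<bar> * indicator {0..T} u) powr r)) \<in> borel_measurable (stieltjes (A i) \<omega>)"
        by (rule measurable_compose[OF Zm[OF order_refl _ w]]) auto
      also have "(\<lambda>u. ennreal (enn2real (ennreal \<bar>Z i u \<omega>\<bar> * indicator {0..T} u) powr r)) = h"
        using r by (auto simp: h_def fun_eq_iff indicator_def)
      finally have hm[measurable]: "h \<in> borel_measurable (stieltjes (A i) \<omega>)" .
      have "(\<integral>\<^sup>+u\<in>{s<..t}. ennreal \<bar>Z i u \<omega>\<bar> \<partial>stieltjes (A i) \<omega>)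
        \<le> (\<integral>\<^sup>+u. ennreal L * indicator {s<..t} u + ennreal (L powr (1 - r)) * h u \<partial>stieltjes (A i) \<omega>)"
      proof (rule nn_integral_mono)
        fix u
        show "ennreal \<bar>Z i u \<omega>\<bar> * indicator {s<..t} u \<le> ennreal L * indicator {s<..t} u + ennreal (L powr (1 - r)) * h u"
          using powr_split_bound[OF r L, of "\<bar>Z i u \<omega>\<bar>"] that L
          by (auto simp: h_def indicator_def ennreal_mult'[symmetric] ennreal_plus[symmetric] intro!: ennreal_leI simp del: ennreal_plus)
      qed
      also have "\<dots> = ennreal (L * (A i t \<omega> - A i s \<omega>)) + ennreal (L powr (1 - r)) * (\<integral>\<^sup>+u. h u \<partial>stieltjes (A i) \<omega>)"
        using Aint[OF that(2,3) w, of L] L by (simp add: nn_integral_add nn_integral_cmult)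
      also have "\<dots> \<le> ennreal (L * (A i t \<omega> - A i s \<omega>)) + ennreal (L powr (1 - r)) * ennreal R"
      proof -
        have "(\<integral>\<^sup>+u. h u \<partial>stieltjes (A i) \<omega>) \<le> ennreal R" using that(1) by (auto simp: B_def h_def)
        then show ?thesis by (intro add_left_mono mult_left_mono) auto
      qed
      also have "\<dots> = ennreal (L * (A i t \<omega> - A i s \<omega>) + \<theta>)"
        using LR R L \<theta> increasing_processD[OF A w that(2,3)]
        by (simp add: ennreal_mult'[symmetric] ennreal_plus)
      finally show ?thesis .
    qed
    ultimately show thesis
      by - (rule that[OF L], rule holds_outsideI[OF Bm], blast+)
  next
    case MInf then show thesis using p by simp
  qed
qed

text \<open>A window of length \<open>d\<close> lies in a block of length \<open>2 * d\<close>
  starting at a multiple of \<open>d\<close>. By monotonicity finitely many block increments control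
  all windows; each is dominated by the supremum in the hypothesis at lag \<open>2 * d\<close>, so
  Markov's inequality bounds their union in one stroke.\<close>

lemma increasing_process_windows:
  fixes M :: "'i \<Rightarrow> 'a measure"
  assumes A: "\<And>i. increasing_process (M i) (A i)" and Am: "\<And>i t. 0 \<le> t \<Longrightarrow> A i t \<in> borel_measurable (M i)"
    and T: "0 < T"
    and lim: "((\<lambda>\<delta>. SUP i. \<integral>\<^sup>+\<omega>. (SUP r\<in>{0..T}. ennreal \<bar>A i (r + \<delta>) \<omega> - A i r \<omega>\<bar>) \<partial>M i) \<longlongrightarrow> 0) (at_right 0)"
    and \<kappa>: "0 < \<kappa>" and \<eta>: "0 < \<eta>"
  obtains d where "0 < d" "\<And>i. holds_outside (M i) \<eta> (\<lambda>\<omega>. windows_le T d \<kappa> (\<lambda>t. A i t \<omega>))"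
proof -
  have "0 < ennreal (\<eta> * \<kappa>)" using \<kappa> \<eta> by simp
  from order_tendstoD(2)[OF lim this] obtain b where b: "0 < b"
    "\<And>\<delta>. 0 < \<delta> \<Longrightarrow> \<delta> < b \<Longrightarrow> (SUP i. \<integral>\<^sup>+\<omega>. (SUP r\<in>{0..T}. ennreal \<bar>A i (r + \<delta>) \<omega> - A i r \<omega>\<bar>) \<partial>M i) < ennreal (\<eta> * \<kappa>)"
    unfolding eventually_at_right_field by blast
  define d where "d = b / 4"
  have d: "0 < d" "0 < 2 * d" "2 * d < b" using b(1) by (auto simp: d_def)
  define K where "K = {k::nat. real k * d \<le> T}"
  have "finite K"
  proof (rule finite_subset)
    show "K \<subseteq> {..nat \<lceil>T / d\<rceil>}"
    proof
      fix k assume "k \<in> K"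
      then have "real k \<le> T / d" using d by (simp add: K_def field_simps)
      then have "real k \<le> of_int \<lceil>T / d\<rceil>" using le_of_int_ceiling order_trans by blast
      then show "k \<in> {..nat \<lceil>T / d\<rceil>}" by simp
    qed
  qed simp
  define B where "B i = {\<omega> \<in> space (M i). \<exists>k\<in>K. \<kappa> \<le> A i (real k * d + 2 * d) \<omega> - A i (real k * d) \<omega>}" for i
  have Bm: "B i \<in> sets (M i)" for i
  proof -
    have [measurable]: "A i (real k * d + 2 * d) \<in> borel_measurable (M i)" "A i (real k * d) \<in> borel_measurable (M i)" for k
      using d by (auto intro!: Am)
    show ?thesis unfolding B_def using \<open>finite K\<close> by measurable
  qed
  have "emeasure (M i) (B i) \<le> ennreal \<eta>" for i
  proof (rule markov_exceptional_set[OF _ Bm _ \<kappa> order_refl])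
    show "(\<integral>\<^sup>+\<omega>. (SUP r\<in>{0..T}. ennreal \<bar>A i (r + 2 * d) \<omega> - A i r \<omega>\<bar>) \<partial>M i) \<le> ennreal (\<eta> * \<kappa>)"
      using b(2)[OF d(2,3)] by (meson SUP_upper UNIV_I less_imp_le order_trans)
    fix \<omega> assume "\<omega> \<in> B i"
    then obtain k where k: "k \<in> K" "\<kappa> \<le> A i (real k * d + 2 * d) \<omega> - A i (real k * d) \<omega>" by (auto simp: B_def)
    have "ennreal \<kappa> \<le> ennreal \<bar>A i (real k * d + 2 * d) \<omega> - A i (real k * d) \<omega>\<bar>" using k by (intro ennreal_leI) auto
    also have "\<dots> \<le> (SUP r\<in>{0..T}. ennreal \<bar>A i (r + 2 * d) \<omega> - A i r \<omega>\<bar>)"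
      using k(1) d by (intro SUP_upper) (auto simp: K_def)
    finally show "ennreal \<kappa> \<le> (SUP r\<in>{0..T}. ennreal \<bar>A i (r + 2 * d) \<omega> - A i r \<omega>\<bar>)" .
  qed (use \<kappa> \<eta> in auto)
  moreover have "\<bar>A i t \<omega> - A i s \<omega>\<bar> \<le> \<kappa>" if "\<omega> \<in> space (M i) - B i" "0 \<le> s" "s \<le> t" "t \<le> s + d" "t \<le> T" for i \<omega> s t
  proof -
    define k where "k = nat \<lfloor>s / d\<rfloor>"
    have "real k = of_int \<lfloor>s / d\<rfloor>" using that d by (simp add: k_def)
    then have "real k \<le> s / d" "s / d < real k + 1" by linarith+
    then have k: "real k * d \<le> s" "s \<le> real k * d + d" using d by (auto simp: field_simps)
    then have "k \<in> K" using that by (simp add: K_def)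
    then have "A i (real k * d + 2 * d) \<omega> - A i (real k * d) \<omega> < \<kappa>" using that(1) by (auto simp: B_def not_le)
    moreover have "A i (real k * d) \<omega> \<le> A i s \<omega>" "A i t \<omega> \<le> A i (real k * d + 2 * d) \<omega>"
      using k that d by (auto intro!: increasing_processD[OF A])
    moreover have "A i s \<omega> \<le> A i t \<omega>" using that by (auto intro: increasing_processD[OF A])
    ultimately show ?thesis by linarith
  qed
  ultimately show thesis
    by - (rule that[OF d(1)], unfold windows_le_def, rule holds_outsideI[OF Bm], blast+)
qed

text \<open>\<open>L\<close> is fixed first, from the bound on \<open>Z\<close>; the window length
  then comes from \<open>A\<close> with tolerance \<open>\<theta> / (2 * L)\<close>. The two halves
  of \<open>\<theta>\<close> and of \<open>\<eta>\<close> belong to \<open>Z\<close> and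
  \<open>A\<close>, and integrability of the paths costs a null set.\<close>

theorem integral_windows:
  fixes M :: "'i \<Rightarrow> 'a measure"
  assumes filt: "\<And>i. filtered (M i) (F i)" and A: "\<And>i. increasing_process (M i) (A i)"
    and Aad: "\<And>i. adapted (F i) (A i)" and T: "0 < T"
    and lim: "((\<lambda>\<delta>. SUP i. \<integral>\<^sup>+\<omega>. (SUP r\<in>{0..T}. ennreal \<bar>A i (r + \<delta>) \<omega> - A i r \<omega>\<bar>) \<partial>M i) \<longlongrightarrow> 0) (at_right 0)"
    and YZ: "\<And>i. (Y i, Z i) \<in> semimartingale_pairs (M i) (F i) (A i)" and p: "1 < p"
    and bound: "(SUP i. \<integral>\<^sup>+\<omega>. lp_norm_pow (stieltjes (A i) \<omega>) p T (\<lambda>t. Z i t \<omega>) \<partial>M i) < \<infinity>"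
    and \<theta>: "0 < \<theta>" and \<eta>: "0 < \<eta>"
  obtains d where "0 < d"
    "\<And>i. holds_outside (M i) \<eta> (\<lambda>\<omega>. windows_le T d \<theta> (\<lambda>t. LINT u:{0..t}|stieltjes (A i) \<omega>. Z i u \<omega>))"
proof -
  have Am: "A i t \<in> borel_measurable (M i)" if "0 \<le> t" for i t
    by (rule measurable_from_subalg[of "M i" "F i t"])
       (use filt[of i] Aad[of i] that in \<open>auto simp: filtered_def adapted_def\<close>)
  have sub: "subalgebra (M i) (F i T)" for i using filt[of i] T by (auto simp: filtered_def)
  have Z: "progressive (F i) (Z i)" for i using YZ[of i] by (auto simp: semimartingale_pairs_def process_space_def)
  have \<theta>2: "0 < \<theta> / 2" and \<eta>2: "0 < \<eta> / 2" using \<theta> \<eta> by auto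
  obtain L where L: "0 < L" "\<And>i. holds_outside (M i) (\<eta> / 2) (\<lambda>\<omega>. \<forall>s t. 0 \<le> s \<longrightarrow> s \<le> t \<longrightarrow> t \<le> T \<longrightarrow>
        (\<integral>\<^sup>+u\<in>{s<..t}. ennreal \<bar>Z i u \<omega>\<bar> \<partial>stieltjes (A i) \<omega>) \<le> ennreal (L * (A i t \<omega> - A i s \<omega>) + \<theta> / 2))"
    using stieltjes_integral_split[OF sub A Am Z T p bound \<theta>2 \<eta>2] by blast
  have "0 < \<theta> / (2 * L)" using \<theta> L(1) by simp
  from increasing_process_windows[OF A Am T lim this \<eta>2] obtain d
    where d: "0 < d" "\<And>i. holds_outside (M i) (\<eta> / 2) (\<lambda>\<omega>. windows_le T d (\<theta> / (2 * L)) (\<lambda>t. A i t \<omega>))" by blast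
  show thesis
  proof (rule that[OF d(1)])
    fix i
    have int: "AE \<omega> in M i. \<forall>t\<ge>0. set_integrable (stieltjes (A i) \<omega>) {0..t} (\<lambda>s. Z i s \<omega>)"
      using YZ[of i] by (auto simp: semimartingale_pairs_def)
    have "holds_outside (M i) (\<eta> / 2 + 0 + \<eta> / 2) (\<lambda>\<omega>. windows_le T d \<theta> (\<lambda>t. LINT u:{0..t}|stieltjes (A i) \<omega>. Z i u \<omega>))"
    proof (rule holds_outside_conj[OF holds_outside_conj[OF L(2) AE_holds_outside[OF int] _ _ conjI] d(2)])
      fix \<omega>
      assume B: "(\<forall>s t. 0 \<le> s \<longrightarrow> s \<le> t \<longrightarrow> t \<le> T \<longrightarrow>
          (\<integral>\<^sup>+u\<in>{s<..t}. ennreal \<bar>Z i u \<omega>\<bar> \<partial>stieltjes (A i) \<omega>) \<le> ennreal (L * (A i t \<omega> - A i s \<omega>) + \<theta> / 2)) \<and>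
          (\<forall>t\<ge>0. set_integrable (stieltjes (A i) \<omega>) {0..t} (\<lambda>s. Z i s \<omega>))"
        and W: "windows_le T d (\<theta> / (2 * L)) (\<lambda>t. A i t \<omega>)"
      show "windows_le T d \<theta> (\<lambda>t. LINT u:{0..t}|stieltjes (A i) \<omega>. Z i u \<omega>)"
        unfolding windows_le_def
      proof (intro allI impI)
        fix s t assume st: "0 \<le> s" "s \<le> t" "t \<le> s + d" "t \<le> T"
        have int: "set_integrable (stieltjes (A i) \<omega>) {0..t} (\<lambda>s. Z i s \<omega>)" using B st by auto
        have i1: "set_integrable (stieltjes (A i) \<omega>) {0..s} (\<lambda>s. Z i s \<omega>)"
          and i2: "set_integrable (stieltjes (A i) \<omega>) {s<..t} (\<lambda>s. Z i s \<omega>)"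
          using st by (auto intro!: set_integrable_subset[OF int])
        have "{0..t} = {0..s} \<union> {s<..t}" using st by auto
        then have "(LINT u:{0..t}|stieltjes (A i) \<omega>. Z i u \<omega>) =
            (LINT u:{0..s}|stieltjes (A i) \<omega>. Z i u \<omega>) + (LINT u:{s<..t}|stieltjes (A i) \<omega>. Z i u \<omega>)"
          using set_integral_Un[OF _ i1 i2] by (simp add: ivl_disj_int_two)
        then have "ennreal \<bar>(LINT u:{0..t}|stieltjes (A i) \<omega>. Z i u \<omega>) - (LINT u:{0..s}|stieltjes (A i) \<omega>. Z i u \<omega>)\<bar>
            = ennreal (norm (LINT u:{s<..t}|stieltjes (A i) \<omega>. Z i u \<omega>))" by simp
        also have "\<dots> \<le> (\<integral>\<^sup>+u. ennreal (norm (indicator {s<..t} u *\<^sub>R Z i u \<omega>)) \<partial>stieltjes (A i) \<omega>)"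
          unfolding set_lebesgue_integral_def
          by (rule integral_norm_bound_ennreal) (use i2 in \<open>simp add: set_integrable_def\<close>)
        also have "\<dots> = (\<integral>\<^sup>+u\<in>{s<..t}. ennreal \<bar>Z i u \<omega>\<bar> \<partial>stieltjes (A i) \<omega>)"
          by (intro nn_integral_cong) (auto simp: indicator_def)
        also have "\<dots> \<le> ennreal (L * (A i t \<omega> - A i s \<omega>) + \<theta> / 2)" using B st by blast
        also have "\<dots> \<le> ennreal \<theta>"
        proof (rule ennreal_leI)
          have "A i t \<omega> - A i s \<omega> \<le> \<theta> / (2 * L)" using windows_leD[OF W st] by simp
          then show "L * (A i t \<omega> - A i s \<omega>) + \<theta> / 2 \<le> \<theta>" using L(1) by (simp add: field_simps)
        qed
        finally show "\<bar>(LINT u:{0..t}|stieltjes (A i) \<omega>. Z i u \<omega>) - (LINT u:{0..s}|stieltjes (A i) \<omega>. Z i u \<omega>)\<bar> \<le> \<theta>"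
          using \<theta> by (simp add: ennreal_le_iff)
      qed
    qed (use \<eta> in auto)
    then show "holds_outside (M i) \<eta> (\<lambda>\<omega>. windows_le T d \<theta> (\<lambda>t. LINT u:{0..t}|stieltjes (A i) \<omega>. Z i u \<omega>))" by simp
  qed
qed

subsection \<open>Sampling at stopping times on a grid\<close>

locale discrete_filtration = prob_space M for M :: "'a measure" +
  fixes G :: "nat \<Rightarrow> 'a measure" and m :: nat
  assumes subG: "\<And>j. subalgebra M (G j)" and monoG: "\<And>i j. i \<le> j \<Longrightarrow> subalgebra (G j) (G i)"
begin

lemma space_G [simp]: "space (G j) = space M"
  using subG by (simp add: subalgebra_def)

lemma measurable_G: "f \<in> G j \<rightarrow>\<^sub>M N \<Longrightarrow> f \<in> M \<rightarrow>\<^sub>M N"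
  by (rule measurable_from_subalg[OF subG])

lemma measurable_G_mono: "f \<in> G i \<rightarrow>\<^sub>M N \<Longrightarrow> i \<le> j \<Longrightarrow> f \<in> G j \<rightarrow>\<^sub>M N"
  by (rule measurable_from_subalg[OF monoG])

text \<open>Only the values up to the horizon \<open>m\<close> have to be observable.\<close>

definition stopping :: "('a \<Rightarrow> nat) \<Rightarrow> bool" where
  "stopping \<tau> \<longleftrightarrow> (\<forall>j\<le>m. Measurable.pred (G j) (\<lambda>\<omega>. \<tau> \<omega> = j))"

text \<open>Measurability with respect to the stopped sigma-algebra, expressed by the pieces on
  \<open>\<tau> = j\<close>; these pieces are what the martingale property is tested with.\<close>

definition known_at :: "('a \<Rightarrow> nat) \<Rightarrow> ('a \<Rightarrow> real) \<Rightarrow> bool" where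
  "known_at \<tau> K \<longleftrightarrow> (\<forall>j\<le>m. (\<lambda>\<omega>. if \<tau> \<omega> = j then K \<omega> else 0) \<in> borel_measurable (G j))"

text \<open>Conditional expectations are replaced by integrals against bounded observable test
  functions, the form in which optional sampling consumes them.\<close>

definition is_martingale :: "(nat \<Rightarrow> 'a \<Rightarrow> real) \<Rightarrow> bool" where
  "is_martingale N \<longleftrightarrow> (\<forall>j. N j \<in> borel_measurable (G j) \<and> integrable M (N j)) \<and>
     (\<forall>i j H c. i \<le> j \<longrightarrow> H \<in> borel_measurable (G i) \<longrightarrow> (\<forall>\<omega>\<in>space M. \<bar>H \<omega>\<bar> \<le> c) \<longrightarrow>
        (\<integral>\<omega>. H \<omega> * N j \<omega> \<partial>M) = (\<integral>\<omega>. H \<omega> * N i \<omega> \<partial>M))"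

lemma sampled_sum:
  fixes K :: "'a \<Rightarrow> real" and X :: "nat \<Rightarrow> 'a \<Rightarrow> real"
  assumes "\<tau> \<omega> \<le> m"
  shows "K \<omega> * X (\<tau> \<omega>) \<omega> = (\<Sum>j\<le>m. (if \<tau> \<omega> = j then K \<omega> else 0) * X j \<omega>)"
proof -
  have "(\<Sum>j\<le>m. (if \<tau> \<omega> = j then K \<omega> else 0) * X j \<omega>) = (\<Sum>j\<le>m. if j = \<tau> \<omega> then K \<omega> * X j \<omega> else 0)"
    by (intro sum.cong refl) simp
  then show ?thesis using assms by simp
qed

lemma sampled_measurable:
  assumes \<tau>: "stopping \<tau>" "\<And>\<omega>. \<tau> \<omega> \<le> m" and X: "\<And>j. j \<le> m \<Longrightarrow> X j \<in> borel_measurable M"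
  shows "(\<lambda>\<omega>. X (\<tau> \<omega>) \<omega> :: real) \<in> borel_measurable M"
proof -
  have "(\<lambda>\<omega>. \<Sum>j\<le>m. (if \<tau> \<omega> = j then 1 else 0) * X j \<omega>) \<in> borel_measurable M"
  proof (intro borel_measurable_sum borel_measurable_times)
    fix j assume "j \<in> {..m}"
    then have [measurable]: "Measurable.pred M (\<lambda>\<omega>. \<tau> \<omega> = j)"
      using \<tau>(1) by (auto simp: stopping_def intro: measurable_G)
    show "(\<lambda>\<omega>. if \<tau> \<omega> = j then 1 else 0) \<in> borel_measurable M" by measurable
    show "X j \<in> borel_measurable M" using X \<open>j \<in> {..m}\<close> by simp
  qed
  then show ?thesis using sampled_sum[of \<tau> _ "\<lambda>_. 1" X] \<tau>(2) by simp
qed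

lemma sampled_integrable:
  assumes \<tau>: "stopping \<tau>" "\<And>\<omega>. \<tau> \<omega> \<le> m" and X: "\<And>j. j \<le> m \<Longrightarrow> integrable M (X j :: 'a \<Rightarrow> real)"
  shows "integrable M (\<lambda>\<omega>. X (\<tau> \<omega>) \<omega>)"
proof (rule Bochner_Integration.integrable_bound)
  show "integrable M (\<lambda>\<omega>. \<Sum>j\<le>m. \<bar>X j \<omega>\<bar>)" using X by (intro Bochner_Integration.integrable_sum integrable_abs) auto
  show "(\<lambda>\<omega>. X (\<tau> \<omega>) \<omega>) \<in> borel_measurable M" by (rule sampled_measurable[OF \<tau>]) (use X in auto)
  show "AE \<omega> in M. norm (X (\<tau> \<omega>) \<omega>) \<le> norm (\<Sum>j\<le>m. \<bar>X j \<omega>\<bar>)"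
  proof (rule AE_I2)
    fix \<omega>
    have "\<bar>X (\<tau> \<omega>) \<omega>\<bar> \<le> (\<Sum>j\<le>m. \<bar>X j \<omega>\<bar>)" using \<tau>(2)[of \<omega>] by (intro member_le_sum[of "\<tau> \<omega>" _ "\<lambda>j. \<bar>X j \<omega>\<bar>"]) auto
    then show "norm (X (\<tau> \<omega>) \<omega>) \<le> norm (\<Sum>j\<le>m. \<bar>X j \<omega>\<bar>)" by simp
  qed
qed

text \<open>On \<open>\<tau> = j\<close> the earlier time takes some value \<open>i \<le> j\<close>,
  and the piece of \<open>K\<close> on \<open>\<sigma> = i\<close>, known at \<open>i\<close>, is
  still known at \<open>j\<close>.\<close>

lemma known_at_mono:
  assumes \<sigma>: "stopping \<sigma>" and \<tau>: "stopping \<tau>" and le: "\<And>\<omega>. \<sigma> \<omega> \<le> \<tau> \<omega>" and K: "known_at \<sigma> K"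
  shows "known_at \<tau> K"
  unfolding known_at_def
proof (intro allI impI)
  fix j assume j: "j \<le> m"
  have "(\<lambda>\<omega>. \<Sum>i\<le>j. (if \<tau> \<omega> = j then 1 else 0) * (if \<sigma> \<omega> = i then K \<omega> else 0)) \<in> borel_measurable (G j)"
  proof (intro borel_measurable_sum borel_measurable_times)
    fix i assume "i \<in> {..j}"
    have [measurable]: "Measurable.pred (G j) (\<lambda>\<omega>. \<tau> \<omega> = j)" using \<tau> j by (simp add: stopping_def)
    show "(\<lambda>\<omega>. if \<tau> \<omega> = j then 1 else 0) \<in> borel_measurable (G j)" by measurable
    show "(\<lambda>\<omega>. if \<sigma> \<omega> = i then K \<omega> else 0) \<in> borel_measurable (G j)"
      by (rule measurable_G_mono[of _ i]) (use K j \<open>i \<in> {..j}\<close> in \<open>auto simp: known_at_def\<close>)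
  qed
  moreover have "(\<Sum>i\<le>j. (if \<tau> \<omega> = j then 1 else 0) * (if \<sigma> \<omega> = i then K \<omega> else 0)) = (if \<tau> \<omega> = j then K \<omega> else 0)" for \<omega>
    using le[of \<omega>] by simp
  ultimately show "(\<lambda>\<omega>. if \<tau> \<omega> = j then K \<omega> else 0) \<in> borel_measurable (G j)" by simp
qed

lemma known_at_sampled:
  assumes \<tau>: "stopping \<tau>" and X: "\<And>j. X j \<in> borel_measurable (G j)" and [measurable]: "\<phi> \<in> borel_measurable borel"
  shows "known_at \<tau> (\<lambda>\<omega>. \<phi> (X (\<tau> \<omega>) \<omega>))"
  unfolding known_at_def
proof (intro allI impI)
  fix j assume j: "j \<le> m"
  have [measurable]: "Measurable.pred (G j) (\<lambda>\<omega>. \<tau> \<omega> = j)" using \<tau> j by (simp add: stopping_def)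
  have [measurable]: "X j \<in> borel_measurable (G j)" by (rule X)
  have "(\<lambda>\<omega>. if \<tau> \<omega> = j then \<phi> (X j \<omega>) else 0) \<in> borel_measurable (G j)" by measurable
  also have "(\<lambda>\<omega>. if \<tau> \<omega> = j then \<phi> (X j \<omega>) else 0) = (\<lambda>\<omega>. if \<tau> \<omega> = j then \<phi> (X (\<tau> \<omega>) \<omega>) else 0)" by auto
  finally show "(\<lambda>\<omega>. if \<tau> \<omega> = j then \<phi> (X (\<tau> \<omega>) \<omega>) else 0) \<in> borel_measurable (G j)" .
qed

text \<open>The piece of \<open>K\<close> on \<open>\<tau> = j\<close> is an admissible test
  function between times \<open>j\<close> and \<open>m\<close>; the claim is the sum over
  \<open>j\<close>.\<close>

lemma optional_sampling:
  assumes N: "is_martingale N" and \<tau>: "stopping \<tau>" "\<And>\<omega>. \<tau> \<omega> \<le> m"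
    and K: "known_at \<tau> K" "\<And>\<omega>. \<omega> \<in> space M \<Longrightarrow> \<bar>K \<omega>\<bar> \<le> c" "0 \<le> c"
  shows "(\<integral>\<omega>. K \<omega> * N (\<tau> \<omega>) \<omega> \<partial>M) = (\<integral>\<omega>. K \<omega> * N m \<omega> \<partial>M)"
proof -
  define H where "H j \<omega> = (if \<tau> \<omega> = j then K \<omega> else 0)" for j \<omega>
  have H: "H j \<in> borel_measurable (G j)" if "j \<le> m" for j
    using K(1) that by (simp add: known_at_def H_def[abs_def])
  have Hb: "\<bar>H j \<omega>\<bar> \<le> c" if "\<omega> \<in> space M" for j \<omega> using K(2)[OF that] K(3) by (auto simp: H_def)
  have Ni: "integrable M (N j)" for j using N by (simp add: is_martingale_def)
  have int: "integrable M (\<lambda>\<omega>. H j \<omega> * N i \<omega>)" if "j \<le> m" for i j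
  proof (rule Bochner_Integration.integrable_bound)
    show "integrable M (\<lambda>\<omega>. c * N i \<omega>)" using Ni by simp
    show "(\<lambda>\<omega>. H j \<omega> * N i \<omega>) \<in> borel_measurable M"
      using measurable_G[OF H[OF that]] Ni[of i] by (intro borel_measurable_times) auto
    show "AE \<omega> in M. norm (H j \<omega> * N i \<omega>) \<le> norm (c * N i \<omega>)"
      using Hb K(3) by (intro AE_I2) (auto simp: abs_mult intro: mult_right_mono)
  qed
  have "(\<integral>\<omega>. K \<omega> * N (\<tau> \<omega>) \<omega> \<partial>M) = (\<Sum>j\<le>m. \<integral>\<omega>. H j \<omega> * N j \<omega> \<partial>M)"
    unfolding sampled_sum[of \<tau>, OF \<tau>(2)] H_def[symmetric]
    by (rule Bochner_Integration.integral_sum) (use int in auto)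
  also have "\<dots> = (\<Sum>j\<le>m. \<integral>\<omega>. H j \<omega> * N m \<omega> \<partial>M)"
  proof (intro sum.cong refl)
    fix j assume "j \<in> {..m}"
    then have "(\<integral>\<omega>. H j \<omega> * N m \<omega> \<partial>M) = (\<integral>\<omega>. H j \<omega> * N j \<omega> \<partial>M)"
      using N H[of j] Hb[of _ j] unfolding is_martingale_def by blast
    then show "(\<integral>\<omega>. H j \<omega> * N j \<omega> \<partial>M) = (\<integral>\<omega>. H j \<omega> * N m \<omega> \<partial>M)" by simp
  qed
  also have "\<dots> = (\<integral>\<omega>. (\<Sum>j\<le>m. H j \<omega> * N m \<omega>) \<partial>M)"
    by (rule Bochner_Integration.integral_sum[symmetric]) (use int in auto)
  also have "(\<lambda>\<omega>. \<Sum>j\<le>m. H j \<omega> * N m \<omega>) = (\<lambda>\<omega>. K \<omega> * N m \<omega>)"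
    using sampled_sum[of \<tau> _ K "\<lambda>_. N m"] \<tau>(2) by (simp add: H_def)
  finally show ?thesis .
qed

text \<open>\<open>(\<bar>N\<bar> - L)\<^sup>+\<close> is a submartingale: with \<open>K\<close> the sign of \<open>N\<^sub>\<tau>\<close> where \<open>\<bar>N\<^sub>\<tau>\<bar> > L\<close>, and \<open>0\<close> elsewhere,
  it is \<open>K N\<^sub>\<tau> - L \<bar>K\<bar>\<close> at time \<open>\<tau>\<close> and at least \<open>K N\<^sub>m - L \<bar>K\<bar>\<close> at time \<open>m\<close>.\<close>

lemma sampled_martingale_ui:
  assumes N: "is_martingale N" and \<tau>: "stopping \<tau>" "\<And>\<omega>. \<tau> \<omega> \<le> m" and L: "0 \<le> L" and Q: "Q \<in> sets M"
  shows "(\<integral>\<omega>. \<bar>N (\<tau> \<omega>) \<omega>\<bar> * indicator Q \<omega> \<partial>M) \<le> L * prob Q + (\<integral>\<omega>. max 0 (\<bar>N m \<omega>\<bar> - L) \<partial>M)"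
proof -
  define \<phi> where "\<phi> z = (if L < z then 1 else if z < - L then - 1 else (0::real))" for z
  define K where "K \<omega> = \<phi> (N (\<tau> \<omega>) \<omega>)" for \<omega>
  have [measurable]: "\<phi> \<in> borel_measurable borel" unfolding \<phi>_def[abs_def] by measurable
  have Nm: "N j \<in> borel_measurable (G j)" and Ni: "integrable M (N j)" for j using N by (auto simp: is_martingale_def)
  have K: "known_at \<tau> K" unfolding K_def by (rule known_at_sampled[OF \<tau>(1) Nm]) measurable
  have K1: "\<bar>K \<omega>\<bar> \<le> 1" for \<omega> by (simp add: K_def \<phi>_def)
  have N\<tau>: "integrable M (\<lambda>\<omega>. N (\<tau> \<omega>) \<omega>)" by (rule sampled_integrable[OF \<tau> Ni])
  have [measurable]: "K \<in> borel_measurable M"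
    unfolding K_def[abs_def] using N\<tau> by measurable
  have "integrable M (\<lambda>\<omega>. K \<omega> * X \<omega>)" if "integrable M X" for X
    by (rule Bochner_Integration.integrable_bound[OF that])
       (use that K1 in \<open>auto simp: abs_mult mult_left_le_one_le\<close>)
  from this[OF N\<tau>] this[OF Ni] have KN: "integrable M (\<lambda>\<omega>. K \<omega> * N (\<tau> \<omega>) \<omega>)" "integrable M (\<lambda>\<omega>. K \<omega> * N m \<omega>)" .
  have Ki: "integrable M (\<lambda>\<omega>. L * \<bar>K \<omega>\<bar>)"
    by (intro integrable_mult_right integrable_abs integrable_const_bound[of _ 1]) (use K1 in auto)
  \<comment> \<open>On \<open>Q\<close>, \<open>\<bar>z\<bar>\<close> is at most \<open>L\<close>
    plus the positive part of \<open>\<bar>z\<bar> - L\<close>; at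
    \<open>z = N (\<tau> \<omega>) \<omega>\<close> that part is
    \<open>K \<omega> * z - L * \<bar>K \<omega>\<bar>\<close>.\<close>
  have "(\<integral>\<omega>. \<bar>N (\<tau> \<omega>) \<omega>\<bar> * indicator Q \<omega> \<partial>M)
      \<le> (\<integral>\<omega>. L * indicator Q \<omega> + (K \<omega> * N (\<tau> \<omega>) \<omega> - L * \<bar>K \<omega>\<bar>) \<partial>M)"
  proof (rule integral_mono)
    show "integrable M (\<lambda>\<omega>. \<bar>N (\<tau> \<omega>) \<omega>\<bar> * indicator Q \<omega>)" using Q N\<tau> by (intro integrable_real_mult_indicator integrable_abs)
    show "integrable M (\<lambda>\<omega>. L * indicator Q \<omega> + (K \<omega> * N (\<tau> \<omega>) \<omega> - L * \<bar>K \<omega>\<bar>))"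
      using Q by (intro Bochner_Integration.integrable_add Bochner_Integration.integrable_diff KN Ki integrable_mult_right) (auto simp: emeasure_eq_measure)
    show "\<bar>N (\<tau> \<omega>) \<omega>\<bar> * indicator Q \<omega> \<le> L * indicator Q \<omega> + (K \<omega> * N (\<tau> \<omega>) \<omega> - L * \<bar>K \<omega>\<bar>)" for \<omega>
      using L by (auto simp: K_def \<phi>_def indicator_def)
  qed
  also have "\<dots> = L * prob Q + ((\<integral>\<omega>. K \<omega> * N m \<omega> \<partial>M) - (\<integral>\<omega>. L * \<bar>K \<omega>\<bar> \<partial>M))"
    using Q KN Ki optional_sampling[OF N \<tau> K, of 1] K1
    by (subst Bochner_Integration.integral_add) (auto simp: emeasure_eq_measure)
  also have "(\<integral>\<omega>. K \<omega> * N m \<omega> \<partial>M) - (\<integral>\<omega>. L * \<bar>K \<omega>\<bar> \<partial>M) = (\<integral>\<omega>. K \<omega> * N m \<omega> - L * \<bar>K \<omega>\<bar> \<partial>M)"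
    using KN Ki by simp
  also have "\<dots> \<le> (\<integral>\<omega>. max 0 (\<bar>N m \<omega>\<bar> - L) \<partial>M)"
  proof (rule integral_mono)
    show "integrable M (\<lambda>\<omega>. K \<omega> * N m \<omega> - L * \<bar>K \<omega>\<bar>)" using KN Ki by simp
    show "integrable M (\<lambda>\<omega>. max 0 (\<bar>N m \<omega>\<bar> - L))" using Ni[of m] by (intro integrable_max) auto
    show "K \<omega> * N m \<omega> - L * \<bar>K \<omega>\<bar> \<le> max 0 (\<bar>N m \<omega>\<bar> - L)" for \<omega>
      by (auto simp: K_def \<phi>_def)
  qed
  finally show ?thesis by simp
qed

text \<open>\<open>V\<close> is only controlled off the exceptional set \<open>Q\<close>; on \<open>Q\<close>, \<open>V = Y - (Y - V)\<close> is handled by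
  uniform integrability of the martingale \<open>Y - V\<close>.\<close>

lemma sampled_increment_bound:
  fixes \<zeta> Y V :: "nat \<Rightarrow> 'a \<Rightarrow> real"
  assumes N: "is_martingale (\<lambda>j \<omega>. Y j \<omega> - V j \<omega>)"
    and \<zeta>: "\<And>j. \<zeta> j \<in> borel_measurable (G j)" "\<And>j \<omega>. \<bar>\<zeta> j \<omega>\<bar> \<le> c"
    and Ym: "\<And>j. Y j \<in> borel_measurable (G j)"
    and D: "integrable M D" "\<And>j \<omega>. j \<le> m \<Longrightarrow> \<bar>Y j \<omega> - \<zeta> j \<omega>\<bar> \<le> D \<omega>" "(\<integral>\<omega>. D \<omega> \<partial>M) \<le> \<epsilon>"
    and L: "0 \<le> L" "(\<integral>\<omega>. max 0 (\<bar>Y m \<omega> - V m \<omega>\<bar> - L) \<partial>M) \<le> \<epsilon>"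
    and Q: "Q \<in> sets M" "(c + L) * prob Q \<le> \<epsilon>"
    and \<sigma>: "stopping \<sigma>" "\<And>\<omega>. \<sigma> \<omega> \<le> \<tau> \<omega>" and \<tau>: "stopping \<tau>" "\<And>\<omega>. \<tau> \<omega> \<le> m"
    and \<theta>: "0 \<le> \<theta>" "\<And>\<omega>. \<omega> \<in> space M - Q \<Longrightarrow> \<bar>V (\<tau> \<omega>) \<omega> - V (\<sigma> \<omega>) \<omega>\<bar> \<le> 2 * \<theta>"
    and K: "known_at \<sigma> K" "\<And>\<omega>. \<bar>K \<omega>\<bar> \<le> k" "0 \<le> k"
  shows "\<bar>\<integral>\<omega>. K \<omega> * (\<zeta> (\<tau> \<omega>) \<omega> - \<zeta> (\<sigma> \<omega>) \<omega>) \<partial>M\<bar> \<le> k * (2 * \<theta> + 8 * \<epsilon>)"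
proof -
  have \<sigma>m: "\<sigma> \<omega> \<le> m" for \<omega> using \<sigma>(2)[of \<omega>] \<tau>(2)[of \<omega>] by simp
  define N where "N j \<omega> = Y j \<omega> - V j \<omega>" for j \<omega>
  have NN: "is_martingale N" using N by (simp add: N_def[abs_def])
  have Ni: "integrable M (N j)" for j using NN by (simp add: is_martingale_def)
  have \<zeta>i: "integrable M (\<zeta> j)" for j
    by (rule integrable_const_bound[of _ c]) (use \<zeta> in \<open>auto intro: measurable_G\<close>)
  have Yi: "integrable M (Y j)" if "j \<le> m" for j
  proof (rule Bochner_Integration.integrable_bound)
    show "integrable M (\<lambda>\<omega>. c + D \<omega>)" using D by simp
    show "Y j \<in> borel_measurable M" by (rule measurable_G[OF Ym])
    show "AE \<omega> in M. norm (Y j \<omega>) \<le> norm (c + D \<omega>)"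
      using D(2)[OF that] \<zeta>(2)[of j] by (intro AE_I2) (smt (verit) real_norm_def)
  qed
  note S = sampled_integrable[OF \<sigma>(1) \<sigma>m] and T = sampled_integrable[OF \<tau>]
  have Vi: "integrable M (V j)" if "j \<le> m" for j
    using Bochner_Integration.integrable_diff[OF Yi[OF that] Ni[of j]] by (simp add: N_def[abs_def])
  have NS: "integrable M (\<lambda>\<omega>. N (\<sigma> \<omega>) \<omega>)" and NT: "integrable M (\<lambda>\<omega>. N (\<tau> \<omega>) \<omega>)" using S[of N] T[of N] Ni by auto
  have VS: "integrable M (\<lambda>\<omega>. V (\<sigma> \<omega>) \<omega>)" and VT: "integrable M (\<lambda>\<omega>. V (\<tau> \<omega>) \<omega>)" using S[of V] T[of V] Vi by auto
  have zS: "integrable M (\<lambda>\<omega>. \<zeta> (\<sigma> \<omega>) \<omega>)" and zT: "integrable M (\<lambda>\<omega>. \<zeta> (\<tau> \<omega>) \<omega>)" using S[of \<zeta>] T[of \<zeta>] \<zeta>i by auto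
  have KT: "known_at \<tau> K" by (rule known_at_mono[OF \<sigma>(1) \<tau>(1) \<sigma>(2) K(1)])
  have Km[measurable]: "K \<in> borel_measurable M"
  proof -
    have "(\<lambda>\<omega>. \<Sum>j\<le>m. (if \<sigma> \<omega> = j then K \<omega> else 0)) \<in> borel_measurable M"
      by (intro borel_measurable_sum measurable_G) (use K(1) in \<open>auto simp: known_at_def\<close>)
    then show ?thesis using \<sigma>m by simp
  qed
  have Kint: "integrable M (\<lambda>\<omega>. K \<omega> * X \<omega>)" if "integrable M X" for X
  proof (rule Bochner_Integration.integrable_bound)
    show "integrable M (\<lambda>\<omega>. k * X \<omega>)" using that by simp
    show "(\<lambda>\<omega>. K \<omega> * X \<omega>) \<in> borel_measurable M" using that by measurable
    show "AE \<omega> in M. norm (K \<omega> * X \<omega>) \<le> norm (k * X \<omega>)"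
      using K by (intro AE_I2) (auto simp: abs_mult intro: mult_right_mono)
  qed
  have ED: "0 \<le> D \<omega>" for \<omega> using D(2)[of 0 \<omega>] by simp
  have E0: "0 \<le> \<epsilon>" by (rule order_trans[OF Bochner_Integration.integral_nonneg D(3)]) (rule ED)
  have c0: "0 \<le> c" using \<zeta>(2)[of 0 undefined] by simp
  have DO: "(\<integral>\<omega>. D \<omega> * indicator Q \<omega> \<partial>M) \<le> \<epsilon>"
  proof (rule order_trans[OF integral_mono D(3)])
    show "integrable M (\<lambda>\<omega>. D \<omega> * indicator Q \<omega>)" using Q(1) D(1) by (rule integrable_real_mult_indicator)
    show "D \<omega> * indicator Q \<omega> \<le> D \<omega>" for \<omega> using ED[of \<omega>] by (simp add: indicator_def)
  qed (rule D)
  define W where "W \<omega> = V (\<tau> \<omega>) \<omega> - V (\<sigma> \<omega>) \<omega>" for \<omega>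
  have Wi: "integrable M W" unfolding W_def[abs_def] using VS VT by simp
  define R where "R \<omega> = 2 * \<theta> + 2 * c * indicator Q \<omega> + 2 * (D \<omega> * indicator Q \<omega>)
      + \<bar>N (\<tau> \<omega>) \<omega>\<bar> * indicator Q \<omega> + \<bar>N (\<sigma> \<omega>) \<omega>\<bar> * indicator Q \<omega>" for \<omega>
  have i1: "integrable M (\<lambda>\<omega>. 2 * c * indicator Q \<omega>)" "integrable M (\<lambda>\<omega>. 2 * (D \<omega> * indicator Q \<omega>))"
    "integrable M (\<lambda>\<omega>. \<bar>N (\<tau> \<omega>) \<omega>\<bar> * indicator Q \<omega>)" "integrable M (\<lambda>\<omega>. \<bar>N (\<sigma> \<omega>) \<omega>\<bar> * indicator Q \<omega>)"
    using Q D(1) NS NT by (auto intro!: integrable_real_mult_indicator integrable_abs integrable_mult_right simp: emeasure_eq_measure)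
  have WR: "\<bar>W \<omega>\<bar> \<le> R \<omega>" if "\<omega> \<in> space M" for \<omega>
  proof (cases "\<omega> \<in> Q")
    case True
    have "\<bar>W \<omega>\<bar> \<le> \<bar>Y (\<tau> \<omega>) \<omega>\<bar> + \<bar>Y (\<sigma> \<omega>) \<omega>\<bar> + \<bar>N (\<tau> \<omega>) \<omega>\<bar> + \<bar>N (\<sigma> \<omega>) \<omega>\<bar>"
      by (simp add: W_def N_def)
    moreover have "\<bar>Y j \<omega>\<bar> \<le> c + D \<omega>" if "j \<le> m" for j using D(2)[OF that, of \<omega>] \<zeta>(2)[of j \<omega>] by linarith
    from this[OF \<tau>(2)] this[OF \<sigma>m] have "\<bar>Y (\<tau> \<omega>) \<omega>\<bar> \<le> c + D \<omega>" "\<bar>Y (\<sigma> \<omega>) \<omega>\<bar> \<le> c + D \<omega>" .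
    ultimately show ?thesis using True \<theta>(1) by (simp add: R_def)
  next
    case False
    then show ?thesis using \<theta>(2)[of \<omega>] that by (simp add: R_def W_def)
  qed
  have "(\<integral>\<omega>. \<bar>W \<omega>\<bar> \<partial>M) \<le> (\<integral>\<omega>. R \<omega> \<partial>M)"
    unfolding R_def[abs_def] by (intro integral_mono WR[unfolded R_def] Bochner_Integration.integrable_add i1 integrable_abs Wi) auto
  also have "\<dots> = 2 * \<theta> + 2 * c * prob Q + 2 * (\<integral>\<omega>. D \<omega> * indicator Q \<omega> \<partial>M)
      + (\<integral>\<omega>. \<bar>N (\<tau> \<omega>) \<omega>\<bar> * indicator Q \<omega> \<partial>M) + (\<integral>\<omega>. \<bar>N (\<sigma> \<omega>) \<omega>\<bar> * indicator Q \<omega> \<partial>M)"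
    unfolding R_def[abs_def] using i1 Q(1)
    by (simp add: prob_space emeasure_eq_measure)
  also have "\<dots> \<le> 2 * \<theta> + 2 * c * prob Q + 2 * \<epsilon> + (L * prob Q + \<epsilon>) + (L * prob Q + \<epsilon>)"
    using DO sampled_martingale_ui[OF NN \<tau> L(1) Q(1)] sampled_martingale_ui[OF NN \<sigma>(1) \<sigma>m L(1) Q(1)] L(2)
    by (simp add: N_def)
  \<comment> \<open>Of the six \<open>\<epsilon>\<close>, two come from \<open>D\<close>, two from
    the tails of the martingale at the two times, and two from
    \<open>2 * (c + L) * prob Q\<close>.\<close>
  also have "\<dots> \<le> 2 * \<theta> + 6 * \<epsilon>" using Q(2) by (simp add: algebra_simps)
  finally have W: "(\<integral>\<omega>. \<bar>W \<omega>\<bar> \<partial>M) \<le> 2 * \<theta> + 6 * \<epsilon>" .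
  have KN0: "(\<integral>\<omega>. K \<omega> * N (\<tau> \<omega>) \<omega> \<partial>M) = (\<integral>\<omega>. K \<omega> * N (\<sigma> \<omega>) \<omega> \<partial>M)"
    using optional_sampling[OF NN \<tau> KT K(2,3)] optional_sampling[OF NN \<sigma>(1) \<sigma>m K] by simp
  \<comment> \<open>The martingale increment weighted with \<open>K\<close> has mean zero, so it may
    be subtracted. What remains is the drift plus the error of replacing \<open>\<zeta>\<close> by
    \<open>Y\<close> at two times, which adds the last two \<open>\<epsilon>\<close>.\<close>
  define E where "E \<omega> = K \<omega> * (\<zeta> (\<tau> \<omega>) \<omega> - \<zeta> (\<sigma> \<omega>) \<omega>) - (K \<omega> * N (\<tau> \<omega>) \<omega> - K \<omega> * N (\<sigma> \<omega>) \<omega>)" for \<omega>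
  have zi: "integrable M (\<lambda>\<omega>. K \<omega> * (\<zeta> (\<tau> \<omega>) \<omega> - \<zeta> (\<sigma> \<omega>) \<omega>))" using zS zT by (intro Kint) simp
  have Ei: "integrable M E" unfolding E_def[abs_def] by (intro Bochner_Integration.integrable_diff zi Kint NT NS)
  have "(\<integral>\<omega>. K \<omega> * (\<zeta> (\<tau> \<omega>) \<omega> - \<zeta> (\<sigma> \<omega>) \<omega>) \<partial>M) = (\<integral>\<omega>. E \<omega> \<partial>M)"
    unfolding E_def[abs_def] using KN0 Kint[OF NT] Kint[OF NS] zi by simp
  then have "\<bar>\<integral>\<omega>. K \<omega> * (\<zeta> (\<tau> \<omega>) \<omega> - \<zeta> (\<sigma> \<omega>) \<omega>) \<partial>M\<bar> \<le> (\<integral>\<omega>. \<bar>E \<omega>\<bar> \<partial>M)" using integral_abs_bound[of M E] by simp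
  also have "\<dots> \<le> (\<integral>\<omega>. k * (\<bar>W \<omega>\<bar> + 2 * D \<omega>) \<partial>M)"
  proof (rule integral_mono)
    fix \<omega>
    have "E \<omega> = K \<omega> * (W \<omega> - ((Y (\<tau> \<omega>) \<omega> - \<zeta> (\<tau> \<omega>) \<omega>) - (Y (\<sigma> \<omega>) \<omega> - \<zeta> (\<sigma> \<omega>) \<omega>)))"
      by (simp add: E_def W_def N_def algebra_simps)
    moreover have "\<bar>W \<omega> - ((Y (\<tau> \<omega>) \<omega> - \<zeta> (\<tau> \<omega>) \<omega>) - (Y (\<sigma> \<omega>) \<omega> - \<zeta> (\<sigma> \<omega>) \<omega>))\<bar> \<le> \<bar>W \<omega>\<bar> + 2 * D \<omega>"
      using D(2)[OF \<tau>(2), of \<omega> \<omega>] D(2)[OF \<sigma>m, of \<omega> \<omega>] by linarith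
    ultimately show "\<bar>E \<omega>\<bar> \<le> k * (\<bar>W \<omega>\<bar> + 2 * D \<omega>)"
      using K(2)[of \<omega>] K(3) by (simp add: abs_mult mult_mono)
  qed (use Ei Wi D(1) in auto)
  also have "\<dots> = k * ((\<integral>\<omega>. \<bar>W \<omega>\<bar> \<partial>M) + 2 * (\<integral>\<omega>. D \<omega> \<partial>M))"
    using Wi D(1) by simp
  also have "\<dots> \<le> k * (2 * \<theta> + 8 * \<epsilon>)"
    using W D(3) K(3) by (intro mult_left_mono) auto
  finally show ?thesis .
qed

end

subsection \<open>Oscillation on a grid\<close>

text \<open>One index and one grid: \<open>Y\<close>, \<open>V\<close> belong to \<open>f\<close>
  and \<open>Y'\<close>, \<open>V'\<close> to its square. \<open>Q\<close> controls the drifts over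
  single grid steps only; control over whole windows enters later, through \<open>W\<close>.\<close>

locale two_approximations = discrete_filtration M G m for M :: "'a measure" and G m +
  fixes \<xi> Y V Y' V' :: "nat \<Rightarrow> 'a \<Rightarrow> real" and C \<epsilon> \<theta> L :: real and Q :: "'a set" and D D' :: "'a \<Rightarrow> real"
  assumes \<xi>m: "\<And>j. \<xi> j \<in> borel_measurable (G j)" and \<xi>C: "\<And>j \<omega>. \<bar>\<xi> j \<omega>\<bar> \<le> C"
    and Ym: "\<And>j. Y j \<in> borel_measurable (G j)" "\<And>j. Y' j \<in> borel_measurable (G j)"
    and Vm: "\<And>j. V j \<in> borel_measurable (G j)" "\<And>j. V' j \<in> borel_measurable (G j)"
    and N: "is_martingale (\<lambda>j \<omega>. Y j \<omega> - V j \<omega>)" "is_martingale (\<lambda>j \<omega>. Y' j \<omega> - V' j \<omega>)"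
    and D: "integrable M D" "\<And>j \<omega>. j \<le> m \<Longrightarrow> \<bar>Y j \<omega> - \<xi> j \<omega>\<bar> \<le> D \<omega>" "(\<integral>\<omega>. D \<omega> \<partial>M) \<le> \<epsilon>"
    and D': "integrable M D'" "\<And>j \<omega>. j \<le> m \<Longrightarrow> \<bar>Y' j \<omega> - (\<xi> j \<omega>)\<^sup>2\<bar> \<le> D' \<omega>" "(\<integral>\<omega>. D' \<omega> \<partial>M) \<le> \<epsilon>"
    and L: "0 \<le> L" "(\<integral>\<omega>. max 0 (\<bar>Y m \<omega> - V m \<omega>\<bar> - L) \<partial>M) \<le> \<epsilon>" "(\<integral>\<omega>. max 0 (\<bar>Y' m \<omega> - V' m \<omega>\<bar> - L) \<partial>M) \<le> \<epsilon>"
    and Q: "Q \<in> sets M" "(C + L) * prob Q \<le> \<epsilon>" "(C\<^sup>2 + L) * prob Q \<le> \<epsilon>"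
    and \<theta>: "0 \<le> \<theta>" "\<And>\<omega> j. \<omega> \<in> space M - Q \<Longrightarrow> j < m \<Longrightarrow> \<bar>V (Suc j) \<omega> - V j \<omega>\<bar> \<le> \<theta>"
      "\<And>\<omega> j. \<omega> \<in> space M - Q \<Longrightarrow> j < m \<Longrightarrow> \<bar>V' (Suc j) \<omega> - V' j \<omega>\<bar> \<le> \<theta>"
begin

text \<open>The square is tested with the weight 1, \<open>f\<close> itself with the weight
  \<open>\<xi> (\<sigma> \<omega>) \<omega>\<close> bounded by \<open>C\<close> and counted twice;
  hence the factor \<open>1 + 2 * C\<close>.\<close>

lemma squared_increment_bound:
  assumes \<sigma>: "stopping \<sigma>" "\<And>\<omega>. \<sigma> \<omega> \<le> \<tau> \<omega>" and \<tau>: "stopping \<tau>" "\<And>\<omega>. \<tau> \<omega> \<le> m"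
    and V: "\<And>\<omega>. \<omega> \<in> space M - Q \<Longrightarrow> \<bar>V (\<tau> \<omega>) \<omega> - V (\<sigma> \<omega>) \<omega>\<bar> \<le> 2 * \<theta>"
      "\<And>\<omega>. \<omega> \<in> space M - Q \<Longrightarrow> \<bar>V' (\<tau> \<omega>) \<omega> - V' (\<sigma> \<omega>) \<omega>\<bar> \<le> 2 * \<theta>"
  shows "(\<integral>\<omega>. (\<xi> (\<tau> \<omega>) \<omega> - \<xi> (\<sigma> \<omega>) \<omega>)\<^sup>2 \<partial>M) \<le> (1 + 2 * C) * (2 * \<theta> + 8 * \<epsilon>)"
proof -
  have \<sigma>m: "\<sigma> \<omega> \<le> m" for \<omega> using \<sigma>(2)[of \<omega>] \<tau>(2)[of \<omega>] by simp
  have C0: "0 \<le> C" using \<xi>C[of 0 undefined] by simp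
  have sq: "(\<xi> j \<omega>)\<^sup>2 \<le> C\<^sup>2" for j \<omega> using \<xi>C[of j \<omega>] by (simp add: abs_le_square_iff[symmetric] C0)
  define a where "a = (\<integral>\<omega>. 1 * ((\<xi> (\<tau> \<omega>) \<omega>)\<^sup>2 - (\<xi> (\<sigma> \<omega>) \<omega>)\<^sup>2) \<partial>M)"
  define b where "b = (\<integral>\<omega>. \<xi> (\<sigma> \<omega>) \<omega> * (\<xi> (\<tau> \<omega>) \<omega> - \<xi> (\<sigma> \<omega>) \<omega>) \<partial>M)"
  have "\<bar>a\<bar> \<le> 1 * (2 * \<theta> + 8 * \<epsilon>)" unfolding a_def
  proof (rule sampled_increment_bound[where \<zeta>="\<lambda>j \<omega>. (\<xi> j \<omega>)\<^sup>2" and K="\<lambda>_. 1",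
        OF N(2) _ _ Ym(2) D' L(1,3) Q(1,3) \<sigma> \<tau> \<theta>(1) V(2)])
    show "(\<lambda>\<omega>. (\<xi> j \<omega>)\<^sup>2) \<in> borel_measurable (G j)" for j using \<xi>m[of j] by measurable
    show "known_at \<sigma> (\<lambda>_. 1)" using known_at_sampled[OF \<sigma>(1) \<xi>m, of "\<lambda>_. 1"] by simp
  qed (use sq in auto)
  moreover have "\<bar>b\<bar> \<le> C * (2 * \<theta> + 8 * \<epsilon>)" unfolding b_def
  proof (rule sampled_increment_bound[where \<zeta>=\<xi>, OF N(1) \<xi>m \<xi>C Ym(1) D L(1,2) Q(1,2) \<sigma> \<tau> \<theta>(1) V(1)])
    show "known_at \<sigma> (\<lambda>\<omega>. \<xi> (\<sigma> \<omega>) \<omega>)" using known_at_sampled[OF \<sigma>(1) \<xi>m, of "\<lambda>z. z"] by simp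
  qed (use \<xi>C C0 in auto)
  moreover have "(\<integral>\<omega>. (\<xi> (\<tau> \<omega>) \<omega> - \<xi> (\<sigma> \<omega>) \<omega>)\<^sup>2 \<partial>M) = a - 2 * b"
  proof -
    have [measurable]: "(\<lambda>\<omega>. \<xi> (\<tau> \<omega>) \<omega>) \<in> borel_measurable M" "(\<lambda>\<omega>. \<xi> (\<sigma> \<omega>) \<omega>) \<in> borel_measurable M"
      by (rule sampled_measurable[OF \<tau>] sampled_measurable[OF \<sigma>(1) \<sigma>m], rule measurable_G[OF \<xi>m])+
    have i1: "integrable M (\<lambda>\<omega>. 1 * ((\<xi> (\<tau> \<omega>) \<omega>)\<^sup>2 - (\<xi> (\<sigma> \<omega>) \<omega>)\<^sup>2))"
      by (rule integrable_const_bound[of _ "C\<^sup>2 + C\<^sup>2"])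
         (auto intro!: AE_I2 order_trans[OF abs_triangle_ineq4] add_mono[OF sq sq, simplified])
    have i2: "integrable M (\<lambda>\<omega>. \<xi> (\<sigma> \<omega>) \<omega> * (\<xi> (\<tau> \<omega>) \<omega> - \<xi> (\<sigma> \<omega>) \<omega>))"
      by (rule integrable_const_bound[of _ "C * (C + C)"])
         (auto intro!: AE_I2 mult_mono order_trans[OF abs_triangle_ineq4] add_mono[OF \<xi>C \<xi>C, simplified] \<xi>C C0 simp: abs_mult)
    have "(\<lambda>\<omega>. (\<xi> (\<tau> \<omega>) \<omega> - \<xi> (\<sigma> \<omega>) \<omega>)\<^sup>2) =
        (\<lambda>\<omega>. 1 * ((\<xi> (\<tau> \<omega>) \<omega>)\<^sup>2 - (\<xi> (\<sigma> \<omega>) \<omega>)\<^sup>2) - 2 * (\<xi> (\<sigma> \<omega>) \<omega> * (\<xi> (\<tau> \<omega>) \<omega> - \<xi> (\<sigma> \<omega>) \<omega>)))"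
      by (simp add: fun_eq_iff power2_eq_square algebra_simps)
    then show ?thesis
      using Bochner_Integration.integral_diff[OF i1 integrable_mult_right[OF i2, of 2]] by (simp add: a_def b_def)
  qed
  moreover have "(1 + 2 * C) * (2 * \<theta> + 8 * \<epsilon>) = 1 * (2 * \<theta> + 8 * \<epsilon>) + 2 * (C * (2 * \<theta> + 8 * \<epsilon>))"
    by (simp add: algebra_simps)
  ultimately show ?thesis by linarith
qed

text \<open>Sampling at the first time the increment of \<open>\<xi>\<close> reaches \<open>r\<close>, or those of \<open>V\<close>, \<open>V'\<close> exceed
  \<open>\<theta>\<close>, turns the second moment bound into a bound on the maximum over the window.\<close>

lemma window_oscillation:
  assumes \<sigma>: "stopping \<sigma>" and r: "0 < r" and W: "W \<in> sets M"
    and VW: "\<And>\<omega> i j. \<omega> \<in> space M - W \<Longrightarrow> i \<le> j \<Longrightarrow> j \<le> i + l \<Longrightarrow> j \<le> m \<Longrightarrow>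
      \<bar>V j \<omega> - V i \<omega>\<bar> \<le> \<theta> \<and> \<bar>V' j \<omega> - V' i \<omega>\<bar> \<le> \<theta>"
  obtains E where "E \<in> sets M" "prob E \<le> (1 + 2 * C) * (2 * \<theta> + 8 * \<epsilon>) / r\<^sup>2 + prob W"
    "\<And>\<omega> j. \<omega> \<in> space M \<Longrightarrow> \<sigma> \<omega> \<le> j \<Longrightarrow> j \<le> \<sigma> \<omega> + l \<Longrightarrow> j \<le> m \<Longrightarrow> r \<le> \<bar>\<xi> j \<omega> - \<xi> (\<sigma> \<omega>) \<omega>\<bar> \<Longrightarrow> \<omega> \<in> E"
proof -
  \<comment> \<open>\<open>\<sigma>\<close> may lie beyond the horizon, as jump times do when no
    jump is left. The truncation remains a stopping time, because \<open>s \<omega> = m\<close>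
    means that no earlier value was taken.\<close>
  define s where "s \<omega> = min (\<sigma> \<omega>) m" for \<omega>
  have sm: "s \<omega> \<le> m" for \<omega> by (simp add: s_def)
  have s: "stopping s" unfolding stopping_def
  proof (intro allI impI)
    fix j assume j: "j \<le> m"
    show "Measurable.pred (G j) (\<lambda>\<omega>. s \<omega> = j)"
    proof (cases "j = m")
      case False
      then have "(s \<omega> = j) = (\<sigma> \<omega> = j)" for \<omega> using j by (auto simp: s_def)
      then show ?thesis using \<sigma> j by (simp add: stopping_def)
    next
      case True
      have "(s \<omega> = j) = (\<not> (\<exists>i\<in>{..<m}. \<sigma> \<omega> = i))" for \<omega> using True by (auto simp: s_def)
      moreover have "Measurable.pred (G j) (\<lambda>\<omega>. \<not> (\<exists>i\<in>{..<m}. \<sigma> \<omega> = i))"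
      proof (intro pred_intros_logic pred_intros_finite finite_lessThan)
        fix i assume "i \<in> {..<m}"
        then show "Measurable.pred (G j) (\<lambda>\<omega>. \<sigma> \<omega> = i)"
          using \<sigma> j True by (intro measurable_G_mono[of "\<lambda>\<omega>. \<sigma> \<omega> = i" i _ j]) (auto simp: stopping_def)
      qed
      ultimately show ?thesis by simp
    qed
  qed
  define st where "st i j \<omega> \<longleftrightarrow> j = min (i + l) m \<or> r \<le> \<bar>\<xi> j \<omega> - \<xi> i \<omega>\<bar>
      \<or> \<theta> < \<bar>V j \<omega> - V i \<omega>\<bar> \<or> \<theta> < \<bar>V' j \<omega> - V' i \<omega>\<bar>" for i j \<omega>
  define \<tau> where "\<tau> \<omega> = (LEAST j. s \<omega> \<le> j \<and> st (s \<omega>) j \<omega>)" for \<omega>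
  have ex: "s \<omega> \<le> min (s \<omega> + l) m \<and> st (s \<omega>) (min (s \<omega> + l) m) \<omega>" for \<omega>
    using sm[of \<omega>] by (simp add: st_def)
  have \<tau>1: "s \<omega> \<le> \<tau> \<omega> \<and> st (s \<omega>) (\<tau> \<omega>) \<omega>" for \<omega>
    unfolding \<tau>_def using ex[of \<omega>] by (rule LeastI)
  have \<tau>2: "\<tau> \<omega> \<le> j" if "s \<omega> \<le> j" "st (s \<omega>) j \<omega>" for \<omega> j
    unfolding \<tau>_def by (rule Least_le) (use that in simp)
  have \<tau>l: "\<tau> \<omega> \<le> min (s \<omega> + l) m" for \<omega> using \<tau>2 ex by blast
  have \<tau>m: "\<tau> \<omega> \<le> m" for \<omega> using \<tau>l[of \<omega>] by simp
  have \<tau>: "stopping \<tau>" unfolding stopping_def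
  proof (intro allI impI)
    fix j assume j: "j \<le> m"
    have stm: "Measurable.pred (G j) (st i k)" if "i \<le> j" "k \<le> j" for i k
    proof -
      have [measurable]: "\<xi> i \<in> borel_measurable (G j)" "\<xi> k \<in> borel_measurable (G j)" "V i \<in> borel_measurable (G j)"
        "V k \<in> borel_measurable (G j)" "V' i \<in> borel_measurable (G j)" "V' k \<in> borel_measurable (G j)"
        using measurable_G_mono[OF \<xi>m] measurable_G_mono[OF Vm(1)] measurable_G_mono[OF Vm(2)] that by auto
      show ?thesis unfolding st_def[abs_def] by measurable
    qed
    have "(\<tau> \<omega> = j) = (\<exists>i\<in>{..j}. s \<omega> = i \<and> st i j \<omega> \<and> \<not> (\<exists>k\<in>{i..<j}. st i k \<omega>))" for \<omega>
    proof
      assume "\<tau> \<omega> = j"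
      then show "\<exists>i\<in>{..j}. s \<omega> = i \<and> st i j \<omega> \<and> \<not> (\<exists>k\<in>{i..<j}. st i k \<omega>)"
        using \<tau>1[of \<omega>] \<tau>2[of \<omega>] by (intro bexI[of _ "s \<omega>"]) fastforce+
    next
      assume R: "\<exists>i\<in>{..j}. s \<omega> = i \<and> st i j \<omega> \<and> \<not> (\<exists>k\<in>{i..<j}. st i k \<omega>)"
      then have "s \<omega> \<le> j" "st (s \<omega>) j \<omega>" "\<And>k. s \<omega> \<le> k \<Longrightarrow> k < j \<Longrightarrow> \<not> st (s \<omega>) k \<omega>" by auto
      then show "\<tau> \<omega> = j" using \<tau>1[of \<omega>] \<tau>2[of \<omega> j] by (meson le_neq_implies_less)
    qed
    moreover have "Measurable.pred (G j) (\<lambda>\<omega>. \<exists>i\<in>{..j}. s \<omega> = i \<and> st i j \<omega> \<and> \<not> (\<exists>k\<in>{i..<j}. st i k \<omega>))"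
    proof (intro pred_intros_logic pred_intros_finite finite_atMost finite_atLeastLessThan stm)
      fix i assume "i \<in> {..j}"
      then show "Measurable.pred (G j) (\<lambda>\<omega>. s \<omega> = i)"
        using s j by (intro measurable_G_mono[of "\<lambda>\<omega>. s \<omega> = i" i _ j]) (auto simp: stopping_def)
    qed auto
    ultimately show "Measurable.pred (G j) (\<lambda>\<omega>. \<tau> \<omega> = j)" by simp
  qed
  \<comment> \<open>One step before \<open>\<tau>\<close> the stopping rule had not fired, so the
    increment was still at most \<open>\<theta>\<close>; the last step adds at most
    \<open>\<theta>\<close>.\<close>
  have jump: "\<bar>v (\<tau> \<omega>) \<omega> - v (s \<omega>) \<omega>\<bar> \<le> 2 * \<theta>"
    if v: "\<And>j. \<not> st (s \<omega>) j \<omega> \<Longrightarrow> \<bar>v j \<omega> - v (s \<omega>) \<omega>\<bar> \<le> \<theta>" and inc: "\<And>j. j < m \<Longrightarrow> \<bar>v (Suc j) \<omega> - v j \<omega>\<bar> \<le> \<theta>"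
    for v :: "nat \<Rightarrow> 'a \<Rightarrow> real" and \<omega>
  proof (cases "\<tau> \<omega> = s \<omega>")
    case True then show ?thesis using \<theta>(1) by simp
  next
    case False
    then obtain k where k: "\<tau> \<omega> = Suc k" "s \<omega> \<le> k" using \<tau>1[of \<omega>] by (cases "\<tau> \<omega>") auto
    then have "\<not> st (s \<omega>) k \<omega>" using \<tau>2[of \<omega> k] by auto
    then show ?thesis using v[of k] inc[of k] \<tau>m[of \<omega>] k(1) by (simp add: abs_le_iff)
  qed
  have sec: "(\<integral>\<omega>. (\<xi> (\<tau> \<omega>) \<omega> - \<xi> (s \<omega>) \<omega>)\<^sup>2 \<partial>M) \<le> (1 + 2 * C) * (2 * \<theta> + 8 * \<epsilon>)"
  proof (rule squared_increment_bound[OF s _ \<tau> \<tau>m])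
    show "s \<omega> \<le> \<tau> \<omega>" for \<omega> using \<tau>1 by simp
    fix \<omega> assume w: "\<omega> \<in> space M - Q"
    show "\<bar>V (\<tau> \<omega>) \<omega> - V (s \<omega>) \<omega>\<bar> \<le> 2 * \<theta>" by (rule jump) (use \<theta>(2)[OF w] in \<open>auto simp: st_def\<close>)
    show "\<bar>V' (\<tau> \<omega>) \<omega> - V' (s \<omega>) \<omega>\<bar> \<le> 2 * \<theta>" by (rule jump) (use \<theta>(3)[OF w] in \<open>auto simp: st_def\<close>)
  qed
  have [measurable]: "(\<lambda>\<omega>. \<xi> (\<tau> \<omega>) \<omega>) \<in> borel_measurable M" "(\<lambda>\<omega>. \<xi> (s \<omega>) \<omega>) \<in> borel_measurable M"
    by (rule sampled_measurable[OF \<tau> \<tau>m] sampled_measurable[OF s sm], rule measurable_G[OF \<xi>m])+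
  define E1 where "E1 = {\<omega> \<in> space M. r\<^sup>2 \<le> (\<xi> (\<tau> \<omega>) \<omega> - \<xi> (s \<omega>) \<omega>)\<^sup>2}"
  have E1: "E1 \<in> sets M" unfolding E1_def by measurable
  have "integrable M (\<lambda>\<omega>. (\<xi> (\<tau> \<omega>) \<omega> - \<xi> (s \<omega>) \<omega>)\<^sup>2)"
  proof (rule integrable_const_bound[of _ "(C + C)\<^sup>2"])
    show "AE \<omega> in M. norm ((\<xi> (\<tau> \<omega>) \<omega> - \<xi> (s \<omega>) \<omega>)\<^sup>2) \<le> (C + C)\<^sup>2"
    proof (rule AE_I2)
      fix \<omega>
      have "\<bar>\<xi> (\<tau> \<omega>) \<omega> - \<xi> (s \<omega>) \<omega>\<bar> \<le> C + C"
        using \<xi>C[of "\<tau> \<omega>" \<omega>] \<xi>C[of "s \<omega>" \<omega>] by linarith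
      then show "norm ((\<xi> (\<tau> \<omega>) \<omega> - \<xi> (s \<omega>) \<omega>)\<^sup>2) \<le> (C + C)\<^sup>2"
        using power_mono[of "\<bar>\<xi> (\<tau> \<omega>) \<omega> - \<xi> (s \<omega>) \<omega>\<bar>" "C + C" 2] by simp
    qed
  qed measurable
  then have "prob E1 \<le> (\<integral>\<omega>. (\<xi> (\<tau> \<omega>) \<omega> - \<xi> (s \<omega>) \<omega>)\<^sup>2 \<partial>M) / r\<^sup>2"
    unfolding E1_def using r by (intro integral_Markov_inequality_measure[of _ _ "{}"]) auto
  also have "\<dots> \<le> (1 + 2 * C) * (2 * \<theta> + 8 * \<epsilon>) / r\<^sup>2"
    by (rule divide_right_mono[OF sec]) simp
  finally have P1: "prob E1 \<le> (1 + 2 * C) * (2 * \<theta> + 8 * \<epsilon>) / r\<^sup>2" .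
  show thesis
  proof (rule that[of "E1 \<union> W"])
    show "E1 \<union> W \<in> sets M" using E1 W by simp
    show "prob (E1 \<union> W) \<le> (1 + 2 * C) * (2 * \<theta> + 8 * \<epsilon>) / r\<^sup>2 + prob W"
      using measure_Un_le[OF E1 W] P1 by linarith
    fix \<omega> j assume w: "\<omega> \<in> space M" and j: "\<sigma> \<omega> \<le> j" "j \<le> \<sigma> \<omega> + l" "j \<le> m" and big: "r \<le> \<bar>\<xi> j \<omega> - \<xi> (\<sigma> \<omega>) \<omega>\<bar>"
    have s\<sigma>: "s \<omega> = \<sigma> \<omega>" using j by (simp add: s_def)
    show "\<omega> \<in> E1 \<union> W"
    proof (cases "\<omega> \<in> W")
      case False
      \<comment> \<open>Off \<open>W\<close> the drift cannot have caused the stop. So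
        \<open>\<tau>\<close> is either a time where \<open>\<xi>\<close> has moved by
        \<open>r\<close> or the end of the window, and in the latter case it equals
        \<open>j\<close>, where \<open>\<xi>\<close> has moved by \<open>r\<close> too.\<close>
      have "\<tau> \<omega> \<le> j" using \<tau>2[of \<omega> j] j(1) big by (simp add: s\<sigma> st_def)
      have "\<bar>V (\<tau> \<omega>) \<omega> - V (s \<omega>) \<omega>\<bar> \<le> \<theta> \<and> \<bar>V' (\<tau> \<omega>) \<omega> - V' (s \<omega>) \<omega>\<bar> \<le> \<theta>"
        by (rule VW) (use w False \<tau>1[of \<omega>] \<tau>l[of \<omega>] in auto)
      then have "\<tau> \<omega> = min (s \<omega> + l) m \<or> r \<le> \<bar>\<xi> (\<tau> \<omega>) \<omega> - \<xi> (s \<omega>) \<omega>\<bar>"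
        using \<tau>1[of \<omega>] by (auto simp: st_def)
      moreover have "j = \<tau> \<omega>" if "\<tau> \<omega> = min (s \<omega> + l) m" using that \<open>\<tau> \<omega> \<le> j\<close> j s\<sigma> by simp
      ultimately have "r \<le> \<bar>\<xi> (\<tau> \<omega>) \<omega> - \<xi> (s \<omega>) \<omega>\<bar>" using big s\<sigma> by auto
      then have "r\<^sup>2 \<le> \<bar>\<xi> (\<tau> \<omega>) \<omega> - \<xi> (s \<omega>) \<omega>\<bar>\<^sup>2" using r by (intro power_mono) auto
      then show ?thesis using w by (simp add: E1_def)
    qed simp
  qed
qed

end

section \<open>Successive jump times on a grid\<close>

context discrete_filtration
begin

text \<open>The default \<open>i + m + 1\<close> lies beyond the horizon, keeps the sequence
  strictly increasing, and leaves a spacing of \<open>m + 1\<close> grid steps, so that fictitious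
  jumps also meet the constraints of \<open>step_data\<close>.\<close>

definition next_jump :: "(nat \<Rightarrow> 'a \<Rightarrow> real) \<Rightarrow> real \<Rightarrow> 'a \<Rightarrow> nat \<Rightarrow> nat" where
  "next_jump \<xi> r \<omega> i =
     (if \<exists>j. i < j \<and> j \<le> m \<and> r \<le> \<bar>\<xi> j \<omega> - \<xi> i \<omega>\<bar> then LEAST j. i < j \<and> j \<le> m \<and> r \<le> \<bar>\<xi> j \<omega> - \<xi> i \<omega>\<bar>
      else i + m + 1)"

definition jump :: "(nat \<Rightarrow> 'a \<Rightarrow> real) \<Rightarrow> real \<Rightarrow> nat \<Rightarrow> 'a \<Rightarrow> nat" where
  "jump \<xi> r k \<omega> = (next_jump \<xi> r \<omega> ^^ k) 0"

lemma jump_0 [simp]: "jump \<xi> r 0 \<omega> = 0"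
  and jump_Suc: "jump \<xi> r (Suc k) \<omega> = next_jump \<xi> r \<omega> (jump \<xi> r k \<omega>)"
  by (simp_all add: jump_def)

lemma next_jump_cases:
  obtains "i < next_jump \<xi> r \<omega> i" "next_jump \<xi> r \<omega> i \<le> m" "r \<le> \<bar>\<xi> (next_jump \<xi> r \<omega> i) \<omega> - \<xi> i \<omega>\<bar>"
    "\<And>j. i < j \<Longrightarrow> j < next_jump \<xi> r \<omega> i \<Longrightarrow> \<bar>\<xi> j \<omega> - \<xi> i \<omega>\<bar> < r"
  | "next_jump \<xi> r \<omega> i = i + m + 1" "\<And>j. i < j \<Longrightarrow> j \<le> m \<Longrightarrow> \<bar>\<xi> j \<omega> - \<xi> i \<omega>\<bar> < r"
proof (cases "\<exists>j. i < j \<and> j \<le> m \<and> r \<le> \<bar>\<xi> j \<omega> - \<xi> i \<omega>\<bar>")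
  case True
  then have eq: "next_jump \<xi> r \<omega> i = (LEAST j. i < j \<and> j \<le> m \<and> r \<le> \<bar>\<xi> j \<omega> - \<xi> i \<omega>\<bar>)" by (simp add: next_jump_def)
  have "i < next_jump \<xi> r \<omega> i \<and> next_jump \<xi> r \<omega> i \<le> m \<and> r \<le> \<bar>\<xi> (next_jump \<xi> r \<omega> i) \<omega> - \<xi> i \<omega>\<bar>"
    unfolding eq using True by (rule LeastI_ex)
  moreover have "\<bar>\<xi> j \<omega> - \<xi> i \<omega>\<bar> < r" if "i < j" "j < next_jump \<xi> r \<omega> i" for j
    using not_less_Least[of j "\<lambda>j. i < j \<and> j \<le> m \<and> r \<le> \<bar>\<xi> j \<omega> - \<xi> i \<omega>\<bar>"] that calculation
    unfolding eq by auto
  ultimately show thesis using that(1) by blast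
next
  case False
  then have "next_jump \<xi> r \<omega> i = i + m + 1" by (simp only: next_jump_def if_False)
  with False show thesis using that(2) by (meson not_le)
qed

lemma next_jump_greater: "i < next_jump \<xi> r \<omega> i"
  by (rule next_jump_cases[of i \<xi> r \<omega>]) auto

lemma jump_mono: "k \<le> l \<Longrightarrow> jump \<xi> r k \<omega> \<le> jump \<xi> r l \<omega>"
  by (rule lift_Suc_mono_le[of "\<lambda>k. jump \<xi> r k \<omega>"]) (simp_all add: jump_Suc next_jump_greater less_imp_le)

text \<open>Up to the horizon, the event depends only on values up to time \<open>j\<close>, which
  makes jump times stopping times. The default value beyond the horizon carries knowledge of the
  whole path, hence the restriction to \<open>j \<le> m\<close>.\<close>

lemma next_jump_eq_iff:
  assumes "j \<le> m"
  shows "next_jump \<xi> r \<omega> i = j \<longleftrightarrow> i < j \<and> r \<le> \<bar>\<xi> j \<omega> - \<xi> i \<omega>\<bar> \<and> (\<forall>k\<in>{i<..<j}. \<bar>\<xi> k \<omega> - \<xi> i \<omega>\<bar> < r)"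
proof (cases rule: next_jump_cases[of i \<xi> r \<omega>])
  case 1
  show ?thesis
  proof
    assume "next_jump \<xi> r \<omega> i = j"
    then show "i < j \<and> r \<le> \<bar>\<xi> j \<omega> - \<xi> i \<omega>\<bar> \<and> (\<forall>k\<in>{i<..<j}. \<bar>\<xi> k \<omega> - \<xi> i \<omega>\<bar> < r)" using 1 by auto
  next
    assume R: "i < j \<and> r \<le> \<bar>\<xi> j \<omega> - \<xi> i \<omega>\<bar> \<and> (\<forall>k\<in>{i<..<j}. \<bar>\<xi> k \<omega> - \<xi> i \<omega>\<bar> < r)"
    have "\<not> j < next_jump \<xi> r \<omega> i" using R 1(4)[of j] by auto
    moreover have "\<not> next_jump \<xi> r \<omega> i < j" using R 1(1,3) by (meson greaterThanLessThan_iff not_le)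
    ultimately show "next_jump \<xi> r \<omega> i = j" by simp
  qed
next
  case 2
  then show ?thesis using assms by (metis add_leD2 not_add_less2 not_le le_add2 less_Suc_eq_le Suc_eq_plus1 not_less_eq_eq)
qed

lemma jump_stopping:
  assumes \<xi>m: "\<And>j. \<xi> j \<in> borel_measurable (G j)"
  shows "stopping (jump \<xi> r k)"
proof (induction k)
  case 0
  then show ?case by (simp add: stopping_def)
next
  case (Suc k)
  show ?case unfolding stopping_def
  proof (intro allI impI)
    fix j assume j: "j \<le> m"
    have "(jump \<xi> r (Suc k) \<omega> = j) = (\<exists>i\<in>{..<j}. jump \<xi> r k \<omega> = i \<and> r \<le> \<bar>\<xi> j \<omega> - \<xi> i \<omega>\<bar> \<and>
        (\<forall>k\<in>{i<..<j}. \<bar>\<xi> k \<omega> - \<xi> i \<omega>\<bar> < r))" for \<omega>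
      unfolding jump_Suc next_jump_eq_iff[OF j] by auto
    moreover have "Measurable.pred (G j) (\<lambda>\<omega>. \<exists>i\<in>{..<j}. jump \<xi> r k \<omega> = i \<and> r \<le> \<bar>\<xi> j \<omega> - \<xi> i \<omega>\<bar> \<and>
        (\<forall>k\<in>{i<..<j}. \<bar>\<xi> k \<omega> - \<xi> i \<omega>\<bar> < r))"
    proof (intro pred_intros_logic pred_intros_finite finite_lessThan finite_greaterThanLessThan)
      fix i assume i: "i \<in> {..<j}"
      then show "Measurable.pred (G j) (\<lambda>\<omega>. jump \<xi> r k \<omega> = i)"
        using Suc j by (intro measurable_G_mono[of "\<lambda>\<omega>. jump \<xi> r k \<omega> = i" i _ j]) (auto simp: stopping_def)
      have [measurable]: "\<xi> n \<in> borel_measurable (G j)" if "n \<le> j" for n by (rule measurable_G_mono[OF \<xi>m that])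
      have [measurable]: "\<xi> i \<in> borel_measurable (G j)" "\<xi> j \<in> borel_measurable (G j)" using i \<xi>m by (auto intro: measurable_G_mono[OF \<xi>m])
      show "Measurable.pred (G j) (\<lambda>\<omega>. r \<le> \<bar>\<xi> j \<omega> - \<xi> i \<omega>\<bar>)" by measurable
      fix n assume "n \<in> {i<..<j}"
      then have [measurable]: "\<xi> n \<in> borel_measurable (G j)" by (auto intro: measurable_G_mono[OF \<xi>m])
      show "Measurable.pred (G j) (\<lambda>\<omega>. \<bar>\<xi> n \<omega> - \<xi> i \<omega>\<bar> < r)" by measurable
    qed
    ultimately show "Measurable.pred (G j) (\<lambda>\<omega>. jump \<xi> r (Suc k) \<omega> = j)" by simp
  qed
qed

definition short_gap :: "(nat \<Rightarrow> 'a \<Rightarrow> real) \<Rightarrow> real \<Rightarrow> nat \<Rightarrow> nat \<Rightarrow> 'a set" where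
  "short_gap \<xi> r l k = {\<omega> \<in> space M. jump \<xi> r (Suc k) \<omega> \<le> m \<and> jump \<xi> r (Suc k) \<omega> \<le> jump \<xi> r k \<omega> + l}"

lemma short_gap_sets:
  assumes \<xi>m: "\<And>j. \<xi> j \<in> borel_measurable (G j)"
  shows "{\<omega> \<in> space M. jump \<xi> r k \<omega> \<le> m} \<in> sets M" "short_gap \<xi> r l k \<in> sets M"
proof -
  have J: "Measurable.pred M (\<lambda>\<omega>. jump \<xi> r k \<omega> = j)" if "j \<le> m" for j k
    using jump_stopping[OF \<xi>m, of r k] that by (auto simp: stopping_def intro: measurable_G)
  have "(jump \<xi> r k \<omega> \<le> m) = (\<exists>j\<in>{..m}. jump \<xi> r k \<omega> = j)" for \<omega> by auto
  moreover have "Measurable.pred M (\<lambda>\<omega>. \<exists>j\<in>{..m}. jump \<xi> r k \<omega> = j)"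
    by (intro pred_intros_finite finite_atMost J) auto
  ultimately show "{\<omega> \<in> space M. jump \<xi> r k \<omega> \<le> m} \<in> sets M" by (simp add: pred_def)
  have "(jump \<xi> r (Suc k) \<omega> \<le> m \<and> jump \<xi> r (Suc k) \<omega> \<le> jump \<xi> r k \<omega> + l) =
    (\<exists>j\<in>{..m}. \<exists>i\<in>{..m}. jump \<xi> r (Suc k) \<omega> = j \<and> jump \<xi> r k \<omega> = i \<and> j \<le> i + l)" for \<omega>
    using jump_mono[of k "Suc k" \<xi> r \<omega>] by auto
  moreover have "Measurable.pred M (\<lambda>\<omega>. \<exists>j\<in>{..m}. \<exists>i\<in>{..m}. jump \<xi> r (Suc k) \<omega> = j \<and> jump \<xi> r k \<omega> = i \<and> j \<le> i + l)"
    by (intro pred_intros_finite finite_atMost pred_intros_logic J) auto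
  ultimately show "short_gap \<xi> r l k \<in> sets M" by (simp add: pred_def short_gap_def)
qed

text \<open>Aldous's counting argument: if gaps up to \<open>l0\<close> are rare, there are at most \<open>q\<close> jumps up to
  the horizon with high probability, so that only \<open>q\<close> gaps have to be controlled at the finer scale.\<close>

lemma prob_short_gap:
  assumes \<xi>m: "\<And>j. \<xi> j \<in> borel_measurable (G j)"
    and P0: "\<And>k. prob (short_gap \<xi> r l0 k) \<le> \<eta>" and q: "0 < q" "2 * m \<le> q * (l0 + 1)"
    and P1: "\<And>k. prob (short_gap \<xi> r l1 k) \<le> \<eta> / real q"
  shows "(\<Union>k. short_gap \<xi> r l1 k) \<in> sets M" "prob (\<Union>k. short_gap \<xi> r l1 k) \<le> 3 * \<eta>"
proof -
  define F where "F = {\<omega> \<in> space M. jump \<xi> r q \<omega> \<le> m}"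
  note F = short_gap_sets(1)[OF \<xi>m, of r q, folded F_def]
  note S = short_gap_sets(2)[OF \<xi>m, of r]
  \<comment> \<open>Each of the first \<open>n\<close> gaps either advances the jump time by at
    least \<open>l0 + 1\<close> or is counted as short.\<close>
  have count: "n * (l0 + 1) \<le> jump \<xi> r n \<omega> + (l0 + 1) * (\<Sum>k<n. of_bool (\<omega> \<in> short_gap \<xi> r l0 k))"
    if "\<omega> \<in> space M" "jump \<xi> r n \<omega> \<le> m" for n \<omega>
    using that(2)
  proof (induction n)
    case 0 then show ?case by simp
  next
    case (Suc n)
    have le: "jump \<xi> r n \<omega> \<le> jump \<xi> r (Suc n) \<omega>" by (rule jump_mono) simp
    then have IH: "n * (l0 + 1) \<le> jump \<xi> r n \<omega> + (l0 + 1) * (\<Sum>k<n. of_bool (\<omega> \<in> short_gap \<xi> r l0 k))"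
      using Suc by simp
    show ?case
    proof (cases "\<omega> \<in> short_gap \<xi> r l0 n")
      case True
      then show ?thesis using IH le by simp
    next
      case False
      then have "jump \<xi> r n \<omega> + l0 < jump \<xi> r (Suc n) \<omega>"
        using Suc.prems that(1) by (auto simp: short_gap_def not_le)
      then show ?thesis using IH False by simp
    qed
  qed
  \<comment> \<open>If the \<open>q\<close>-th jump lies within the horizon, then
    \<open>2 * m \<le> q * (l0 + 1)\<close> forces at least half of the first \<open>q\<close> gaps
    to be short; their expected number is at most \<open>q * \<eta>\<close>.\<close>
  have "real q / 2 * prob F \<le> real q * \<eta>"
  proof -
    have "(\<integral>\<omega>. real q / 2 * indicator F \<omega> \<partial>M) \<le> (\<integral>\<omega>. (\<Sum>k<q. indicator (short_gap \<xi> r l0 k) \<omega>) \<partial>M)"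
    proof (rule integral_mono)
      show "integrable M (\<lambda>\<omega>. real q / 2 * indicator F \<omega>)" using F by (auto simp: emeasure_eq_measure)
      show "integrable M (\<lambda>\<omega>. \<Sum>k<q. indicator (short_gap \<xi> r l0 k) \<omega> :: real)"
        using S by (intro Bochner_Integration.integrable_sum) (auto simp: emeasure_eq_measure)
      fix \<omega>
      show "real q / 2 * indicator F \<omega> \<le> (\<Sum>k<q. indicator (short_gap \<xi> r l0 k) \<omega>)"
      proof (cases "\<omega> \<in> F")
        case True
        define n where "n = (\<Sum>k<q. of_bool (\<omega> \<in> short_gap \<xi> r l0 k) :: nat)"
        have "q * (l0 + 1) \<le> m + (l0 + 1) * n" using count[of \<omega> q] True by (simp add: F_def n_def)
        then have "2 * (q * (l0 + 1)) \<le> q * (l0 + 1) + 2 * ((l0 + 1) * n)" using q(2) by linarith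
        then have "(l0 + 1) * q \<le> (l0 + 1) * (2 * n)" by (simp add: algebra_simps)
        then have "q \<le> 2 * n" by (subst (asm) mult_le_cancel1) simp
        moreover have "real n = (\<Sum>k<q. indicator (short_gap \<xi> r l0 k) \<omega>)"
          by (simp add: n_def indicator_def)
        ultimately show ?thesis using True by simp
      qed (simp add: sum_nonneg)
    qed
    also have "\<dots> = (\<Sum>k<q. prob (short_gap \<xi> r l0 k))"
      using S by (subst Bochner_Integration.integral_sum) (auto simp: emeasure_eq_measure)
    also have "\<dots> \<le> (\<Sum>k<q. \<eta>)" by (intro sum_mono P0)
    finally show ?thesis using F by simp
  qed
  then have PF: "prob F \<le> 2 * \<eta>" using q(1) by (simp add: field_simps)
  show U: "(\<Union>k. short_gap \<xi> r l1 k) \<in> sets M" using S by auto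
  have "(\<Union>k. short_gap \<xi> r l1 k) \<subseteq> F \<union> (\<Union>k<q. short_gap \<xi> r l1 k)"
  proof
    fix \<omega> assume "\<omega> \<in> (\<Union>k. short_gap \<xi> r l1 k)"
    then obtain k where k: "\<omega> \<in> short_gap \<xi> r l1 k" by blast
    show "\<omega> \<in> F \<union> (\<Union>k<q. short_gap \<xi> r l1 k)"
    proof (cases "k < q")
      case False
      then show ?thesis using k jump_mono[of q "Suc k" \<xi> r \<omega>] by (simp add: F_def short_gap_def)
    qed (use k in auto)
  qed
  then have "prob (\<Union>k. short_gap \<xi> r l1 k) \<le> prob (F \<union> (\<Union>k<q. short_gap \<xi> r l1 k))"
    using F S by (intro finite_measure_mono) auto
  also have "\<dots> \<le> prob F + prob (\<Union>k<q. short_gap \<xi> r l1 k)"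
    using F S by (intro measure_Un_le) auto
  also have "prob (\<Union>k<q. short_gap \<xi> r l1 k) \<le> (\<Sum>k<q. prob (short_gap \<xi> r l1 k))"
    using S by (intro measure_UNION_le) auto
  also have "\<dots> \<le> (\<Sum>k<q. \<eta> / real q)" by (intro sum_mono P1)
  also have "\<dots> = \<eta>" using q(1) by simp
  finally show "prob (\<Union>k. short_gap \<xi> r l1 k) \<le> 3 * \<eta>" using PF by simp
qed

text \<open>The jump times of the path and its values there are the step data. A fictitious jump
  advances time by \<open>H + h\<close>, which is where the bound \<open>H + 1\<close> on the
  spacing originates.\<close>

lemma jump_step_data:
  assumes \<xi>C: "\<And>j. \<bar>\<xi> j \<omega>\<bar> \<le> C" and w: "\<omega> \<in> space M" and gap: "\<And>k. \<omega> \<notin> short_gap \<xi> r l k"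
    and h: "0 < h" "h \<le> 1" "real m * h = H" and \<delta>: "\<delta> \<le> (real l + 1) * h" "\<delta> \<le> H"
  defines "p \<equiv> \<lambda>k. (real (jump \<xi> r k \<omega>) * h, \<xi> (jump \<xi> r k \<omega>) \<omega>)"
  shows "p \<in> step_data \<delta> H C"
    and "\<And>k j. fst (p k) < real j * h \<Longrightarrow> real j * h < fst (p (Suc k)) \<Longrightarrow> real j * h < H \<Longrightarrow> \<bar>\<xi> j \<omega> - snd (p k)\<bar> \<le> r"
proof -
  have step: "real (jump \<xi> r k \<omega>) * h + \<delta> \<le> real (jump \<xi> r (Suc k) \<omega>) * h \<and>
      real (jump \<xi> r (Suc k) \<omega>) * h \<le> real (jump \<xi> r k \<omega>) * h + H + 1" for k
  proof (rule next_jump_cases[of "jump \<xi> r k \<omega>" \<xi> r \<omega>], goal_cases)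
    case 1
    then have "jump \<xi> r k \<omega> + l + 1 \<le> jump \<xi> r (Suc k) \<omega>"
      using gap[of k] w by (auto simp: short_gap_def jump_Suc)
    then have "real (jump \<xi> r k \<omega>) + (real l + 1) \<le> real (jump \<xi> r (Suc k) \<omega>)" by linarith
    from mult_right_mono[OF this, of h] have "real (jump \<xi> r k \<omega>) * h + (real l + 1) * h \<le> real (jump \<xi> r (Suc k) \<omega>) * h"
      using h by (simp add: algebra_simps)
    moreover have "real (jump \<xi> r (Suc k) \<omega>) * h \<le> H"
      unfolding h(3)[symmetric] using 1 h by (intro mult_right_mono) (auto simp: jump_Suc)
    moreover have "0 \<le> real (jump \<xi> r k \<omega>) * h" using h by simp
    ultimately show ?thesis using \<delta> by linarith
  next
    case 2
    then have "real (jump \<xi> r (Suc k) \<omega>) * h = real (jump \<xi> r k \<omega>) * h + H + h"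
      by (simp add: jump_Suc algebra_simps h(3)[symmetric])
    then show ?thesis using \<delta> h by linarith
  qed
  then show "p \<in> step_data \<delta> H C" using \<xi>C by (simp add: step_data_def p_def)
  fix k j assume j: "fst (p k) < real j * h" "real j * h < fst (p (Suc k))" "real j * h < H"
  have "real (jump \<xi> r k \<omega>) * h < real j * h" "real j * h < real (jump \<xi> r (Suc k) \<omega>) * h" "real j * h < real m * h"
    using j unfolding p_def h(3) by simp_all
  then have J: "jump \<xi> r k \<omega> < j" "j < next_jump \<xi> r \<omega> (jump \<xi> r k \<omega>)" "j < m"
    using h(1) by (simp_all add: jump_Suc)
  have "\<bar>\<xi> j \<omega> - \<xi> (jump \<xi> r k \<omega>) \<omega>\<bar> < r"
    by (rule next_jump_cases[of "jump \<xi> r k \<omega>" \<xi> r \<omega>]) (use J in auto)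
  then show "\<bar>\<xi> j \<omega> - snd (p k)\<bar> \<le> r" by (simp add: p_def)
qed

end

subsection \<open>Tightness\<close>

lemma progressive_adapted:
  assumes "progressive F Y" "0 \<le> t" shows "Y t \<in> borel_measurable (F t)"
proof -
  have "(\<lambda>\<omega>. (t, \<omega>)) \<in> F t \<rightarrow>\<^sub>M restrict_space borel {0..t} \<Otimes>\<^sub>M F t"
    using assms(2) by (intro measurable_Pair1') (simp add: space_restrict_space)
  moreover have "(\<lambda>(s, \<omega>). Y s \<omega>) \<in> borel_measurable (restrict_space borel {0..t} \<Otimes>\<^sub>M F t)"
    using assms unfolding progressive_def by blast
  ultimately have "(\<lambda>\<omega>. (\<lambda>(s, \<omega>). Y s \<omega>) (t, \<omega>)) \<in> borel_measurable (F t)" by (rule measurable_compose)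
  then show ?thesis by simp
qed

lemma martingale_test_integral:
  assumes "prob_space M" "filtered M F" "martingale M F N" "0 \<le> s" "s \<le> t"
    and H: "H \<in> borel_measurable (F s)" "\<And>\<omega>. \<omega> \<in> space M \<Longrightarrow> \<bar>H \<omega>\<bar> \<le> c"
  shows "(\<integral>\<omega>. H \<omega> * N t \<omega> \<partial>M) = (\<integral>\<omega>. H \<omega> * N s \<omega> \<partial>M)"
proof -
  interpret prob_space M by fact
  have sub: "subalgebra M (F s)" using assms(2,4) by (simp add: filtered_def)
  interpret S: sigma_finite_subalgebra M "F s"
    by (intro finite_measure_subalgebra_is_sigma_finite finite_measure_subalgebra.intro
        finite_measure_subalgebra_axioms.intro sub finite_measure_axioms)
  have Hm: "H \<in> borel_measurable M" by (rule measurable_from_subalg[OF sub H(1)])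
  have Ni: "integrable M (N t)" using assms(3-5) by (simp add: martingale_def)
  have "integrable M (\<lambda>\<omega>. H \<omega> * N t \<omega>)"
  proof (rule Bochner_Integration.integrable_bound)
    show "integrable M (\<lambda>\<omega>. c * N t \<omega>)" using Ni by simp
    show "(\<lambda>\<omega>. H \<omega> * N t \<omega>) \<in> borel_measurable M" using Hm Ni by (intro borel_measurable_times) auto
    show "AE \<omega> in M. norm (H \<omega> * N t \<omega>) \<le> norm (c * N t \<omega>)"
      using H(2) by (intro AE_I2) (auto simp: abs_mult intro!: mult_right_mono order_trans[OF H(2) abs_ge_self])
  qed
  then have "(\<integral>\<omega>. H \<omega> * N t \<omega> \<partial>M) = (\<integral>\<omega>. H \<omega> * real_cond_exp M (F s) (N t) \<omega> \<partial>M)"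
    using S.real_cond_exp_intg(2)[OF _ H(1), of "N t"] Ni by simp
  also have "\<dots> = (\<integral>\<omega>. H \<omega> * N s \<omega> \<partial>M)"
  proof (rule integral_cong_AE)
    have "N s \<in> borel_measurable (F s)" using assms(3,4) by (auto simp: martingale_def adapted_def)
    then have "N s \<in> borel_measurable M" by (rule measurable_from_subalg[OF sub])
    then show "(\<lambda>\<omega>. H \<omega> * N s \<omega>) \<in> borel_measurable M" using Hm by measurable
    have "real_cond_exp M (F s) (N t) \<in> borel_measurable M"
      by (rule measurable_from_subalg[OF sub]) simp
    then show "(\<lambda>\<omega>. H \<omega> * real_cond_exp M (F s) (N t) \<omega>) \<in> borel_measurable M" using Hm by measurable
    have "AE \<omega> in M. real_cond_exp M (F s) (N t) \<omega> = N s \<omega>" using assms(3-5) by (simp add: martingale_def)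
    then show "AE \<omega> in M. H \<omega> * real_cond_exp M (F s) (N t) \<omega> = H \<omega> * N s \<omega>" by eventually_elim simp
  qed
  finally show ?thesis .
qed

text \<open>Stated for every \<open>L\<close> above the threshold so that the two martingales of one
  index can share one \<open>L\<close>.\<close>

lemma tail_integral_small:
  fixes f :: "'a \<Rightarrow> real"
  assumes f: "integrable M f" and "0 < e"
  obtains K where "0 \<le> K" "\<And>L. K \<le> L \<Longrightarrow> (\<integral>\<omega>. max 0 (\<bar>f \<omega>\<bar> - L) \<partial>M) \<le> e"
proof -
  have [measurable]: "f \<in> borel_measurable M" using f by simp
  have "(\<lambda>n. \<integral>\<omega>. max 0 (\<bar>f \<omega>\<bar> - real n) \<partial>M) \<longlonglongrightarrow> (\<integral>\<omega>. 0 \<partial>M)"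
  proof (rule integral_dominated_convergence[where w="\<lambda>\<omega>. \<bar>f \<omega>\<bar>"])
    show "AE \<omega> in M. (\<lambda>n. max 0 (\<bar>f \<omega>\<bar> - real n)) \<longlonglongrightarrow> 0"
    proof (rule AE_I2, rule tendsto_eventually)
      fix \<omega>
      obtain k :: nat where "\<bar>f \<omega>\<bar> \<le> real k" using real_arch_simple by blast
      then show "\<forall>\<^sub>F n in sequentially. max 0 (\<bar>f \<omega>\<bar> - real n) = 0"
        unfolding eventually_sequentially by (intro exI[of _ k]) auto
    qed
  qed (use f in auto)
  then have "\<forall>\<^sub>F n in sequentially. (\<integral>\<omega>. max 0 (\<bar>f \<omega>\<bar> - real n) \<partial>M) < e"
    using \<open>0 < e\<close> by (intro order_tendstoD(2)) auto
  then obtain n where n: "(\<integral>\<omega>. max 0 (\<bar>f \<omega>\<bar> - real n) \<partial>M) < e"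
    unfolding eventually_sequentially by blast
  have "(\<integral>\<omega>. max 0 (\<bar>f \<omega>\<bar> - L) \<partial>M) \<le> (\<integral>\<omega>. max 0 (\<bar>f \<omega>\<bar> - real n) \<partial>M)" if "real n \<le> L" for L
  proof (rule integral_mono)
    have "integrable M (\<lambda>\<omega>. max 0 (\<bar>f \<omega>\<bar> - c))" if "0 \<le> c" for c
      by (rule Bochner_Integration.integrable_bound[OF f]) (use that in auto)
    then show "integrable M (\<lambda>\<omega>. max 0 (\<bar>f \<omega>\<bar> - L))" "integrable M (\<lambda>\<omega>. max 0 (\<bar>f \<omega>\<bar> - real n))"
      using that by auto
  qed (use that in auto)
  then show thesis using n that[of "real n"] by fastforce
qed

text \<open>Dyadic times are rational, so the maximum over a grid is dominated by the supremum in
  the hypothesis; being a finite maximum it is measurable.\<close>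

lemma max_deviation_integral:
  fixes Y g :: "real \<Rightarrow> 'a \<Rightarrow> real" and n N :: nat
  assumes ms: "\<forall>t\<ge>0. Y t \<in> borel_measurable M" "\<forall>t\<ge>0. g t \<in> borel_measurable M"
    and bound: "(\<integral>\<^sup>+\<omega>. (SUP t\<in>{0..real N} \<inter> \<rat>. ennreal \<bar>Y t \<omega> - g t \<omega>\<bar>) \<partial>M) \<le> ennreal \<epsilon>" and "0 \<le> \<epsilon>"
  defines "D \<equiv> \<lambda>\<omega>. Max ((\<lambda>j. \<bar>Y (real j / 2 ^ n) \<omega> - g (real j / 2 ^ n) \<omega>\<bar>) ` {..N * 2 ^ n})"
  shows "integrable M D" "(\<integral>\<omega>. D \<omega> \<partial>M) \<le> \<epsilon>" "\<And>j \<omega>. j \<le> N * 2 ^ n \<Longrightarrow> \<bar>Y (real j / 2 ^ n) \<omega> - g (real j / 2 ^ n) \<omega>\<bar> \<le> D \<omega>"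
proof -
  show le: "\<bar>Y (real j / 2 ^ n) \<omega> - g (real j / 2 ^ n) \<omega>\<bar> \<le> D \<omega>" if "j \<le> N * 2 ^ n" for j \<omega>
    unfolding D_def by (rule Max_ge) (use that in auto)
  have D0: "0 \<le> D \<omega>" for \<omega> using le[of 0 \<omega>] by simp
  have Dm: "D \<in> borel_measurable M" unfolding D_def
    by (intro borel_measurable_Max borel_measurable_abs borel_measurable_diff) (use ms in auto)
  have "ennreal (D \<omega>) \<le> (SUP t\<in>{0..real N} \<inter> \<rat>. ennreal \<bar>Y t \<omega> - g t \<omega>\<bar>)" for \<omega>
  proof -
    have "D \<omega> \<in> (\<lambda>j. \<bar>Y (real j / 2 ^ n) \<omega> - g (real j / 2 ^ n) \<omega>\<bar>) ` {..N * 2 ^ n}"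
      unfolding D_def by (rule Max_in) auto
    then obtain j where j: "j \<le> N * 2 ^ n" "D \<omega> = \<bar>Y (real j / 2 ^ n) \<omega> - g (real j / 2 ^ n) \<omega>\<bar>" by auto
    have "real j \<le> real (N * 2 ^ n)" using j(1) by (rule of_nat_mono)
    then have "real j / 2 ^ n \<le> real N" by (simp add: field_simps)
    moreover have "real j / 2 ^ n \<in> \<rat>" by simp
    ultimately show ?thesis unfolding j(2) by (intro SUP_upper) auto
  qed
  then have "(\<integral>\<^sup>+\<omega>. ennreal (D \<omega>) \<partial>M) \<le> (\<integral>\<^sup>+\<omega>. (SUP t\<in>{0..real N} \<inter> \<rat>. ennreal \<bar>Y t \<omega> - g t \<omega>\<bar>) \<partial>M)"
    by (intro nn_integral_mono)
  also note bound
  finally have ub: "(\<integral>\<^sup>+\<omega>. ennreal (D \<omega>) \<partial>M) \<le> ennreal \<epsilon>" .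
  show "integrable M D"
    by (rule integrableI_nonneg) (use Dm D0 order_le_less_trans[OF ub] in auto)
  show "(\<integral>\<omega>. D \<omega> \<partial>M) \<le> \<epsilon>"
    using integral_eq_nn_integral[of D M] Dm D0 enn2real_mono[OF ub] \<open>0 \<le> \<epsilon>\<close> by simp
qed

section \<open>From estimates on grids to tightness\<close>

locale approximable_process =
  fixes M :: "'i \<Rightarrow> 'a measure" and F :: "'i \<Rightarrow> real \<Rightarrow> 'a measure" and X :: "'i \<Rightarrow> real \<Rightarrow> 'a \<Rightarrow> 'e::metric_space"
    and A :: "'i \<Rightarrow> real \<Rightarrow> 'a \<Rightarrow> real" and f :: "'e \<Rightarrow> real" and C :: real
  assumes prob: "\<And>i. prob_space (M i)" and filt: "\<And>i. filtered (M i) (F i)" and Xad: "\<And>i. adapted (F i) (X i)"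
    and Xcad: "\<And>i \<omega>. \<omega> \<in> space (M i) \<Longrightarrow> cadlag (\<lambda>t. X i t \<omega>)"
    and Aad: "\<And>i. adapted (F i) (A i)" and Ainc: "\<And>i. increasing_process (M i) (A i)"
    and Alim: "\<And>T. T > 0 \<Longrightarrow>
      ((\<lambda>\<delta>. SUP i. \<integral>\<^sup>+\<omega>. (SUP r\<in>{0..T}. ennreal \<bar>A i (r + \<delta>) \<omega> - A i r \<omega>\<bar>) \<partial>M i) \<longlongrightarrow> 0) (at_right 0)"
    and f: "f \<in> approximable_functions M F X A" and f2: "(\<lambda>x. f x * f x) \<in> approximable_functions M F X A"
    and C: "\<And>x. \<bar>f x\<bar> \<le> C"
begin

lemma C0: "0 \<le> C" using C[of undefined] by simp

definition g :: "'i \<Rightarrow> real \<Rightarrow> 'a \<Rightarrow> real" where "g i t \<omega> = f (X i t \<omega>)"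

lemma f_cont: "continuous_on UNIV f"
  using f by (auto simp: approximable_functions_def bdd_unif_cont_def intro: uniformly_continuous_imp_continuous)

lemma sub: "0 \<le> t \<Longrightarrow> subalgebra (M i) (F i t)"
  using filt[of i] by (simp add: filtered_def)

lemma gF: "0 \<le> t \<Longrightarrow> g i t \<in> borel_measurable (F i t)"
  unfolding g_def[abs_def]
  by (rule measurable_compose[of "X i t" _ borel]) (use Xad[of i] in \<open>auto simp: adapted_def intro: borel_measurable_continuous_onI f_cont\<close>)

lemma gM: "0 \<le> t \<Longrightarrow> g i t \<in> borel_measurable (M i)"
  by (rule measurable_from_subalg[OF sub gF])

lemma g_cadlag:
  assumes "\<omega> \<in> space (M i)" shows "cadlag (\<lambda>t. g i t \<omega>)"
  unfolding cadlag_def g_def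
proof (intro conjI allI impI)
  have ft: "(f \<longlongrightarrow> f l) (nhds l)" for l
    using f_cont by (simp add: continuous_on_eq_continuous_at continuous_at_imp_continuous_within isCont_def tendsto_at_iff_tendsto_nhds)
  fix t :: real
  show "0 \<le> t \<Longrightarrow> ((\<lambda>t. f (X i t \<omega>)) \<longlongrightarrow> f (X i t \<omega>)) (at_right t)"
    by (rule filterlim_compose[OF ft cadlagD_right[OF Xcad[OF assms]]])
  assume "0 < t"
  then obtain l where "((\<lambda>t. X i t \<omega>) \<longlongrightarrow> l) (at_left t)" using cadlagD_left[OF Xcad[OF assms]] by blast
  then show "\<exists>l. ((\<lambda>t. f (X i t \<omega>)) \<longlongrightarrow> l) (at_left t)" using filterlim_compose[OF ft] by blast
qed

lemma grid: "discrete_filtration (M i) (\<lambda>j. F i (real j / 2 ^ n))"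
proof -
  interpret prob_space "M i" by (rule prob)
  show ?thesis
    by unfold_locales (use filt[of i] in \<open>auto simp: filtered_def divide_right_mono\<close>)
qed

lemma grid_martingale:
  assumes YZ: "(Y, Z) \<in> semimartingale_pairs (M i) (F i) (A i)"
  defines "V \<equiv> \<lambda>t \<omega>. LINT s:{0..t}|stieltjes (A i) \<omega>. Z s \<omega>"
  shows "discrete_filtration.is_martingale (M i) (\<lambda>j. F i (real j / 2 ^ n)) (\<lambda>j \<omega>. Y (real j / 2 ^ n) \<omega> - V (real j / 2 ^ n) \<omega>)"
    and "0 \<le> t \<Longrightarrow> Y t \<in> borel_measurable (F i t)" and "0 \<le> t \<Longrightarrow> V t \<in> borel_measurable (F i t)"
    and "0 \<le> t \<Longrightarrow> integrable (M i) (\<lambda>\<omega>. Y t \<omega> - V t \<omega>)"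
proof -
  have mart: "martingale (M i) (F i) (\<lambda>t \<omega>. Y t \<omega> - V t \<omega>)" and prog: "progressive (F i) Y"
    using YZ by (auto simp: semimartingale_pairs_def process_space_def V_def)
  interpret discrete_filtration "M i" "\<lambda>j. F i (real j / 2 ^ n)" by (rule grid)
  show "is_martingale (\<lambda>j \<omega>. Y (real j / 2 ^ n) \<omega> - V (real j / 2 ^ n) \<omega>)"
    unfolding is_martingale_def
  proof (intro conjI allI impI)
    fix k j and H :: "'a \<Rightarrow> real" and c :: real assume "k \<le> j" "H \<in> borel_measurable (F i (real k / 2 ^ n))" "\<forall>\<omega>\<in>space (M i). \<bar>H \<omega>\<bar> \<le> c"
    then show "(\<integral>\<omega>. H \<omega> * (Y (real j / 2 ^ n) \<omega> - V (real j / 2 ^ n) \<omega>) \<partial>M i)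
        = (\<integral>\<omega>. H \<omega> * (Y (real k / 2 ^ n) \<omega> - V (real k / 2 ^ n) \<omega>) \<partial>M i)"
      by (intro martingale_test_integral[OF prob filt mart, where c=c]) (auto simp: divide_right_mono)
  qed (use mart in \<open>auto simp: martingale_def adapted_def\<close>)
  show Y: "Y t \<in> borel_measurable (F i t)" if "0 \<le> t" for t using progressive_adapted[OF prog that] .
  show "V t \<in> borel_measurable (F i t)" if "0 \<le> t"
  proof -
    have "(\<lambda>\<omega>. Y t \<omega> - V t \<omega>) \<in> borel_measurable (F i t)" using mart that by (auto simp: martingale_def adapted_def)
    \<comment> \<open>\<open>V\<close> is a pathwise integral with no measurability of its own at
      hand; it is the difference of two adapted processes.\<close>
    with Y[OF that] have "(\<lambda>\<omega>. Y t \<omega> - (Y t \<omega> - V t \<omega>)) \<in> borel_measurable (F i t)" by (rule borel_measurable_diff)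
    then show ?thesis by simp
  qed
  show "0 \<le> t \<Longrightarrow> integrable (M i) (\<lambda>\<omega>. Y t \<omega> - V t \<omega>)" using mart by (simp add: martingale_def)
qed

definition rare_oscillation :: "nat \<Rightarrow> real \<Rightarrow> real \<Rightarrow> real \<Rightarrow> 'i \<Rightarrow> nat \<Rightarrow> bool" where
  "rare_oscillation N r \<eta> \<delta> i n \<longleftrightarrow> (\<forall>l \<sigma>. real l / 2 ^ n \<le> \<delta> \<longrightarrow>
     discrete_filtration.stopping (\<lambda>j. F i (real j / 2 ^ n)) (N * 2 ^ n) \<sigma> \<longrightarrow>
     holds_outside (M i) \<eta> (\<lambda>\<omega>. \<forall>j. \<sigma> \<omega> \<le> j \<longrightarrow> j \<le> \<sigma> \<omega> + l \<longrightarrow> j \<le> N * 2 ^ n \<longrightarrow>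
       \<bar>g i (real j / 2 ^ n) \<omega> - g i (real (\<sigma> \<omega>) / 2 ^ n) \<omega>\<bar> < r))"

text \<open>\<open>\<delta>\<close> is uniform in \<open>i\<close>, but how fine the grid has to be depends on \<open>i\<close>, through the uniform
  integrability threshold \<open>L\<close>.\<close>

lemma uniform_window_oscillation:
  assumes N: "0 < N" and r: "0 < r" and \<eta>: "0 < \<eta>"
  obtains \<delta> where "0 < \<delta>"
    "\<And>i. \<exists>n0. \<forall>n\<ge>n0. rare_oscillation N r \<eta> \<delta> i n"
proof -
  \<comment> \<open>Used for \<open>\<theta>\<close> as well, so the bound of
    \<open>window_oscillation\<close> contains \<open>2 * \<epsilon> + 8 * \<epsilon>\<close>; the
    20 makes it \<open>\<eta> / 2\<close>, leaving the other half for \<open>W\<close>.\<close>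
  define \<epsilon> where "\<epsilon> = \<eta> * r\<^sup>2 / (20 * (1 + 2 * C))"
  have \<epsilon>: "0 < \<epsilon>" using \<eta> r C0 by (simp add: \<epsilon>_def)
  have small: "(1 + 2 * C) * (2 * \<epsilon> + 8 * \<epsilon>) / r\<^sup>2 = \<eta> / 2"
  proof -
    have "0 < 1 + 2 * C" using C0 by simp
    then have "20 * ((1 + 2 * C) * \<epsilon>) = \<eta> * r\<^sup>2" by (simp add: \<epsilon>_def field_simps)
    then have "(1 + 2 * C) * (2 * \<epsilon> + 8 * \<epsilon>) = \<eta> / 2 * r\<^sup>2" by (simp add: algebra_simps)
    then show ?thesis using r by simp
  qed
  have T: "0 < real N" using N by simp
  obtain Y Z p where YZ: "\<And>i. (Y i, Z i) \<in> semimartingale_pairs (M i) (F i) (A i)"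
    and Y: "(SUP i. \<integral>\<^sup>+\<omega>. (SUP t\<in>{0..real N} \<inter> \<rat>. ennreal \<bar>Y i t \<omega> - f (X i t \<omega>)\<bar>) \<partial>M i) < ennreal \<epsilon>"
    and p: "1 < p" and Z: "(SUP i. \<integral>\<^sup>+\<omega>. lp_norm_pow (stieltjes (A i) \<omega>) p (real N) (\<lambda>t. Z i t \<omega>) \<partial>M i) < \<infinity>"
    using f \<epsilon> T unfolding approximable_functions_def by blast
  obtain Y' Z' p' where YZ': "\<And>i. (Y' i, Z' i) \<in> semimartingale_pairs (M i) (F i) (A i)"
    and Y': "(SUP i. \<integral>\<^sup>+\<omega>. (SUP t\<in>{0..real N} \<inter> \<rat>. ennreal \<bar>Y' i t \<omega> - f (X i t \<omega>) * f (X i t \<omega>)\<bar>) \<partial>M i) < ennreal \<epsilon>"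
    and p': "1 < p'" and Z': "(SUP i. \<integral>\<^sup>+\<omega>. lp_norm_pow (stieltjes (A i) \<omega>) p' (real N) (\<lambda>t. Z' i t \<omega>) \<partial>M i) < \<infinity>"
    using f2 \<epsilon> T unfolding approximable_functions_def by blast
  define V where "V i t \<omega> = (LINT s:{0..t}|stieltjes (A i) \<omega>. Z i s \<omega>)" for i t \<omega>
  define V' where "V' i t \<omega> = (LINT s:{0..t}|stieltjes (A i) \<omega>. Z' i s \<omega>)" for i t \<omega>
  define near where "near d i \<omega> \<longleftrightarrow> windows_le (real N) d \<epsilon> (\<lambda>t. V i t \<omega>) \<and> windows_le (real N) d \<epsilon> (\<lambda>t. V' i t \<omega>)" for d i \<omega>
  have nearD: "\<bar>V i t \<omega> - V i s \<omega>\<bar> \<le> \<epsilon> \<and> \<bar>V' i t \<omega> - V' i s \<omega>\<bar> \<le> \<epsilon>"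
    if "near d i \<omega>" "0 \<le> s" "s \<le> t" "t \<le> s + d" "t \<le> real N" for d i \<omega> s t
    using that(1) windows_leD[OF _ that(2-5)] unfolding near_def by blast
  \<comment> \<open>Used twice: with \<open>\<kappa> = \<eta> / 2\<close> for the window length
    \<open>\<delta>\<close> common to all indices, and with a \<open>\<kappa>\<close> depending on
    the index for the length \<open>d\<close> of a grid step.\<close>
  have windows: "\<exists>d>0. \<forall>i. holds_outside (M i) \<kappa> (near d i)" if "0 < \<kappa>" for \<kappa>
  proof -
    have \<kappa>2: "0 < \<kappa> / 2" using that by simp
    obtain d where d: "0 < d" "\<And>i. holds_outside (M i) (\<kappa> / 2) (\<lambda>\<omega>. windows_le (real N) d \<epsilon> (\<lambda>t. V i t \<omega>))"
      unfolding V_def using integral_windows[OF filt Ainc Aad T Alim[OF T] YZ p Z \<epsilon> \<kappa>2] by blast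
    obtain d' where d': "0 < d'" "\<And>i. holds_outside (M i) (\<kappa> / 2) (\<lambda>\<omega>. windows_le (real N) d' \<epsilon> (\<lambda>t. V' i t \<omega>))"
      unfolding V'_def using integral_windows[OF filt Ainc Aad T Alim[OF T] YZ' p' Z' \<epsilon> \<kappa>2] by blast
    have "holds_outside (M i) (\<kappa> / 2 + \<kappa> / 2) (near (min d d') i)" for i
      by (rule holds_outside_conj[OF d(2) d'(2)])
         (use that in \<open>auto simp: near_def intro: windows_le_antimono\<close>)
    then show ?thesis using d(1) d'(1) by (intro exI[of _ "min d d'"]) auto
  qed
  obtain \<delta> where \<delta>: "0 < \<delta>" "\<And>i. holds_outside (M i) (\<eta> / 2) (near \<delta> i)"
    using windows[of "\<eta> / 2"] \<eta> by auto
  show thesis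
  proof (rule that[OF \<delta>(1)])
    fix i
    interpret Mi: prob_space "M i" by (rule prob)
    obtain W where W: "W \<in> sets (M i)" "measure (M i) W \<le> \<eta> / 2" "\<And>\<omega>. \<omega> \<in> space (M i) - W \<Longrightarrow> near \<delta> i \<omega>"
      using Mi.holds_outside_measureE[OF \<delta>(2)] \<eta> by auto
    note mart = grid_martingale[OF YZ, where i=i, folded V_def]
    note mart' = grid_martingale[OF YZ', where i=i, folded V'_def]
    obtain L1 where L1: "0 \<le> L1" "\<And>L. L1 \<le> L \<Longrightarrow> (\<integral>\<omega>. max 0 (\<bar>Y i (real N) \<omega> - V i (real N) \<omega>\<bar> - L) \<partial>M i) \<le> \<epsilon>"
      using tail_integral_small[OF mart(4) \<epsilon>, of "real N"] by auto
    obtain L2 where L2: "0 \<le> L2" "\<And>L. L2 \<le> L \<Longrightarrow> (\<integral>\<omega>. max 0 (\<bar>Y' i (real N) \<omega> - V' i (real N) \<omega>\<bar> - L) \<partial>M i) \<le> \<epsilon>"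
      using tail_integral_small[OF mart'(4) \<epsilon>, of "real N"] by auto
    define L where "L = max L1 L2"
    have L: "0 \<le> L" using L1 by (simp add: L_def)
    \<comment> \<open>The denominator exceeds both \<open>C + L\<close> and
      \<open>C\<^sup>2 + L\<close>, as needed for \<open>f\<close> and for its square; the 1 keeps
      it positive.\<close>
    define \<kappa> where "\<kappa> = \<epsilon> / (C + C\<^sup>2 + L + 1)"
    have pos: "0 < C + C\<^sup>2 + L + 1" using C0 L by (simp add: add_nonneg_pos)
    then have \<kappa>: "0 < \<kappa>" using \<epsilon> by (simp add: \<kappa>_def)
    obtain d where d: "0 < d" "holds_outside (M i) \<kappa> (near d i)"
      using windows[OF \<kappa>] by blast
    obtain Q where Q: "Q \<in> sets (M i)" "measure (M i) Q \<le> \<kappa>" "\<And>\<omega>. \<omega> \<in> space (M i) - Q \<Longrightarrow> near d i \<omega>"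
      using Mi.holds_outside_measureE[OF d(2)] \<kappa> by auto
    have Qc: "b * measure (M i) Q \<le> \<epsilon>" if "0 \<le> b" "b \<le> C + C\<^sup>2 + L + 1" for b
    proof -
      have "b * measure (M i) Q \<le> (C + C\<^sup>2 + L + 1) * \<kappa>" using that Q(2) pos by (intro mult_mono) auto
      then show ?thesis using pos by (simp add: \<kappa>_def)
    qed
    obtain n0 where n0: "1 / 2 ^ n0 < d" using real_arch_pow_inv[OF d(1), of "1/2"] by (auto simp: power_one_over)
    show "\<exists>n0. \<forall>n\<ge>n0. rare_oscillation N r \<eta> \<delta> i n"
      unfolding rare_oscillation_def
    proof (intro exI[of _ n0] allI impI)
      fix n l \<sigma> assume n: "n0 \<le> n" and l: "real l / 2 ^ n \<le> \<delta>"
        and \<sigma>: "discrete_filtration.stopping (\<lambda>j. F i (real j / 2 ^ n)) (N * 2 ^ n) \<sigma>"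
      have h: "1 / 2 ^ n \<le> d"
      proof -
        have "(1::real) / 2 ^ n \<le> 1 / 2 ^ n0" using n by (intro divide_left_mono power_increasing) auto
        then show ?thesis using n0 by simp
      qed
      have jN: "real j / 2 ^ n \<le> real N" if "j \<le> N * 2 ^ n" for j
        using of_nat_mono[OF that, where 'a=real] by (simp add: field_simps)
      have Yb: "(\<integral>\<^sup>+\<omega>. (SUP t\<in>{0..real N} \<inter> \<rat>. ennreal \<bar>Y i t \<omega> - g i t \<omega>\<bar>) \<partial>M i) \<le> ennreal \<epsilon>"
        unfolding g_def using Y by (meson SUP_upper UNIV_I less_imp_le order_trans)
      have Yb': "(\<integral>\<^sup>+\<omega>. (SUP t\<in>{0..real N} \<inter> \<rat>. ennreal \<bar>Y' i t \<omega> - g i t \<omega> * g i t \<omega>\<bar>) \<partial>M i) \<le> ennreal \<epsilon>"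
        unfolding g_def using Y' by (meson SUP_upper UNIV_I less_imp_le order_trans)
      have YM: "\<forall>t\<ge>0. Y i t \<in> borel_measurable (M i)" "\<forall>t\<ge>0. Y' i t \<in> borel_measurable (M i)"
        using measurable_from_subalg[OF sub mart(2)] measurable_from_subalg[OF sub mart'(2)] by auto
      have ggM: "\<forall>t\<ge>0. g i t \<in> borel_measurable (M i)" "\<forall>t\<ge>0. (\<lambda>\<omega>. g i t \<omega> * g i t \<omega>) \<in> borel_measurable (M i)"
        by (auto intro!: borel_measurable_times gM)
      note D = max_deviation_integral[OF YM(1) ggM(1) Yb less_imp_le[OF \<epsilon>], where n=n]
      note D' = max_deviation_integral[OF YM(2) ggM(2) Yb' less_imp_le[OF \<epsilon>], where n=n]
      interpret two_approximations "M i" "\<lambda>j. F i (real j / 2 ^ n)" "N * 2 ^ n"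
        "\<lambda>j. g i (real j / 2 ^ n)" "\<lambda>j. Y i (real j / 2 ^ n)" "\<lambda>j. V i (real j / 2 ^ n)"
        "\<lambda>j. Y' i (real j / 2 ^ n)" "\<lambda>j. V' i (real j / 2 ^ n)" C \<epsilon> \<epsilon> L Q
        "\<lambda>\<omega>. Max ((\<lambda>j. \<bar>Y i (real j / 2 ^ n) \<omega> - g i (real j / 2 ^ n) \<omega>\<bar>) ` {..N * 2 ^ n})"
        "\<lambda>\<omega>. Max ((\<lambda>j. \<bar>Y' i (real j / 2 ^ n) \<omega> - g i (real j / 2 ^ n) \<omega> * g i (real j / 2 ^ n) \<omega>\<bar>) ` {..N * 2 ^ n})"
      proof (intro two_approximations.intro two_approximations_axioms.intro grid)
        show "\<bar>g i (real j / 2 ^ n) \<omega>\<bar> \<le> C" for j \<omega> by (simp add: g_def C)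
        show "\<bar>Y' i (real j / 2 ^ n) \<omega> - (g i (real j / 2 ^ n) \<omega>)\<^sup>2\<bar>
          \<le> Max ((\<lambda>j. \<bar>Y' i (real j / 2 ^ n) \<omega> - g i (real j / 2 ^ n) \<omega> * g i (real j / 2 ^ n) \<omega>\<bar>) ` {..N * 2 ^ n})"
          if "j \<le> N * 2 ^ n" for j \<omega> using D'(3)[OF that] by (simp add: power2_eq_square)
        show "(C + L) * measure (M i) Q \<le> \<epsilon>" "(C\<^sup>2 + L) * measure (M i) Q \<le> \<epsilon>"
          using C0 L by (auto intro!: Qc)
        have inc: "\<bar>V i (real (Suc j) / 2 ^ n) \<omega> - V i (real j / 2 ^ n) \<omega>\<bar> \<le> \<epsilon> \<and>
            \<bar>V' i (real (Suc j) / 2 ^ n) \<omega> - V' i (real j / 2 ^ n) \<omega>\<bar> \<le> \<epsilon>"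
          if "\<omega> \<in> space (M i) - Q" "j < N * 2 ^ n" for \<omega> j
          by (rule nearD[OF Q(3)[OF that(1)]]) (use h jN[of "Suc j"] that(2) in \<open>auto simp: add_divide_distrib divide_right_mono\<close>)
        show "\<bar>V i (real (Suc j) / 2 ^ n) \<omega> - V i (real j / 2 ^ n) \<omega>\<bar> \<le> \<epsilon>"
          "\<bar>V' i (real (Suc j) / 2 ^ n) \<omega> - V' i (real j / 2 ^ n) \<omega>\<bar> \<le> \<epsilon>"
          if "\<omega> \<in> space (M i) - Q" "j < N * 2 ^ n" for \<omega> j using inc[OF that] by blast+
        show "(\<integral>\<omega>. max 0 (\<bar>Y i (real (N * 2 ^ n) / 2 ^ n) \<omega> - V i (real (N * 2 ^ n) / 2 ^ n) \<omega>\<bar> - L) \<partial>M i) \<le> \<epsilon>"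
          using L1(2)[of L] by (simp add: L_def)
        show "(\<integral>\<omega>. max 0 (\<bar>Y' i (real (N * 2 ^ n) / 2 ^ n) \<omega> - V' i (real (N * 2 ^ n) / 2 ^ n) \<omega>\<bar> - L) \<partial>M i) \<le> \<epsilon>"
          using L2(2)[of L] by (simp add: L_def)
      qed (use D D' mart mart' gF L Q(1) \<epsilon> in \<open>auto\<close>)
      have VW: "\<bar>V i (real j / 2 ^ n) \<omega> - V i (real k / 2 ^ n) \<omega>\<bar> \<le> \<epsilon> \<and> \<bar>V' i (real j / 2 ^ n) \<omega> - V' i (real k / 2 ^ n) \<omega>\<bar> \<le> \<epsilon>"
        if "\<omega> \<in> space (M i) - W" "k \<le> j" "j \<le> k + l" "j \<le> N * 2 ^ n" for \<omega> k j
      proof (rule nearD[OF W(3)[OF that(1)]])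
        have "real j \<le> real k + real l" using that(3) by linarith
        then have "real j / 2 ^ n \<le> (real k + real l) / 2 ^ n" by (rule divide_right_mono) simp
        then show "real j / 2 ^ n \<le> real k / 2 ^ n + \<delta>" using l by (simp add: add_divide_distrib)
      qed (use that jN in \<open>auto simp: divide_right_mono\<close>)
      obtain E where E: "E \<in> sets (M i)" "measure (M i) E \<le> (1 + 2 * C) * (2 * \<epsilon> + 8 * \<epsilon>) / r\<^sup>2 + measure (M i) W"
        "\<And>\<omega> j. \<omega> \<in> space (M i) \<Longrightarrow> \<sigma> \<omega> \<le> j \<Longrightarrow> j \<le> \<sigma> \<omega> + l \<Longrightarrow> j \<le> N * 2 ^ n \<Longrightarrow>
          r \<le> \<bar>g i (real j / 2 ^ n) \<omega> - g i (real (\<sigma> \<omega>) / 2 ^ n) \<omega>\<bar> \<Longrightarrow> \<omega> \<in> E"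
        using window_oscillation[OF \<sigma> r W(1) VW] by blast
      have "measure (M i) E \<le> \<eta>" using E(2) W(2) small by linarith
      then show "holds_outside (M i) \<eta> (\<lambda>\<omega>. \<forall>j. \<sigma> \<omega> \<le> j \<longrightarrow> j \<le> \<sigma> \<omega> + l \<longrightarrow> j \<le> N * 2 ^ n \<longrightarrow>
          \<bar>g i (real j / 2 ^ n) \<omega> - g i (real (\<sigma> \<omega>) / 2 ^ n) \<omega>\<bar> < r)"
        using E(3) by (intro Mi.holds_outside_measureI[OF E(1)]) (auto simp: not_le[symmetric])
    qed
  qed
qed

text \<open>Two scales: \<open>\<delta>0\<close> limits the number of jumps to \<open>q\<close> with
  high probability, then \<open>\<delta>1\<close> is chosen for the failure probability
  \<open>\<eta> / q\<close> per gap. \<open>q\<close> is the same for all indices and grids, since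
  the horizon and the windows scale alike with \<open>2 ^ n\<close>.\<close>

lemma level_probability:
  assumes N: "0 < N" and r: "0 < r" and \<eta>: "0 < \<eta>"
  obtains \<delta> where "0 < \<delta>"
    "\<And>i. \<exists>n0. \<forall>n\<ge>n0. holds_outside (M i) (3 * \<eta>)
      (\<lambda>\<omega>. \<exists>p\<in>step_data \<delta> (real N) C. \<forall>j. fits_at p r (real N) (\<lambda>(n, j::nat). g i (j / 2 ^ n) \<omega>) n j)"
proof -
  obtain \<delta>0 where \<delta>0: "0 < \<delta>0" and O0: "\<And>i. \<exists>n0. \<forall>n\<ge>n0. rare_oscillation N r \<eta> \<delta>0 i n"
    using uniform_window_oscillation[OF N r \<eta>] by blast
  define q where "q = nat \<lceil>2 * real N / \<delta>0\<rceil>"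
  have q: "0 < q" "2 * real N \<le> real q * \<delta>0"
  proof -
    have pos: "0 < 2 * real N / \<delta>0" using N \<delta>0 by simp
    then show "0 < q" by (simp add: q_def)
    have "2 * real N / \<delta>0 \<le> real q" using pos unfolding q_def by linarith
    then show "2 * real N \<le> real q * \<delta>0" using \<delta>0 by (simp add: field_simps)
  qed
  have \<eta>q: "0 < \<eta> / real q" using \<eta> q by simp
  obtain \<delta>1 where \<delta>1: "0 < \<delta>1" and O1: "\<And>i. \<exists>n0. \<forall>n\<ge>n0. rare_oscillation N r (\<eta> / real q) \<delta>1 i n"
    using uniform_window_oscillation[OF N r \<eta>q] by blast
  define \<delta> where "\<delta> = min \<delta>1 (real N)"
  have \<delta>: "0 < \<delta>" "\<delta> \<le> \<delta>1" "\<delta> \<le> real N" using \<delta>1 N by (auto simp: \<delta>_def)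
  show thesis
  proof (rule that[OF \<delta>(1)])
    fix i
    interpret Mi: prob_space "M i" by (rule prob)
    obtain n0 where n0: "\<And>n. n0 \<le> n \<Longrightarrow> rare_oscillation N r \<eta> \<delta>0 i n" using O0[of i] by blast
    obtain n1 where n1: "\<And>n. n1 \<le> n \<Longrightarrow> rare_oscillation N r (\<eta> / real q) \<delta>1 i n" using O1[of i] by blast
    show "\<exists>n0. \<forall>n\<ge>n0. holds_outside (M i) (3 * \<eta>)
      (\<lambda>\<omega>. \<exists>p\<in>step_data \<delta> (real N) C. \<forall>j. fits_at p r (real N) (\<lambda>(n, j::nat). g i (j / 2 ^ n) \<omega>) n j)"
    proof (intro exI[of _ "max n0 n1"] allI impI)
      fix n assume n: "max n0 n1 \<le> n"
      define \<xi> where "\<xi> j \<omega> = g i (real j / 2 ^ n) \<omega>" for j \<omega>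
      interpret discrete_filtration "M i" "\<lambda>j. F i (real j / 2 ^ n)" "N * 2 ^ n" by (rule grid)
      have \<xi>m: "\<xi> j \<in> borel_measurable (F i (real j / 2 ^ n))" for j
        unfolding \<xi>_def[abs_def] by (rule gF) simp
      have gap: "measure (M i) (short_gap \<xi> r l k) \<le> \<kappa>"
        if rare: "rare_oscillation N r \<kappa> d i n" and l: "real l / 2 ^ n \<le> d" and "0 < \<kappa>" for \<kappa> d l k
      proof -
        obtain E where E: "E \<in> sets (M i)" "measure (M i) E \<le> \<kappa>" "\<And>\<omega>. \<omega> \<in> space (M i) - E \<Longrightarrow>
            \<forall>j. jump \<xi> r k \<omega> \<le> j \<longrightarrow> j \<le> jump \<xi> r k \<omega> + l \<longrightarrow> j \<le> N * 2 ^ n \<longrightarrow>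
              \<bar>g i (real j / 2 ^ n) \<omega> - g i (real (jump \<xi> r k \<omega>) / 2 ^ n) \<omega>\<bar> < r"
          using Mi.holds_outside_measureE[OF rare[unfolded rare_oscillation_def, rule_format, OF l jump_stopping[OF \<xi>m]] less_imp_le[OF \<open>0 < \<kappa>\<close>]]
          by blast
        have "short_gap \<xi> r l k \<subseteq> E"
        proof (rule subsetI, rule ccontr)
          fix \<omega> assume "\<omega> \<in> short_gap \<xi> r l k" "\<omega> \<notin> E"
          then have S: "\<omega> \<in> space (M i) - E" "jump \<xi> r (Suc k) \<omega> \<le> N * 2 ^ n" "jump \<xi> r (Suc k) \<omega> \<le> jump \<xi> r k \<omega> + l"
            by (auto simp: short_gap_def)
          have "r \<le> \<bar>\<xi> (jump \<xi> r (Suc k) \<omega>) \<omega> - \<xi> (jump \<xi> r k \<omega>) \<omega>\<bar>"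
            by (rule next_jump_cases[of "jump \<xi> r k \<omega>" \<xi> r \<omega>]) (use S(2) in \<open>auto simp: jump_Suc\<close>)
          then show False
            using E(3)[OF S(1), rule_format, OF _ S(3,2)] jump_mono[of k "Suc k" \<xi> r \<omega>] by (simp add: \<xi>_def)
        qed
        then show ?thesis using Mi.finite_measure_mono[OF _ E(1)] E(2) by (meson order_trans)
      qed
      \<comment> \<open>Rounding down keeps \<open>l0\<close> grid steps within
        \<open>\<delta>0\<close>, so gaps that short are rare, while \<open>l0 + 1\<close> steps
        cover \<open>\<delta>0\<close>, as the count of jumps requires. In the same way
        \<open>l1 + 1\<close> steps cover \<open>\<delta>1\<close>, which gives the spacing.\<close>
      define l0 where "l0 = nat \<lfloor>\<delta>0 * 2 ^ n\<rfloor>"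
      define l1 where "l1 = nat \<lfloor>\<delta>1 * 2 ^ n\<rfloor>"
      have "real l0 \<le> \<delta>0 * 2 ^ n" "\<delta>0 * 2 ^ n \<le> real l0 + 1" "real l1 \<le> \<delta>1 * 2 ^ n" "\<delta>1 * 2 ^ n \<le> real l1 + 1"
        using \<delta>0 \<delta>1 by (auto simp: l0_def l1_def)
      then have l: "real l0 / 2 ^ n \<le> \<delta>0" "\<delta>0 \<le> (real l0 + 1) / 2 ^ n" "real l1 / 2 ^ n \<le> \<delta>1" "\<delta>1 \<le> (real l1 + 1) / 2 ^ n"
        by (simp_all add: field_simps)
      have P0: "measure (M i) (short_gap \<xi> r l0 k) \<le> \<eta>" for k
        by (rule gap[OF n0 l(1) \<eta>]) (use n in simp)
      have P1: "measure (M i) (short_gap \<xi> r l1 k) \<le> \<eta> / real q" for k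
        by (rule gap[OF n1 l(3) \<eta>q]) (use n in simp)
      have "real (2 * (N * 2 ^ n)) \<le> real (q * (l0 + 1))"
      proof -
        have "2 * real N \<le> real q * ((real l0 + 1) / 2 ^ n)"
          using q(2) mult_left_mono[OF l(2), of "real q"] by linarith
        then show ?thesis by (simp add: field_simps)
      qed
      then have q2: "2 * (N * 2 ^ n) \<le> q * (l0 + 1)" by (rule of_nat_le_iff[THEN iffD1])
      define E where "E = (\<Union>k. short_gap \<xi> r l1 k)"
      have E: "E \<in> sets (M i)" "measure (M i) E \<le> 3 * \<eta>"
        unfolding E_def by (rule prob_short_gap[OF \<xi>m P0 q(1) q2 P1])+
      have "\<exists>p\<in>step_data \<delta> (real N) C. \<forall>j. fits_at p r (real N) (\<lambda>(n, j::nat). g i (j / 2 ^ n) \<omega>) n j"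
        if "\<omega> \<in> space (M i) - E" for \<omega>
      proof -
        define p where "p k = (real (jump \<xi> r k \<omega>) * (1 / 2 ^ n), \<xi> (jump \<xi> r k \<omega>) \<omega>)" for k
        have \<xi>C: "\<bar>\<xi> j \<omega>\<bar> \<le> C" for j by (simp add: \<xi>_def g_def C)
        have w: "\<omega> \<in> space (M i)" "\<omega> \<notin> short_gap \<xi> r l1 k" for k using that by (auto simp: E_def)
        have h: "0 < (1::real) / 2 ^ n" "(1::real) / 2 ^ n \<le> 1" "real (N * 2 ^ n) * (1 / 2 ^ n) = real N" by auto
        have d: "\<delta> \<le> (real l1 + 1) * (1 / 2 ^ n)" using l(4) \<delta>(2) by simp
        note S = jump_step_data[of \<xi> \<omega> C, OF \<xi>C w h d \<delta>(3), folded p_def]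
        have "fits_at p r (real N) (\<lambda>(n, j::nat). g i (j / 2 ^ n) \<omega>) n j" for j
          unfolding fits_at_def using S(2)[of _ j] by (simp add: \<xi>_def)
        then show ?thesis using S(1) by (auto simp: p_def[abs_def])
      qed
      then show "holds_outside (M i) (3 * \<eta>)
        (\<lambda>\<omega>. \<exists>p\<in>step_data \<delta> (real N) C. \<forall>j. fits_at p r (real N) (\<lambda>(n, j::nat). g i (j / 2 ^ n) \<omega>) n j)"
        by (rule Mi.holds_outside_measureI[OF E])
    qed
  qed
qed

text \<open>The events on the grids decrease as the grid is refined, and compactness of the step
  data identifies their intersection, so the bound passes to the limit. The level from which it
  holds may depend on the index, which is fixed when the limit is taken.\<close>

lemma fits_probability:
  assumes r: "0 < r" and \<eta>: "0 < \<eta>"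
  obtains \<delta> where "0 < \<delta>"
    "\<And>i. 1 - \<eta> \<le> measure (M i) {\<omega> \<in> space (M i). \<exists>p\<in>step_data \<delta> (real N) C. fits p r (real N) (\<lambda>(n, j::nat). g i (j / 2 ^ n) \<omega>)}"
proof (cases "N = 0")
  case True
  \<comment> \<open>At horizon 0 no dyadic time is constrained, so any step data will do; with
    \<open>H = 0\<close> and \<open>\<delta> = 1\<close> unit spacing is forced.\<close>
  have "(\<lambda>k. (real k, 0)) \<in> step_data 1 0 C" using C0 by (simp add: step_data_def)
  moreover have "fits p r 0 v" for p v
    by (simp add: fits_def fits_at_def divide_less_0_iff)
  ultimately have "{\<omega> \<in> space (M i). \<exists>p\<in>step_data 1 (real N) C. fits p r (real N) (\<lambda>(n, j::nat). g i (j / 2 ^ n) \<omega>)} = space (M i)" for i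
    using True by auto
  moreover have "1 - \<eta> \<le> measure (M i) (space (M i))" for i
    using prob_space.prob_space[OF prob, of i] \<eta> by simp
  ultimately show thesis using that[of 1] by simp
next
  case False
  then have N: "0 < N" by simp
  have "0 < \<eta> / 3" using \<eta> by simp
  from level_probability[OF N r this] obtain \<delta> where \<delta>: "0 < \<delta>"
    and level: "\<And>i. \<exists>n0. \<forall>n\<ge>n0. holds_outside (M i) (3 * (\<eta> / 3))
      (\<lambda>\<omega>. \<exists>p\<in>step_data \<delta> (real N) C. \<forall>j. fits_at p r (real N) (\<lambda>(n, j::nat). g i (j / 2 ^ n) \<omega>) n j)"
    by blast
  show thesis
  proof (rule that[OF \<delta>])
    fix i
    interpret prob_space "M i" by (rule prob)
    define v where "v \<omega> = (\<lambda>(n, j::nat). g i (j / 2 ^ n) \<omega>)" for \<omega>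
    define B where "B n = {\<omega> \<in> space (M i). \<exists>p\<in>step_data \<delta> (real N) C. \<forall>j. fits_at p r (real N) (v \<omega>) n j}" for n
    have vm: "v \<in> borel_measurable (M i)"
      by (rule measurable_coordinatewise_then_product) (auto simp: v_def split: prod.split intro!: gM)
    have Bm: "B n \<in> sets (M i)" for n
    proof -
      have "v -` {v. \<exists>p\<in>step_data \<delta> (real N) C. \<forall>n\<in>{n}. \<forall>j. fits_at p r (real N) v n j} \<inter> space (M i) \<in> sets (M i)"
        by (rule measurable_sets[OF vm borel_closed[OF closed_step_data_fits[OF \<delta>]]])
      also have "v -` {v. \<exists>p\<in>step_data \<delta> (real N) C. \<forall>n\<in>{n}. \<forall>j. fits_at p r (real N) v n j} \<inter> space (M i) = B n"
        by (auto simp: B_def)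
      finally show ?thesis .
    qed
    have coarser: "\<forall>j. fits_at p r (real N) (v \<omega>) k j" if "k \<le> n" "\<forall>j. fits_at p r (real N) (v \<omega>) n j" for p k n \<omega>
      using fits_at_coarser[of k n p r "real N" "\<lambda>t. g i t \<omega>"] that by (simp add: v_def)
    have dec: "decseq B" unfolding decseq_def B_def using coarser by blast
    have "(\<Inter>n. B n) = {\<omega> \<in> space (M i). \<exists>p\<in>step_data \<delta> (real N) C. fits p r (real N) (v \<omega>)}"
    proof (intro set_eqI iffI)
      fix \<omega> assume w: "\<omega> \<in> (\<Inter>n. B n)"
      have "\<exists>p\<in>step_data \<delta> (real N) C. fits p r (real N) (v \<omega>)"
      proof (rule fits_iff_all_levels[OF \<delta>])
        show "\<exists>p\<in>step_data \<delta> (real N) C. \<forall>j. fits_at p r (real N) (v \<omega>) n j" for n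
          using w unfolding B_def by blast
      qed (rule coarser)
      then show "\<omega> \<in> {\<omega> \<in> space (M i). \<exists>p\<in>step_data \<delta> (real N) C. fits p r (real N) (v \<omega>)}"
        using w by (auto simp: B_def)
    qed (auto simp: B_def fits_def)
    moreover have "(\<lambda>n. prob (B n)) \<longlonglongrightarrow> prob (\<Inter>n. B n)"
      using Bm by (intro finite_Lim_measure_decseq dec) auto
    moreover have "\<forall>\<^sub>F n in sequentially. 1 - \<eta> \<le> prob (B n)"
    proof -
      obtain n0 where n0: "\<And>n. n0 \<le> n \<Longrightarrow> holds_outside (M i) \<eta>
          (\<lambda>\<omega>. \<exists>p\<in>step_data \<delta> (real N) C. \<forall>j. fits_at p r (real N) (v \<omega>) n j)"
        using level[of i] unfolding v_def by auto
      have "1 - \<eta> \<le> prob (B n)" if "n0 \<le> n" for n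
      proof -
        obtain E where E: "E \<in> sets (M i)" "prob E \<le> \<eta>" "space (M i) - E \<subseteq> B n"
        proof (rule holds_outside_measureE[OF n0[OF \<open>n0 \<le> n\<close>] less_imp_le[OF \<eta>]])
          fix E assume "E \<in> sets (M i)" "prob E \<le> \<eta>"
            "\<And>\<omega>. \<omega> \<in> space (M i) - E \<Longrightarrow> \<exists>p\<in>step_data \<delta> (real N) C. \<forall>j. fits_at p r (real N) (v \<omega>) n j"
          then show thesis by (intro that) (auto simp: B_def)
        qed
        have "1 - \<eta> \<le> prob (space (M i) - E)" using E prob_compl[OF E(1)] by simp
        also have "\<dots> \<le> prob (B n)" by (rule finite_measure_mono[OF E(3) Bm])
        finally show ?thesis .
      qed
      then show ?thesis unfolding eventually_sequentially by blast
    qed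
    ultimately show "1 - \<eta> \<le> prob {\<omega> \<in> space (M i). \<exists>p\<in>step_data \<delta> (real N) C. fits p r (real N) (\<lambda>(n, j::nat). g i (j / 2 ^ n) \<omega>)}"
      unfolding v_def using tendsto_lowerbound[of "\<lambda>n. prob (B n)" _ sequentially "1 - \<eta>"] by simp
  qed
qed

theorem tight: "tight_family skorokhod_topology M (\<lambda>i \<omega>. \<lambda>t\<in>{0..}. f (X i t \<omega>))"
  unfolding tight_family_def
proof (intro allI impI)
  fix \<epsilon> :: real assume \<epsilon>: "0 < \<epsilon>"
  \<comment> \<open>Level \<open>N\<close> may fail with probability
    \<open>\<epsilon> / 2 ^ (N + 1)\<close>; these sum to \<open>\<epsilon>\<close> over all
    levels.\<close>
  define good where "good N d \<longleftrightarrow> 0 < d \<and> (\<forall>i. 1 - \<epsilon> * (1 / 2) ^ Suc N \<le> measure (M i) {\<omega> \<in> space (M i).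
      \<exists>p\<in>step_data d (real N) C. fits p (1 / (real N + 1)) (real N) (\<lambda>(n, j::nat). g i (j / 2 ^ n) \<omega>)})" for N d
  have "\<exists>d. good N d" for N
  proof -
    have "0 < 1 / (real N + 1)" "0 < \<epsilon> * (1 / 2) ^ Suc N" using \<epsilon> by simp_all
    from fits_probability[OF this, of N] show ?thesis unfolding good_def by blast
  qed
  then obtain \<delta> where "\<And>N. good N (\<delta> N)" by metis
  then have \<delta>: "\<And>N. 0 < \<delta> N" and P: "\<And>N i. 1 - \<epsilon> * (1 / 2) ^ Suc N \<le> measure (M i) {\<omega> \<in> space (M i).
      \<exists>p\<in>step_data (\<delta> N) (real N) C. fits p (1 / (real N + 1)) (real N) (\<lambda>(n, j::nat). g i (j / 2 ^ n) \<omega>)}"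
    unfolding good_def by simp_all
  define K where "K = skorokhod_compact \<delta> C"
  have "1 - \<epsilon> \<le> measure (M i) {\<omega> \<in> space (M i). (\<lambda>t\<in>{0..}. f (X i t \<omega>)) \<in> K}" for i
  proof -
    interpret prob_space "M i" by (rule prob)
    define G where "G N = {\<omega> \<in> space (M i).
      \<exists>p\<in>step_data (\<delta> N) (real N) C. fits p (1 / (real N + 1)) (real N) (\<lambda>(n, j::nat). g i (j / 2 ^ n) \<omega>)}" for N
    have eq: "{\<omega> \<in> space (M i). (\<lambda>t\<in>{0..}. f (X i t \<omega>)) \<in> K} = (\<Inter>N. G N)" and Gm: "G N \<in> sets (M i)" for N
      using skorokhod_compact_measurable[of "g i" "M i" \<delta> G C, OF gM g_cadlag \<delta> G_def] by (simp_all add: K_def g_def)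
    have "emeasure (M i) (\<Union>N. space (M i) - G N) \<le> (\<Sum>N. emeasure (M i) (space (M i) - G N))"
      using Gm by (intro emeasure_subadditive_countably) auto
    also have "\<dots> \<le> (\<Sum>N. ennreal (\<epsilon> * (1 / 2) ^ Suc N))"
    proof (intro suminf_le)
      show "emeasure (M i) (space (M i) - G N) \<le> ennreal (\<epsilon> * (1 / 2) ^ Suc N)" for N
        using P[of N i] prob_compl[OF Gm[of N]] by (simp add: emeasure_eq_measure G_def[symmetric] ennreal_leI)
    qed auto
    also have "\<dots> = ennreal (\<epsilon> * 1)"
      using \<epsilon> by (intro suminf_ennreal_eq sums_mult power_half_series) auto
    finally have "prob (\<Union>N. space (M i) - G N) \<le> \<epsilon>" using \<epsilon> by (simp add: emeasure_eq_measure)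
    moreover have "(\<Union>N. space (M i) - G N) = space (M i) - (\<Inter>N. G N)" by auto
    moreover have "(\<Inter>N. G N) \<in> sets (M i)" using Gm by auto
    ultimately show ?thesis using prob_compl[of "\<Inter>N. G N"] by (simp add: eq)
  qed
  moreover have "compactin skorokhod_topology K" unfolding K_def by (rule compactin_skorokhod_compact[OF \<delta>])
  ultimately show "\<exists>K. compactin skorokhod_topology K \<and>
      (\<forall>i. 1 - \<epsilon> \<le> measure (M i) {\<omega> \<in> space (M i). (\<lambda>t\<in>{0..}. f (X i t \<omega>)) \<in> K})" by blast
qed

end

theorem theorem3p1:
  fixes M :: "'i \<Rightarrow> 'a measure"
    and F :: "'i \<Rightarrow> real \<Rightarrow> 'a measure"
    and X :: "'i \<Rightarrow> real \<Rightarrow> 'a \<Rightarrow> 'e::metric_space"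
    and A :: "'i \<Rightarrow> real \<Rightarrow> 'a \<Rightarrow> real"
    and Ca :: "('e \<Rightarrow> real) set"
  assumes "\<And>i. prob_space (M i)"
    and "\<And>i. filtered (M i) (F i)"
    and "\<And>i. adapted (F i) (X i)"
    and "\<And>i \<omega>. \<omega> \<in> space (M i) \<Longrightarrow> cadlag (\<lambda>t. X i t \<omega>)"
    and "\<And>i. adapted (F i) (A i)"
    and "\<And>i. increasing_process (M i) (A i)"
    and "\<And>T. T > 0 \<Longrightarrow>
      ((\<lambda>\<delta>. SUP i. \<integral>\<^sup>+\<omega>. (SUP r\<in>{0..T}. ennreal \<bar>A i (r + \<delta>) \<omega> - A i r \<omega>\<bar>) \<partial>M i)
        \<longlongrightarrow> 0) (at_right 0)"
    and "subalgebra_of_bdd_unif_cont Ca"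
    and "Ca \<subseteq> approximable_functions M F X A"
  shows "\<forall>f\<in>Ca. tight_family skorokhod_topology M (\<lambda>i \<omega>. \<lambda>t\<in>{0..}. f (X i t \<omega>))"
proof
  fix f assume f: "f \<in> Ca"
  \<comment> \<open>The algebra structure enters here: the square of \<open>f\<close> is
    approximable as well.\<close>
  then have "f \<in> bdd_unif_cont" and f2: "(\<lambda>x. f x * f x) \<in> Ca"
    using assms(8) by (auto simp: subalgebra_of_bdd_unif_cont_def)
  then obtain C where C: "\<And>x. \<bar>f x\<bar> \<le> C" by (auto simp: bdd_unif_cont_def bounded_iff)
  interpret approximable_process M F X A f C
    by (rule approximable_process.intro) (fact assms C subsetD[OF assms(9) f] subsetD[OF assms(9) f2])+
  show "tight_family skorokhod_topology M (\<lambda>i \<omega>. \<lambda>t\<in>{0..}. f (X i t \<omega>))" by (rule tight)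
qed

end
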